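(* Let $S=\mathbb{Z}_{\leq 0}\times\{0\}\subset\mathbb{R}^2$ and let $G:\mathbb{R}^2\smallsetminus S\to\mathbb{R}^2$ be $G(x,y)=(\operatorname{Re}\Gamma(x+iy),\operatorname{Im}\Gamma(x+iy))$, where $\Gamma$ is the (meromorphically continued) Gamma function. If $\mathcal{V}\subset\mathbb{R}^2$ is a weakly bialgebraic curve for $G$, then $\mathcal{V}$ is the $x$-axis $\{(x,0):x\in\mathbb{R}\}$.
   Context: A non-empty subset $\mathcal{V}\subsetneq\mathbb{R}^2$ is called a weakly bialgebraic curve for $G$ if (1) $\mathcal{V}$ is not a singleton and there exist algebraic subvarieties $V\subset\mathbb{A}^2_{\mathbb{R}}$ and $W\subsetneq\mathbb{A}^2_{\mathbb{R}}$ such that $\mathcal{V}=V(\mathbb{R})$ and $G(\mathcal{V}\cap(\mathbb{R}^2\smallsetminus S))\subset W(\mathbb{R})$; and (2) $\mathcal{V}$ cannot be written as $V_1(\mathbb{R})\cup V_2(\mathbb{R})$ with $V_1,V_2\subset\mathbb{A}^2_{\mathbb{R}}$ algebraic subvarieties such that both inclusions $V_i(\mathbb{R})\subset\mathcal{V}$ are proper. *)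

theory Defs
  imports "HOL-Analysis.Analysis" "HOL-Computational_Algebra.Polynomial"
begin

text \<open>
  A polynomial in \<open>\<real>[x,y]\<close> is encoded as an element of \<open>\<real>[x][y]\<close>: the inner variable is \<open>x\<close>
  and the outer variable is \<open>y\<close>.
\<close>

definition bpoly :: "real poly poly \<Rightarrow> real \<times> real \<Rightarrow> real" where
  "bpoly p z = poly (poly p [:snd z:]) (fst z)"

text \<open>
  An algebraic subvariety of the affine plane over \<open>\<real>\<close> is given by a set of defining equations.
  It may be reducible, and it is a proper subvariety iff some defining equation is not the zero
  polynomial.
\<close>

definition real_points :: "real poly poly set \<Rightarrow> (real \<times> real) set" where
  "real_points F = {z. \<forall>p\<in>F. bpoly p z = 0}"

definition proper_subvariety :: "real poly poly set \<Rightarrow> bool" where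
  "proper_subvariety F \<longleftrightarrow> (\<exists>p\<in>F. p \<noteq> 0)"

text \<open>
  The function \<open>G\<close> is regarded as defined on the complement of \<open>S\<close> only; its values on \<open>S\<close> are
  never used.
\<close>

definition weakly_bialgebraic_curve ::
  "(real \<times> real) set \<Rightarrow> (real \<times> real \<Rightarrow> real \<times> real) \<Rightarrow> (real \<times> real) set \<Rightarrow> bool" where
  "weakly_bialgebraic_curve S G \<V> \<longleftrightarrow>
     \<V> \<noteq> {} \<and> \<V> \<subset> UNIV \<and>
     \<not> is_singleton \<V> \<and>
     (\<exists>V W. proper_subvariety W \<and> \<V> = real_points V \<and> G ` (\<V> \<inter> (UNIV - S)) \<subseteq> real_points W) \<and>
     \<not> (\<exists>V\<^sub>1 V\<^sub>2. \<V> = real_points V\<^sub>1 \<union> real_points V\<^sub>2 \<and>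
           real_points V\<^sub>1 \<subset> \<V> \<and> real_points V\<^sub>2 \<subset> \<V>)"

definition Gamma_poles :: "(real \<times> real) set" where
  "Gamma_poles = \<int>\<^sub>\<le>\<^sub>0 \<times> {0}"

definition Gamma_plane :: "real \<times> real \<Rightarrow> real \<times> real" where
  "Gamma_plane = (\<lambda>(x, y). (Re (Gamma (Complex x y)), Im (Gamma (Complex x y))))"

end

theory Submission
  imports Defs "HOL-Complex_Analysis.Complex_Analysis"
    "HOL-Computational_Algebra.Fundamental_Theorem_Algebra"
begin

text \<open>
  With \<open>z = x + iy\<close> and \<open>w = x - iy\<close>, a curve that is not the real axis satisfies \<open>P(z, w) = 0\<close>, and since
  \<open>\<Gamma>\<close> commutes with conjugation, \<open>Q(1/\<Gamma>(z), 1/\<Gamma>(w)) = 0\<close>, for polynomials \<open>P\<close>, \<open>Q\<close> of minimal degree in the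
  second variable. Starting from a nonreal point \<open>a\<close> of the curve, \<open>w\<close> continues to a holomorphic function
  \<open>\<phi>(z)\<close> on a star-shaped slit plane, which contains discs of fixed radius around \<open>-n\<close> for all large \<open>n\<close>
  because \<open>a\<close> is not real. The relation \<open>Q\<close> persists there. As \<open>1/\<Gamma>\<close> takes every real value within
  distance \<open>O(1/n!)\<close> of \<open>-n\<close>, whereas \<open>\<phi>\<close> and \<open>\<phi>'\<close> are of polynomial size, the relation forces \<open>\<phi>(-n)\<close> to be
  extremely close to an integer \<open>-m\<close> with \<open>\<bar>m - n\<bar>\<close> bounded. So \<open>P(-n, -n + k)\<close> is tiny for a fixed integer
  \<open>k\<close> and infinitely many \<open>n\<close>, hence \<open>w - z - k\<close> divides \<open>P\<close>, which is impossible at nonreal points.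
\<close>

section \<open>Polynomials in two variables\<close>

text \<open>Passing from \<open>Gamma\<close> to \<open>rGamma\<close> matters because
  \<open>rGamma\<close> is entire: no condition arises on the values of \<phi>, so the relation
  \<open>Q\<close> spreads over the whole domain of \<phi>, including discs about the points -n. In
  place of irreducible factors, \<open>Q\<close> and then \<open>P\<close> are chosen of least
  degree among the polynomials that vanish on an uncountable part of the curve. A factor of lower
  degree has only countably many zeros there, and countable sets (isolated points, ramification
  points, fibres of \<open>rGamma\<close>) are discarded throughout; this is why the off-axis part
  of a real curve is shown to be uncountable as soon as it is infinite. Least degree yields Bezout
  identities between \<open>P\<close> and each of its partial derivatives. They supply simple roots
  outside a finite set, and polynomial bounds for \<phi>' in both directions. The factor w - z - k
  contradicts least degree because at w = cnj z it has imaginary part -2 Im z. Irreducibility of the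
  curve enters only in the final theorem: a curve with finite off-axis part is the union of its
  trace on the axis and a finite set.\<close>

definition poly2 :: "'a::comm_ring_1 poly poly \<Rightarrow> 'a \<Rightarrow> 'a \<Rightarrow> 'a" where
  "poly2 p x y = poly (poly p [:y:]) x"

lemma poly2_simps [simp]:
  "poly2 0 x y = 0"
  "poly2 1 x y = 1"
  "poly2 (pCons a p) x y = poly a x + y * poly2 p x y"
  "poly2 (p + q) x y = poly2 p x y + poly2 q x y"
  "poly2 (p * q) x y = poly2 p x y * poly2 q x y"
  "poly2 (smult a p) x y = poly a x * poly2 p x y"
  by (simp_all add: poly2_def)

lemma poly2_minus [simp]:
  "poly2 (p - q) x y = poly2 p x y - poly2 q x y"
  by (simp add: poly2_def)

lemma bpoly_eq_poly2: "bpoly p v = poly2 p (fst v) (snd v)"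
  by (simp add: bpoly_def poly2_def)

definition poly_at_x :: "'a::comm_ring_1 \<Rightarrow> 'a poly poly \<Rightarrow> 'a poly" where
  "poly_at_x x p = map_poly (\<lambda>a. poly a x) p"

lemma poly_at_x_simps [simp]:
  "poly_at_x x 0 = 0" "poly_at_x x (pCons a p) = pCons (poly a x) (poly_at_x x p)"
  by (simp_all add: poly_at_x_def map_poly_pCons)

lemma coeff_poly_at_x [simp]: "coeff (poly_at_x x p) i = poly (coeff p i) x"
  by (simp add: poly_at_x_def coeff_map_poly)

lemma poly_poly_at_x [simp]: "poly (poly_at_x x p) y = poly2 p x y"
  by (induction p) auto

lemma pderiv_poly_at_x: "pderiv (poly_at_x x p) = poly_at_x x (pderiv p)"
  for p :: "'a::idom poly poly"
  by (intro poly_eqI) (simp add: coeff_pderiv of_nat_poly)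

lemma degree_poly_at_x:
  "poly (lead_coeff p) x \<noteq> 0 \<Longrightarrow> degree (poly_at_x x p) = degree p"
proof (rule antisym)
  show "degree (poly_at_x x p) \<le> degree p"
    by (rule degree_le) (simp add: coeff_eq_0)
qed (auto intro: le_degree)

lemma poly_at_x_eq_0_finite:
  fixes p :: "'a::idom poly poly"
  assumes "p \<noteq> 0"
  shows "finite {x. poly_at_x x p = 0}"
proof (rule finite_subset)
  show "{x. poly_at_x x p = 0} \<subseteq> {x. poly (lead_coeff p) x = 0}"
    using coeff_poly_at_x by (metis (mono_tags, lifting) Collect_mono coeff_0)
  show "finite {x. poly (lead_coeff p) x = 0}"
    using assms by (intro poly_roots_finite) auto
qed

lemma poly2_nonzero_ex:
  fixes p :: "'a::{idom,ring_char_0} poly poly"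
  assumes "p \<noteq> 0" "finite A" "finite B"
  shows "\<exists>x y. x \<notin> A \<and> y \<notin> B \<and> poly2 p x y \<noteq> 0"
proof -
  obtain x where x: "x \<notin> A" "poly_at_x x p \<noteq> 0"
    using ex_new_if_finite[OF infinite_UNIV_char_0, of "A \<union> {x. poly_at_x x p = 0}"] poly_at_x_eq_0_finite[OF assms(1)] assms
    by auto
  obtain y where y: "y \<notin> B" "poly (poly_at_x x p) y \<noteq> 0"
    using ex_new_if_finite[OF infinite_UNIV_char_0, of "B \<union> {y. poly (poly_at_x x p) y = 0}"] poly_roots_finite[OF x(2)] assms
    by auto
  show ?thesis using x y by auto
qed

text \<open>Polynomiality is phrased as a property of functions closed under ring operations, so
  that substitutions into a polynomial stay polynomial without any coefficient formula.\<close>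

definition polyfun2 :: "('a::comm_ring_1 \<Rightarrow> 'a \<Rightarrow> 'a) \<Rightarrow> bool" where
  "polyfun2 f \<longleftrightarrow> (\<exists>p. \<forall>x y. f x y = poly2 p x y)"

lemma polyfun2_const: "polyfun2 (\<lambda>x y. c)"
  unfolding polyfun2_def by (rule exI[of _ "[:[:c:]:]"]) simp

lemma polyfun2_fst: "polyfun2 (\<lambda>x y. x)"
  unfolding polyfun2_def by (rule exI[of _ "[:[:0,1:]:]"]) simp

lemma polyfun2_snd: "polyfun2 (\<lambda>x y. y)"
  unfolding polyfun2_def by (rule exI[of _ "[:0,1:]"]) simp

lemma polyfun2_add: "polyfun2 f \<Longrightarrow> polyfun2 g \<Longrightarrow> polyfun2 (\<lambda>x y. f x y + g x y)"
  unfolding polyfun2_def by (metis poly2_simps(4))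

lemma polyfun2_diff: "polyfun2 f \<Longrightarrow> polyfun2 g \<Longrightarrow> polyfun2 (\<lambda>x y. f x y - g x y)"
  unfolding polyfun2_def by (metis poly2_minus)

lemma polyfun2_mult: "polyfun2 f \<Longrightarrow> polyfun2 g \<Longrightarrow> polyfun2 (\<lambda>x y. f x y * g x y)"
  unfolding polyfun2_def by (metis poly2_simps(5))

lemma polyfun2_power: "polyfun2 f \<Longrightarrow> polyfun2 (\<lambda>x y. f x y ^ n)"
  by (induction n) (auto intro: polyfun2_const polyfun2_mult)

lemma polyfun2_sum: "(\<And>i. i \<in> A \<Longrightarrow> polyfun2 (f i)) \<Longrightarrow> polyfun2 (\<lambda>x y. \<Sum>i\<in>A. f i x y)"
  by (induction A rule: infinite_finite_induct) (auto intro: polyfun2_const polyfun2_add)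

lemmas polyfun2_intros = polyfun2_const polyfun2_fst polyfun2_snd polyfun2_add polyfun2_diff
  polyfun2_mult polyfun2_power polyfun2_sum

lemma poly2_altdef:
  "poly2 p x y = (\<Sum>j\<le>degree p. \<Sum>i\<le>degree (coeff p j). coeff (coeff p j) i * x ^ i * y ^ j)"
proof -
  have "poly2 p x y = (\<Sum>j\<le>degree p. poly (coeff p j * [:y:] ^ j) x)"
    by (simp add: poly2_def poly_altdef[of p] poly_sum)
  also have "\<dots> = (\<Sum>j\<le>degree p. \<Sum>i\<le>degree (coeff p j). coeff (coeff p j) i * x ^ i * y ^ j)"
    by (intro sum.cong refl, subst poly_mult, subst poly_altdef) (simp add: sum_distrib_right)
  finally show ?thesis .
qed

text \<open>With w = cnj z treated as an independent variable, x = (z + w)/2 and y = (z - w)/(2 i)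
  are substituted into \<open>f\<close>. \<open>P\<close> is nonzero because restriction to w = cnj
  z recovers all real values of \<open>f\<close>.\<close>

lemma complexification:
  fixes f :: "real poly poly"
  assumes "f \<noteq> 0"
  obtains P :: "complex poly poly" where "P \<noteq> 0"
    "\<And>z. poly2 P z (cnj z) = of_real (poly2 f (Re z) (Im z))"
proof -
  define g :: "complex \<Rightarrow> complex \<Rightarrow> complex" where
    "g = (\<lambda>z w. \<Sum>j\<le>degree f. \<Sum>i\<le>degree (coeff f j).
       of_real (coeff (coeff f j) i) * ((z + w) * (1/2)) ^ i * ((z - w) * (- \<i>/2)) ^ j)"
  have "polyfun2 g" unfolding g_def by (intro polyfun2_intros)
  then obtain P where P: "\<And>z w. g z w = poly2 P z w" unfolding polyfun2_def by blast
  have eq: "poly2 P z (cnj z) = of_real (poly2 f (Re z) (Im z))" for z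
  proof -
    have 1: "(z + cnj z) * (1/2) = of_real (Re z)" "(z - cnj z) * (- \<i>/2) = of_real (Im z)"
      by (auto simp: complex_eq_iff)
    have "poly2 P z (cnj z) = g z (cnj z)" by (simp add: P)
    also have "\<dots> = of_real (poly2 f (Re z) (Im z))"
      unfolding g_def 1 by (simp add: poly2_altdef)
    finally show ?thesis .
  qed
  obtain x y where "poly2 f x y \<noteq> 0" using poly2_nonzero_ex[OF assms, of "{}" "{}"] by auto
  with eq[of "Complex x y"] have "P \<noteq> 0" by auto
  with eq that show ?thesis by blast
qed

text \<open>Multiplying P(1/a, 1/b) by high powers of a and b clears the denominators. This moves an
  algebraic relation from values of \<open>Gamma\<close> to values of \<open>rGamma\<close>.\<close>

lemma poly2_reverse:
  fixes P :: "'a::field_char_0 poly poly"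
  assumes "P \<noteq> 0"
  obtains Q where "Q \<noteq> 0" "\<And>a b. a \<noteq> 0 \<Longrightarrow> b \<noteq> 0 \<Longrightarrow> poly2 P (inverse a) (inverse b) = 0 \<Longrightarrow> poly2 Q a b = 0"
proof -
  \<comment> \<open>The sum of all inner degrees is a crude common bound for the exponents of the
    first variable.\<close>
  define M where "M = (\<Sum>j\<le>degree P. degree (coeff P j))"
  have M: "degree (coeff P j) \<le> M" if "j \<le> degree P" for j
    unfolding M_def using that by (intro member_le_sum) auto
  define g where "g = (\<lambda>a b. \<Sum>j\<le>degree P. \<Sum>i\<le>degree (coeff P j).
       coeff (coeff P j) i * a ^ (M - i) * b ^ (degree P - j))"
  have "polyfun2 g" unfolding g_def by (intro polyfun2_intros)
  then obtain Q where Q: "\<And>z w. g z w = poly2 Q z w" unfolding polyfun2_def by blast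
  have eq: "poly2 Q a b = a ^ M * b ^ degree P * poly2 P (inverse a) (inverse b)" if "a \<noteq> 0" "b \<noteq> 0" for a b
  proof -
    have "a ^ M * b ^ degree P * (coeff (coeff P j) i * inverse a ^ i * inverse b ^ j) =
          coeff (coeff P j) i * a ^ (M - i) * b ^ (degree P - j)"
      if "j \<le> degree P" "i \<le> degree (coeff P j)" for i j
    proof -
      have "i \<le> M" using that M[of j] by simp
      thus ?thesis using that \<open>a \<noteq> 0\<close> \<open>b \<noteq> 0\<close> by (simp add: power_diff divide_simps)
    qed
    hence "a ^ M * b ^ degree P * poly2 P (inverse a) (inverse b) = g a b"
      unfolding poly2_altdef g_def sum_distrib_left by (intro sum.cong refl) simp
    thus ?thesis by (simp add: Q)
  qed
  obtain x y where "x \<noteq> 0" "y \<noteq> 0" "poly2 P x y \<noteq> 0" using poly2_nonzero_ex[OF assms, of "{0}" "{0}"] by auto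
  with eq[of "inverse x" "inverse y"] have "Q \<noteq> 0" by auto
  with eq that show ?thesis by auto
qed

section \<open>Division and Bezout identities over an integral domain\<close>

lemma pseudo_division:
  fixes f g :: "'a::idom poly"
  assumes "g \<noteq> 0"
  obtains c q r where "c \<noteq> 0" "smult c f = g * q + r" "r = 0 \<or> degree r < degree g"
proof -
  obtain q r where qr: "pseudo_divmod f g = (q, r)" by force
  show ?thesis
    by (rule that[OF _ pseudo_divmod[OF assms qr]]) (use assms in auto)
qed

text \<open>\<open>h\<close> has least degree in the ideal of \<open>f\<close> and \<open>g\<close>.
  The pseudo-remainder of \<open>f\<close> by \<open>h\<close> lies in that ideal, so it must
  vanish, and \<open>h\<close> divides \<open>f\<close> up to a factor from the coefficient ring.
  Later \<open>h\<close> is either constant, which gives a Bezout identity, or a genuine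
  factor.\<close>

lemma ideal_generator:
  fixes f g :: "'a::idom poly"
  assumes "g \<noteq> 0"
  shows "\<exists>a b h c q. h = a * f + b * g \<and> h \<noteq> 0 \<and> degree h \<le> degree g \<and> c \<noteq> 0 \<and> smult c f = h * q"
proof -
  define I where "I = (\<lambda>h. h \<noteq> 0 \<and> (\<exists>a b. h = a * f + b * g))"
  have "g = 0 * f + 1 * g" by simp
  hence "I g" using assms unfolding I_def by blast
  define h where "h = arg_min degree I"
  have h: "I h" "\<And>k. I k \<Longrightarrow> degree h \<le> degree k"
    using arg_min_nat_lemma[of I g degree] \<open>I g\<close> unfolding h_def by auto
  from h(1) obtain a b where ab: "h = a * f + b * g" "h \<noteq> 0" unfolding I_def by blast
  obtain c q r where cqr: "c \<noteq> 0" "smult c f = h * q + r" "r = 0 \<or> degree r < degree h"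
    using pseudo_division[OF ab(2)] by blast
  have "r = ([:c:] - a * q) * f + (- b * q) * g"
    using cqr(2) by (simp add: ab(1) algebra_simps)
  hence "\<exists>a b. r = a * f + b * g" by (intro exI)
  hence "r = 0 \<or> I r" unfolding I_def by simp
  hence "r = 0" using h(2)[of r] cqr(3) by auto
  hence "smult c f = h * q" using cqr(2) by simp
  with ab h(2)[OF \<open>I g\<close>] cqr(1) show ?thesis by (intro exI conjI)
qed

section \<open>Real algebraic subsets of the plane\<close>

lemma real_points_Un: "real_points F \<union> real_points G = real_points {f * g | f g. f \<in> F \<and> g \<in> G}"
proof (intro equalityI subsetI)
  fix v assume v: "v \<in> real_points {f * g | f g. f \<in> F \<and> g \<in> G}"
  have "poly2 f (fst v) (snd v) * poly2 g (fst v) (snd v) = 0" if "f \<in> F" "g \<in> G" for f g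
  proof -
    have "f * g \<in> {f * g | f g. f \<in> F \<and> g \<in> G}" using that by blast
    hence "bpoly (f * g) v = 0" using v unfolding real_points_def by blast
    thus ?thesis by (simp add: bpoly_eq_poly2)
  qed
  thus "v \<in> real_points F \<union> real_points G"
    unfolding real_points_def bpoly_eq_poly2 by fastforce
qed (auto simp: real_points_def bpoly_eq_poly2)

lemma finite_real_points:
  "finite A \<Longrightarrow> \<exists>F. A = real_points F"
proof (induction A rule: finite_induct)
  case empty
  show ?case by (rule exI[of _ "{1}"]) (simp add: real_points_def bpoly_eq_poly2)
next
  case (insert v A)
  then obtain F where F: "A = real_points F" by blast
  have "{v} = real_points {[:[:- fst v, 1:]:], [:[:- snd v:], 1:]}"
    by (auto simp: real_points_def bpoly_eq_poly2 prod_eq_iff)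
  hence "insert v A = real_points {[:[:- fst v, 1:]:], [:[:- snd v:], 1:]} \<union> real_points F"
    using F by auto
  thus ?case unfolding real_points_Un by blast
qed

lemma real_points_Int: "real_points F \<inter> real_points G = real_points (F \<union> G)"
  by (auto simp: real_points_def)

lemma continuous_on_poly2 [continuous_intros]:
  fixes P :: "'a::real_normed_field poly poly"
  assumes "continuous_on A f" "continuous_on A g"
  shows "continuous_on A (\<lambda>x. poly2 P (f x) (g x))"
  by (induction P) (auto intro!: continuous_intros assms)

text \<open>The sets where the equations fail are open, so Lindelof's theorem can take the place of
  Hilbert's basis theorem. Countably many equations suffice later because each one spoils only
  finitely many abscissae.\<close>

lemma real_points_countable:
  obtains F' where "countable F'" "F' \<subseteq> F" "real_points F' = real_points F"
proof -
  let ?U = "\<lambda>f. {v. bpoly f v \<noteq> 0}"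
  have op: "open (?U f)" for f
    unfolding bpoly_eq_poly2
    by (intro open_Collect_neq continuous_intros)
  obtain \<F> where \<F>: "\<F> \<subseteq> ?U ` F" "countable \<F>" "\<Union>\<F> = \<Union>(?U ` F)"
    using Lindelof[of "?U ` F"] op by blast
  obtain F' where F': "F' \<subseteq> F" "countable F'" "\<F> = ?U ` F'"
    using \<F> by (metis (no_types, lifting) countable_subset_image)
  have "(\<Union>(?U ` F')) = (\<Union>(?U ` F))" using F' \<F> by simp
  hence "real_points F' = real_points F"
    unfolding real_points_def by (auto simp: set_eq_iff)
  thus ?thesis using that F' by blast
qed

lemma min_degree_ex:
  fixes p :: "'a::zero poly"
  assumes "\<Phi> p"
  obtains q where "\<Phi> q" "\<And>r. degree r < degree q \<Longrightarrow> \<not> \<Phi> r"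
  using arg_min_nat_lemma[of \<Phi> p degree] assms that by (metis not_le)

lemma pderiv_neq_0: "degree p > 0 \<Longrightarrow> pderiv p \<noteq> 0"
  for p :: "'a::{comm_ring_1,semiring_no_zero_divisors,ring_char_0} poly"
  by (simp add: pderiv_eq_0_iff)

text \<open>Let \<open>p\<close> have least degree among the nonzero polynomials with infinitely
  many zeros on \<open>B\<close>. If that degree is 0, infinitely many points share an abscissa and
  the curve contains a vertical line. Otherwise some zero in \<open>B\<close> has nonzero
  y-derivative, and the sign change there persists for nearby abscissae and produces uncountably
  many zeros of \<open>p\<close>. By minimality \<open>p\<close> divides every equation up to a
  factor in x alone, so these zeros lie on the curve outside countably many abscissae.\<close>

lemma infinite_imp_uncountable_off_axis:
  fixes F :: "real poly poly set"
  defines "B \<equiv> {v \<in> real_points F. snd v \<noteq> 0}"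
  assumes inf: "infinite B" and f0: "f0 \<in> F" "f0 \<noteq> 0"
  shows "uncountable B"
proof -
  define \<Phi> where "\<Phi> = (\<lambda>p. p \<noteq> 0 \<and> infinite {v\<in>B. bpoly p v = 0})"
  have "{v\<in>B. bpoly f0 v = 0} = B" using f0 by (auto simp: B_def real_points_def)
  hence "\<Phi> f0" using inf f0 by (simp add: \<Phi>_def)
  then obtain p where p: "\<Phi> p" and pmin: "\<And>r. degree r < degree p \<Longrightarrow> \<not> \<Phi> r"
    using min_degree_ex by blast
  have p0: "p \<noteq> 0" and pinf: "infinite {v\<in>B. bpoly p v = 0}" using p by (auto simp: \<Phi>_def)
  show ?thesis
  proof (cases "degree p = 0")
    case True \<comment> \<open>the curve contains a vertical line\<close>
    then obtain a where a: "p = [:a:]" by (rule degree_eq_zeroE)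
    let ?R = "{x. poly a x = 0}"
    have "finite ?R" using a p0 by (intro poly_roots_finite) auto
    moreover have "{v\<in>B. bpoly p v = 0} = (\<Union>x\<in>?R. {v\<in>B. fst v = x})"
      by (auto simp: a bpoly_eq_poly2)
    ultimately obtain c where c: "infinite {v\<in>B. fst v = c}" using pinf by auto
    have inj: "inj_on snd {v\<in>B. fst v = c}" by (auto simp: inj_on_def prod_eq_iff)
    have "(c, y) \<in> B" if "y \<noteq> 0" for y
    proof -
      have "bpoly f (c, y) = 0" if f: "f \<in> F" for f
      proof -
        have "snd ` {v\<in>B. fst v = c} \<subseteq> {y. poly (poly_at_x c f) y = 0}"
          using f by (auto simp: B_def real_points_def bpoly_eq_poly2)
        moreover have "infinite (snd ` {v\<in>B. fst v = c})" using c inj finite_imageD by blast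
        ultimately have "poly_at_x c f = 0" using poly_roots_finite finite_subset by blast
        thus ?thesis using poly_poly_at_x[of c f y] by (simp add: bpoly_eq_poly2)
      qed
      thus ?thesis using that by (auto simp: B_def real_points_def)
    qed
    hence "(\<lambda>y. (c, y)) ` {0<..<1::real} \<subseteq> B" by auto
    moreover have "uncountable ((\<lambda>y. (c, y)) ` {0<..<1::real})"
      using countable_image_inj_on[of "\<lambda>y. (c, y)" "{0<..<1::real}"] uncountable_open_interval[of 0 1]
      by (auto simp: inj_on_def)
    ultimately show ?thesis using countable_subset by blast
  next
    case False
    have "pderiv p \<noteq> 0" "degree (pderiv p) < degree p"
      using False pderiv_neq_0[of p] by (auto simp: degree_pderiv)
    hence "finite {v\<in>B. bpoly (pderiv p) v = 0}" using pmin[of "pderiv p"] by (auto simp: \<Phi>_def)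
    hence "infinite ({v\<in>B. bpoly p v = 0} - {v\<in>B. bpoly (pderiv p) v = 0})"
      using pinf by simp
    then obtain v where v: "v \<in> {v\<in>B. bpoly p v = 0} - {v\<in>B. bpoly (pderiv p) v = 0}"
      using infinite_imp_nonempty by blast
    obtain x0 y0 where xy: "v = (x0, y0)" by force
    have y0: "y0 \<noteq> 0" and p00: "poly2 p x0 y0 = 0" and dp: "poly2 (pderiv p) x0 y0 \<noteq> 0"
      using v by (auto simp: xy B_def bpoly_eq_poly2)
    have der: "((\<lambda>y. poly2 p x0 y) has_real_derivative poly2 (pderiv p) x0 y0) (at y0)"
      using poly_DERIV[of "poly_at_x x0 p" y0] by (simp add: pderiv_poly_at_x)
    obtain ya yb where yab: "\<And>y. ya \<le> y \<Longrightarrow> y \<le> yb \<Longrightarrow> y \<noteq> 0" "ya \<le> yb"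
        "poly2 p x0 ya * poly2 p x0 yb < 0"
    proof -
      have "\<exists>d>0. \<forall>h>0. h < d \<longrightarrow> poly2 p x0 (y0 - h) * poly2 p x0 (y0 + h) < 0"
      proof (cases "poly2 (pderiv p) x0 y0 > 0")
        case True
        from DERIV_pos_inc_left[OF der True] DERIV_pos_inc_right[OF der True]
        obtain d1 d2 where "d1 > 0" "d2 > 0" "\<forall>h>0. h < d1 \<longrightarrow> poly2 p x0 (y0 - h) < 0"
           "\<forall>h>0. h < d2 \<longrightarrow> 0 < poly2 p x0 (y0 + h)" using p00 by auto
        thus ?thesis by (intro exI[of _ "min d1 d2"]) (auto simp: mult_less_0_iff)
      next
        case False
        hence neg: "poly2 (pderiv p) x0 y0 < 0" using dp by simp
        from DERIV_neg_dec_left[OF der neg] DERIV_neg_dec_right[OF der neg]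
        obtain d1 d2 where "d1 > 0" "d2 > 0" "\<forall>h>0. h < d1 \<longrightarrow> poly2 p x0 (y0 - h) > 0"
           "\<forall>h>0. h < d2 \<longrightarrow> 0 > poly2 p x0 (y0 + h)" using p00 by auto
        thus ?thesis by (intro exI[of _ "min d1 d2"]) (auto simp: mult_less_0_iff)
      qed
      then obtain d where d: "d > 0" "\<And>h. h > 0 \<Longrightarrow> h < d \<Longrightarrow> poly2 p x0 (y0 - h) * poly2 p x0 (y0 + h) < 0"
        by blast
      \<comment> \<open>The bound by half of \<open>\<bar>y0\<bar>\<close> keeps the whole interval
        off the axis.\<close>
      define h where "h = min (d/2) (\<bar>y0\<bar>/2)"
      have h: "h > 0" "h < d" "h < \<bar>y0\<bar>" using d y0 by (auto simp: h_def min_def)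
      show ?thesis
        by (rule that[of "y0 - h" "y0 + h"]) (use h d in auto)
    qed
    have "open {x. poly2 p x ya * poly2 p x yb < 0}"
      by (intro open_Collect_less continuous_intros)
    then obtain \<delta> where \<delta>: "\<delta> > 0" "ball x0 \<delta> \<subseteq> {x. poly2 p x ya * poly2 p x yb < 0}"
      using yab(3) open_contains_ball by blast
    have "\<exists>y. ya \<le> y \<and> y \<le> yb \<and> poly2 p x y = 0" if "x \<in> ball x0 \<delta>" for x
    proof -
      have cont: "continuous_on {ya..yb} (\<lambda>y. poly2 p x y)" by (intro continuous_intros)
      have "poly2 p x ya * poly2 p x yb < 0" using that \<delta> by auto
      thus ?thesis
        using IVT'[of "\<lambda>y. poly2 p x y" ya 0 yb] IVT2'[of "\<lambda>y. poly2 p x y" yb 0 ya] cont yab(2)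
        by (auto simp: mult_less_0_iff)
    qed
    then obtain Y where Y: "\<And>x. x \<in> ball x0 \<delta> \<Longrightarrow> ya \<le> Y x \<and> Y x \<le> yb \<and> poly2 p x (Y x) = 0"
      by metis
    obtain F' where F': "countable F'" "F' \<subseteq> F" "real_points F' = real_points F"
      using real_points_countable by blast
    have "\<exists>c q. c \<noteq> 0 \<and> smult c f = p * q" if f: "f \<in> F'" for f
    proof -
      \<comment> \<open>The pseudo-remainder vanishes at the infinitely many zeros of
        \<open>p\<close> in \<open>B\<close> but has smaller degree, so it is zero.\<close>
      obtain c q r where cqr: "c \<noteq> 0" "smult c f = p * q + r" "r = 0 \<or> degree r < degree p"
        using pseudo_division[OF p0] by blast
      have "{v\<in>B. bpoly p v = 0} \<subseteq> {v\<in>B. bpoly r v = 0}"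
      proof safe
        fix x y assume xy: "(x, y) \<in> B" "bpoly p (x, y) = 0"
        have "bpoly f (x, y) = 0" using xy f F' by (auto simp: B_def real_points_def)
        thus "bpoly r (x, y) = 0"
          using arg_cong[OF cqr(2), of "\<lambda>t. poly2 t x y"] xy by (simp add: bpoly_eq_poly2)
      qed
      hence "infinite {v\<in>B. bpoly r v = 0}" using pinf finite_subset by blast
      hence "r = 0" using cqr(3) pmin[of r] by (auto simp: \<Phi>_def)
      thus ?thesis using cqr by auto
    qed
    then obtain c q where cq: "\<And>f. f \<in> F' \<Longrightarrow> c f \<noteq> 0 \<and> smult (c f) f = p * q f" by metis
    \<comment> \<open>Where the factor \<open>c f\<close> vanishes, divisibility says nothing about
      \<open>f\<close>; these abscissae are removed.\<close>
    define E where "E = (\<Union>f\<in>F'. {x. poly (c f) x = 0})"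
    have "countable E" unfolding E_def using F' cq
      by (intro countable_UN) (simp_all add: countable_finite poly_roots_finite)
    hence "uncountable (ball x0 \<delta> - E)"
      using uncountable_ball[OF \<delta>(1), of x0] uncountable_minus_countable by blast
    hence "uncountable ((\<lambda>x. (x, Y x)) ` (ball x0 \<delta> - E))"
      using countable_image_inj_on[of "\<lambda>x. (x, Y x)" "ball x0 \<delta> - E"] by (auto simp: inj_on_def)
    moreover have "(\<lambda>x. (x, Y x)) ` (ball x0 \<delta> - E) \<subseteq> B"
    proof safe
      fix x assume x: "x \<in> ball x0 \<delta>" "x \<notin> E"
      have "bpoly f (x, Y x) = 0" if f: "f \<in> F'" for f
      proof -
        have "poly (c f) x * poly2 f x (Y x) = 0"
          using arg_cong[OF conjunct2[OF cq[OF f]], of "\<lambda>t. poly2 t x (Y x)"] Y[OF x(1)] by simp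
        thus ?thesis using x f by (auto simp: E_def bpoly_eq_poly2)
      qed
      hence "(x, Y x) \<in> real_points F'" by (auto simp: real_points_def)
      thus "(x, Y x) \<in> B" using Y[OF x(1)] yab(1) F' by (auto simp: B_def)
    qed
    ultimately show ?thesis using countable_subset by blast
  qed
qed

section \<open>Branches of algebraic functions\<close>

text \<open>The value at \<open>w\<close> is the leading coefficient times the product of the
  differences to the roots, each of which is at least as long as the one to the nearest root. A
  small value thus forces a nearby root, with a bound that stays explicit when the coefficients
  vary.\<close>

lemma root_near:
  fixes f :: "complex poly"
  assumes "degree f > 0"
  shows "\<exists>\<rho>. poly f \<rho> = 0 \<and> norm (lead_coeff f) * dist w \<rho> ^ degree f \<le> norm (poly f w)"
proof -
  obtain A where A: "size A = degree f" "f = smult (lead_coeff f) (\<Prod>x\<in>#A. [:-x, 1:])"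
    using alg_closed_imp_factorization[of f] assms by fastforce
  have "A \<noteq> {#}" using A assms by auto
  hence ne: "set_mset A \<noteq> {}" by simp
  define \<rho> where "\<rho> = arg_min_on (dist w) (set_mset A)"
  have \<rho>: "\<rho> \<in># A" "\<And>x. x \<in># A \<Longrightarrow> dist w \<rho> \<le> dist w x"
    unfolding \<rho>_def using arg_min_if_finite(1)[OF _ ne, of "dist w"] arg_min_least[OF _ ne, of _ "dist w"] by auto
  have ev: "poly (\<Prod>x\<in>#B. [:-x, 1:]) u = (\<Prod>x\<in>#B. u - x)" for u and B :: "complex multiset"
    by (induction B) (auto simp: algebra_simps)
  have "dist w \<rho> ^ size B \<le> norm (\<Prod>x\<in>#B. w - x)" if "\<And>x. x \<in># B \<Longrightarrow> dist w \<rho> \<le> dist w x" for B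
    using that
  proof (induction B)
    case (add x B)
    have "dist w \<rho> * dist w \<rho> ^ size B \<le> norm (w - x) * norm (\<Prod>x\<in>#B. w - x)"
      using add by (intro mult_mono) (auto simp: dist_norm)
    thus ?case by (simp add: norm_mult)
  qed auto
  from this[of A] \<rho> A(1) have "dist w \<rho> ^ degree f \<le> norm (\<Prod>x\<in>#A. w - x)" by auto
  moreover have "poly f w = lead_coeff f * (\<Prod>x\<in>#A. w - x)"
    using ev[of A w] by (subst A(2)) simp
  moreover have "poly f \<rho> = 0"
  proof -
    have "(\<Prod>x\<in>#A. \<rho> - x) = 0" using \<rho>(1) by (auto simp: prod_mset_zero_iff)
    thus ?thesis using ev[of A \<rho>] by (subst A(2)) simp
  qed
  ultimately show ?thesis by (auto simp: norm_mult mult_left_mono)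
qed

lemma card_simple_roots:
  fixes f :: "complex poly"
  assumes "f \<noteq> 0" "\<And>x. poly f x = 0 \<Longrightarrow> poly (pderiv f) x \<noteq> 0"
  shows "card {x. poly f x = 0} = degree f"
proof -
  have "rsquarefree f" using assms by (auto simp: rsquarefree_roots)
  from complex_poly_decompose_rsquarefree[OF this]
  have "degree f = degree (\<Prod>z | poly f z = 0. [:-z, 1:])"
    by (metis assms(1) degree_smult_eq leading_coeff_0_iff)
  also have "\<dots> = card {x. poly f x = 0}"
    by (subst degree_prod_eq_sum_degree) auto
  finally show ?thesis by simp
qed

text \<open>Quantitative form of being unramified with the radius as a parameter: one fixed radius
  gives evenly covered neighbourhoods, and shrinking radii give continuity of the sheets.\<close>

definition unramified_near :: "complex poly poly \<Rightarrow> complex \<Rightarrow> real \<Rightarrow> complex \<Rightarrow> bool" where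
  "unramified_near P z1 r z \<longleftrightarrow>
     (\<forall>w. poly2 P z1 w = 0 \<longrightarrow> (\<exists>!w'. w' \<in> ball w r \<and> poly2 P z w' = 0)) \<and>
     (\<forall>w'. poly2 P z w' = 0 \<longrightarrow> (\<exists>w. poly2 P z1 w = 0 \<and> w' \<in> ball w r))"

lemma unramified_nearD:
  assumes "unramified_near P z1 r z"
  shows "poly2 P z1 w = 0 \<Longrightarrow> \<exists>!w'. w' \<in> ball w r \<and> poly2 P z w' = 0"
    and "poly2 P z w' = 0 \<Longrightarrow> \<exists>w. poly2 P z1 w = 0 \<and> w' \<in> ball w r"
  using assms unfolding unramified_near_def by blast+

text \<open>Each of \<open>degree P\<close> disjoint discs catches a root of \<open>P(z, \<cdot>)\<close>, and there are no more than \<open>degree P\<close> roots.\<close>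

lemma local_sheets:
  fixes P :: "complex poly poly"
  assumes deg: "degree P > 0" and lc: "poly (lead_coeff P) z1 \<noteq> 0"
    and card: "card {w. poly2 P z1 w = 0} = degree P" and e: "e0 > 0"
  shows "\<exists>e>0. e \<le> e0 \<and>
    (\<forall>w w'. poly2 P z1 w = 0 \<longrightarrow> poly2 P z1 w' = 0 \<longrightarrow> w \<noteq> w' \<longrightarrow> ball w e \<inter> ball w' e = {}) \<and>
    (\<forall>e'>0. e' \<le> e \<longrightarrow> (\<exists>d>0. \<forall>z\<in>ball z1 d. unramified_near P z1 e' z))"
proof -
  define W where "W = {w. poly2 P z1 w = 0}"
  have finW: "finite W" using card deg card.infinite unfolding W_def by fastforce
  obtain s where s: "s > 0" "\<And>w w'. w \<in> W \<Longrightarrow> w' \<in> W \<Longrightarrow> w \<noteq> w' \<Longrightarrow> s \<le> dist w w'"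
  proof -
    \<comment> \<open>Inserting 1 keeps \<open>D\<close> nonempty when there is only one
      root.\<close>
    define D where "D = insert 1 ((\<lambda>(w,w'). dist w w') ` {(w,w')\<in>W\<times>W. w \<noteq> w'})"
    have "finite {(w,w')\<in>W\<times>W. w \<noteq> w'}" using finW by (auto intro: finite_subset[OF _ finite_cartesian_product[OF finW finW]])
    hence fD: "finite D" "D \<noteq> {}" by (auto simp: D_def)
    have "Min D > 0" using fD by (subst Min_gr_iff) (auto simp: D_def)
    moreover have "Min D \<le> dist w w'" if "w \<in> W" "w' \<in> W" "w \<noteq> w'" for w w'
      using fD that by (intro Min_le) (auto simp: D_def)
    ultimately show ?thesis using that by blast
  qed
  define e where "e = min e0 (s/2)"
  have e': "e > 0" "e \<le> e0" "e \<le> s/2" using e s by (auto simp: e_def)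
  have disj: "ball w r \<inter> ball w' r = {}" if "w \<in> W" "w' \<in> W" "w \<noteq> w'" "r \<le> e" for w w' r
    using s(2)[OF that(1-3)] e'(3) that(4) by (intro disjoint_ballI) auto
  have main: "\<exists>d>0. \<forall>z\<in>ball z1 d. unramified_near P z1 r z" if r: "r > 0" "r \<le> e" for r
  proof -
    \<comment> \<open>At \<open>z1\<close> the left side is 0, so this is an open condition around
      \<open>z1\<close>; \<open>root_near\<close> turns it into a root of P(z, .) within
      \<open>r\<close> of each \<open>w\<close>.\<close>
    let ?good = "\<lambda>z. \<forall>w\<in>W. norm (poly2 P z w) < norm (poly (lead_coeff P) z) * r ^ degree P"
    have "open {z. norm (poly2 P z w) < norm (poly (lead_coeff P) z) * r ^ degree P}" for w
      by (intro open_Collect_less continuous_intros)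
    hence "open (\<Inter>w\<in>W. {z. norm (poly2 P z w) < norm (poly (lead_coeff P) z) * r ^ degree P})"
      using finW by (intro open_INT) auto
    also have "(\<Inter>w\<in>W. {z. norm (poly2 P z w) < norm (poly (lead_coeff P) z) * r ^ degree P}) = {z. ?good z}"
      by auto
    finally have op: "open ({z. ?good z} \<inter> {z. poly (lead_coeff P) z \<noteq> 0})"
      by (intro open_Int open_Collect_neq continuous_intros)
    have "z1 \<in> {z. ?good z} \<inter> {z. poly (lead_coeff P) z \<noteq> 0}" using lc r by (auto simp: W_def)
    with op obtain d where d: "d > 0" "ball z1 d \<subseteq> {z. ?good z} \<inter> {z. poly (lead_coeff P) z \<noteq> 0}"
      using open_contains_ball by blast
    show ?thesis
      unfolding unramified_near_def
    proof (intro exI[of _ d] conjI ballI d(1))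
      fix z assume "z \<in> ball z1 d"
      hence lcz: "poly (lead_coeff P) z \<noteq> 0" and good: "?good z" using d(2) by auto
      have dz: "degree (poly_at_x z P) = degree P" by (rule degree_poly_at_x[OF lcz])
      define R where "R = {w. poly2 P z w = 0}"
      have "poly_at_x z P \<noteq> 0" using dz deg by auto
      hence R: "finite R" "card R \<le> degree P"
        using poly_roots_finite[of "poly_at_x z P"] card_poly_roots_bound[of "poly_at_x z P"] dz deg
        by (auto simp: R_def)
      have "\<exists>w'\<in>R. w' \<in> ball w r" if w: "w \<in> W" for w
      proof -
        obtain \<rho> where \<rho>: "poly2 P z \<rho> = 0" 
          "norm (poly (lead_coeff P) z) * dist w \<rho> ^ degree P \<le> norm (poly2 P z w)"
          using root_near[of "poly_at_x z P" w] deg dz by auto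
        have "norm (poly2 P z w) < norm (poly (lead_coeff P) z) * r ^ degree P" using good w by blast
        with \<rho>(2) have "norm (poly (lead_coeff P) z) * dist w \<rho> ^ degree P < norm (poly (lead_coeff P) z) * r ^ degree P"
          by linarith
        hence "dist w \<rho> ^ degree P < r ^ degree P" using lcz by simp
        hence "dist w \<rho> < r" using r power_less_imp_less_base by fastforce
        thus ?thesis using \<rho> by (auto simp: R_def)
      qed
      then obtain h where h: "\<And>w. w \<in> W \<Longrightarrow> h w \<in> R \<and> h w \<in> ball w r" by metis
      have inj: "inj_on h W"
      proof (rule inj_onI, rule ccontr)
        fix x y assume "x \<in> W" "y \<in> W" "h x = h y" "x \<noteq> y"
        thus False using disj[of x y r] h[of x] h[of y] r by auto
      qed
      have "card (h ` W) = degree P" using card_image[OF inj] card by (simp add: W_def)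
      moreover have "h ` W \<subseteq> R" using h by auto
      ultimately have hW: "h ` W = R" using R by (metis card_seteq)
      show "\<forall>w. poly2 P z1 w = 0 \<longrightarrow> (\<exists>!w'. w' \<in> ball w r \<and> poly2 P z w' = 0)"
      proof (intro allI impI)
        fix w assume "poly2 P z1 w = 0"
        hence w: "w \<in> W" by (simp add: W_def)
        show "\<exists>!w'. w' \<in> ball w r \<and> poly2 P z w' = 0"
        proof (rule ex1I[of _ "h w"])
          show "h w \<in> ball w r \<and> poly2 P z (h w) = 0" using h[OF w] by (auto simp: R_def)
          fix w' assume w': "w' \<in> ball w r \<and> poly2 P z w' = 0"
          then obtain v where v: "v \<in> W" "w' = h v" using hW by (auto simp: R_def)
          show "w' = h w"
          proof (rule ccontr)
            assume "w' \<noteq> h w"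
            hence "v \<noteq> w" using v by auto
            thus False using disj[of v w r] v w w' h[of v] r by auto
          qed
        qed
      qed
      show "\<forall>w'. poly2 P z w' = 0 \<longrightarrow> (\<exists>w. poly2 P z1 w = 0 \<and> w' \<in> ball w r)"
      proof (intro allI impI)
        fix w' assume "poly2 P z w' = 0"
        then obtain v where "v \<in> W" "w' = h v" using hW by (auto simp: R_def)
        thus "\<exists>w. poly2 P z1 w = 0 \<and> w' \<in> ball w r" using h[of v] by (auto simp: W_def)
      qed
    qed
  qed
  show ?thesis
  proof (rule exI[of _ e], intro conjI allI impI)
    fix w w' assume "poly2 P z1 w = 0" "poly2 P z1 w' = 0" "w \<noteq> w'"
    thus "ball w e \<inter> ball w' e = {}" using disj[of w w' e] by (simp add: W_def)
  next
    fix r assume "0 < r" "r \<le> e"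
    thus "\<exists>d>0. \<forall>z\<in>ball z1 d. unramified_near P z1 r z" by (rule main)
  qed (fact e'(1,2))+
qed

text \<open>Covering theory does the work of continuation along paths: over a simply connected base,
  a point of the fibre extends to a global section. The sheets over a small disc are cut out by
  discs about the roots at its centre.\<close>

lemma covering_space_poly2:
  fixes P :: "complex poly poly"
  assumes deg: "degree P > 0" and op: "open S"
    and lc: "\<And>z. z \<in> S \<Longrightarrow> poly (lead_coeff P) z \<noteq> 0"
    and card: "\<And>z. z \<in> S \<Longrightarrow> card {w. poly2 P z w = 0} = degree P"
  defines "C \<equiv> {(z, w). z \<in> S \<and> poly2 P z w = 0}"
  shows "covering_space C fst S"
proof
  show "continuous_on C fst" by (intro continuous_intros)
  show "fst ` C = S"
  proof safe
    fix z assume z: "z \<in> S"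
    have "{w. poly2 P z w = 0} \<noteq> {}" using card[OF z] deg by (metis card.empty less_irrefl)
    thus "z \<in> fst ` C" using z by (force simp: C_def)
  qed (auto simp: C_def)
next
  fix z1 assume z1: "z1 \<in> S"
  from local_sheets[OF deg lc[OF z1] card[OF z1] zero_less_one]
  obtain e where e: "e > 0" "e \<le> 1"
    "\<forall>w w'. poly2 P z1 w = 0 \<longrightarrow> poly2 P z1 w' = 0 \<longrightarrow> w \<noteq> w' \<longrightarrow> ball w e \<inter> ball w' e = {}"
    "\<forall>e'>0. e' \<le> e \<longrightarrow> (\<exists>d>0. \<forall>z\<in>ball z1 d. unramified_near P z1 e' z)"
    by (elim exE conjE) (rule that)
  obtain d0 where d0: "d0 > 0" and d0': "\<And>z. z \<in> ball z1 d0 \<Longrightarrow> unramified_near P z1 e z"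
    using e(4)[rule_format, OF e(1) order_refl] by blast
  obtain d1 where d1: "d1 > 0" "ball z1 d1 \<subseteq> S" using op z1 open_contains_ball by blast
  define T where "T = ball z1 (min d0 d1)"
  have TS: "T \<subseteq> S" "z1 \<in> T" "open T" "T \<subseteq> ball z1 d0" using d0 d1 by (auto simp: T_def)
  define sh where "sh = (\<lambda>w. C \<inter> (T \<times> ball w e))"
  show "\<exists>T. z1 \<in> T \<and> openin (top_of_set S) T \<and>
           (\<exists>v. \<Union>v = C \<inter> fst -` T \<and> (\<forall>u\<in>v. openin (top_of_set C) u) \<and>
           pairwise disjnt v \<and> (\<forall>u\<in>v. \<exists>q. homeomorphism u T fst q))"
  proof (intro exI[of _ T] exI[of _ "sh ` {w. poly2 P z1 w = 0}"] conjI ballI)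
    show "z1 \<in> T" by fact
    show "openin (top_of_set S) T" using TS by (simp add: open_subset)
    show "\<Union> (sh ` {w. poly2 P z1 w = 0}) = C \<inter> fst -` T"
    proof (intro equalityI subsetI)
      fix x assume x: "x \<in> C \<inter> fst -` T"
      then obtain z w' where zw: "x = (z, w')" "z \<in> T" "poly2 P z w' = 0" "x \<in> C" by (auto simp: C_def)
      have "z \<in> ball z1 d0" using zw(2) TS(4) by blast
      from unramified_nearD(2)[OF d0'[OF this] zw(3)]
      obtain w where "poly2 P z1 w = 0" "w' \<in> ball w e" by (elim exE conjE) (rule that)
      thus "x \<in> \<Union> (sh ` {w. poly2 P z1 w = 0})" using zw by (auto simp: sh_def)
    qed (auto simp: sh_def)
    show "openin (top_of_set C) u" if "u \<in> sh ` {w. poly2 P z1 w = 0}" for u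
      using that TS(3) unfolding sh_def by (auto intro!: openin_open_Int open_Times)
    show "pairwise disjnt (sh ` {w. poly2 P z1 w = 0})"
    proof (rule pairwiseI)
      fix u v assume uv: "u \<in> sh ` {w. poly2 P z1 w = 0}" "v \<in> sh ` {w. poly2 P z1 w = 0}" "u \<noteq> v"
      then obtain w w' where "u = sh w" "v = sh w'" "poly2 P z1 w = 0" "poly2 P z1 w' = 0" "w \<noteq> w'" by auto
      thus "disjnt u v" using e(3)[rule_format, of w w'] by (auto simp: sh_def disjnt_def)
    qed
    fix u assume "u \<in> sh ` {w. poly2 P z1 w = 0}"
    then obtain w0 where w0: "u = sh w0" "poly2 P z1 w0 = 0" by auto
    define h where "h = (\<lambda>z. THE w. w \<in> ball w0 e \<and> poly2 P z w = 0)"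
    have ex1: "\<exists>!w. w \<in> ball w0 e \<and> poly2 P z w = 0" if "z \<in> T" for z
      using unramified_nearD(1)[OF d0'[OF subsetD[OF TS(4) that]] w0(2)] .
    have h: "h z \<in> ball w0 e \<and> poly2 P z (h z) = 0" if "z \<in> T" for z
      unfolding h_def by (rule theI'[OF ex1[OF that]])
    have hu: "w = h z" if "z \<in> T" "w \<in> ball w0 e" "poly2 P z w = 0" for z w
      using ex1[OF that(1)] h[OF that(1)] that by blast
    have cont: "continuous_on T h"
    proof (rule continuous_at_imp_continuous_on, rule ballI)
      fix z2 assume z2: "z2 \<in> T"
      hence z2S: "z2 \<in> S" using TS by auto
      show "isCont h z2"
        unfolding continuous_at_eps_delta
      proof (intro allI impI)
        fix r :: real assume r: "r > 0"
        have "h z2 \<in> ball w0 e" using h[OF z2] by blast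
        then obtain r' where r': "r' > 0" "ball (h z2) r' \<subseteq> ball w0 e" using open_ball open_contains_ball by blast
        \<comment> \<open>\<open>local_sheets\<close> is applied again at \<open>z2\<close>, with a
          radius small enough for continuity and for the disc to stay inside the original sheet,
          where the root found must be \<open>h z\<close> by uniqueness.\<close>
        have "min r r' > 0" using r r' by simp
        from local_sheets[OF deg lc[OF z2S] card[OF z2S] this]
        obtain e2 where e2: "e2 > 0" "e2 \<le> min r r'"
          "\<forall>w w'. poly2 P z2 w = 0 \<longrightarrow> poly2 P z2 w' = 0 \<longrightarrow> w \<noteq> w' \<longrightarrow> ball w e2 \<inter> ball w' e2 = {}"
          "\<forall>e'>0. e' \<le> e2 \<longrightarrow> (\<exists>d>0. \<forall>z\<in>ball z2 d. unramified_near P z2 e' z)"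
          by (elim exE conjE) (rule that)
        obtain d where d: "d > 0" "\<forall>z\<in>ball z2 d. unramified_near P z2 e2 z"
          using e2(4)[rule_format, OF e2(1) order_refl] by (elim exE conjE) (rule that)
        obtain d' where d': "d' > 0" "ball z2 d' \<subseteq> T" using TS(3) z2 open_contains_ball by blast
        show "\<exists>d>0. \<forall>z. dist z z2 < d \<longrightarrow> dist (h z) (h z2) < r"
        proof (intro exI[of _ "min d d'"] conjI allI impI)
          fix z assume "dist z z2 < min d d'"
          hence z: "z \<in> ball z2 d" "z \<in> T" using d' by (auto simp: dist_commute)
          obtain w' where w': "w' \<in> ball (h z2) e2" "poly2 P z w' = 0"
            using unramified_nearD(1)[OF bspec[OF d(2) z(1)] conjunct2[OF h[OF z2]]] by (elim ex1E conjE) (rule that)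
          have "w' \<in> ball (h z2) r'" using w'(1) e2(2) by simp
          hence "w' \<in> ball w0 e" using r'(2) by blast
          hence "w' = h z" using hu z w' by blast
          thus "dist (h z) (h z2) < r" using w' e2(2) by (auto simp: dist_commute)
        qed (use d d' in auto)
      qed
    qed
    show "\<exists>q. homeomorphism u T fst q"
    proof (intro exI[of _ "\<lambda>z. (z, h z)"] homeomorphismI)
      show "continuous_on u fst" by (intro continuous_intros)
      show "continuous_on T (\<lambda>z. (z, h z))" by (intro continuous_intros cont)
      show "fst ` u \<subseteq> T" by (auto simp: w0 sh_def)
      show "(\<lambda>z. (z, h z)) ` T \<subseteq> u" using h TS by (auto simp: w0 sh_def C_def)
      show "(fst x, h (fst x)) = x" if "x \<in> u" for x
        using that hu by (auto simp: w0 sh_def C_def)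
    qed simp
  qed
qed

section \<open>Implicit differentiation along an algebraic curve\<close>

definition pderiv_x :: "complex poly poly \<Rightarrow> complex poly poly" where
  "pderiv_x P = map_poly pderiv P"

lemma pderiv_x_simps [simp]:
  "pderiv_x 0 = 0" "pderiv_x (pCons a P) = pCons (pderiv a) (pderiv_x P)"
  by (simp_all add: pderiv_x_def map_poly_pCons)

lemma coeff_pderiv_x [simp]: "coeff (pderiv_x P) i = pderiv (coeff P i)"
  by (simp add: pderiv_x_def coeff_map_poly)

lemma poly2_has_field_derivative:
  assumes "(f has_field_derivative f') (at t within A)" "(g has_field_derivative g') (at t within A)"
  shows "((\<lambda>t. poly2 P (f t) (g t)) has_field_derivative
     (poly2 (pderiv_x P) (f t) (g t) * f' + poly2 (pderiv P) (f t) (g t) * g')) (at t within A)"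
proof (induction P)
  case (pCons a P)
  have "((\<lambda>t. poly a (f t)) has_field_derivative poly (pderiv a) (f t) * f') (at t within A)"
    by (rule DERIV_chain2[OF poly_DERIV assms(1)])
  note [derivative_intros] = this pCons.IH assms
  show ?case
    by (auto intro!: derivative_eq_intros simp: pderiv_pCons algebra_simps)
qed auto

text \<open>Hadamard's lemma in algebraic form. Since \<open>J\<close> and \<open>K\<close> are
  polynomials, they are continuous along any continuous branch, so that differentiability of the
  branch will follow from continuity.\<close>

lemma poly2_hadamard:
  fixes P :: "complex poly poly"
  shows "\<exists>J K. (\<forall>z w. poly2 P z w - poly2 P z1 w1 = (z - z1) * poly2 J z w + (w - w1) * poly2 K z w) \<and>
     poly2 J z1 w1 = poly2 (pderiv_x P) z1 w1 \<and> poly2 K z1 w1 = poly2 (pderiv P) z1 w1"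
proof (induction P)
  case (pCons a P)
  then obtain J K where JK: "\<And>z w. poly2 P z w - poly2 P z1 w1 = (z - z1) * poly2 J z w + (w - w1) * poly2 K z w"
     "poly2 J z1 w1 = poly2 (pderiv_x P) z1 w1" "poly2 K z1 w1 = poly2 (pderiv P) z1 w1" by blast
  define q where "q = synthetic_div a z1"
  have a: "a = [:-z1, 1:] * q + [:poly a z1:]" using synthetic_div_correct'[of z1 a] by (simp add: q_def)
  have a1: "poly a z - poly a z1 = (z - z1) * poly q z" for z
    by (subst (1) a) (simp add: algebra_simps)
  have a2: "poly (pderiv a) z1 = poly q z1"
  proof -
    have "pderiv a = pderiv ([:-z1, 1:] * q + [:poly a z1:])" using a by simp
    also have "\<dots> = [:-z1, 1:] * pderiv q + q"
      by (simp only: pderiv_add pderiv_mult) (simp add: pderiv_pCons)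
    finally show ?thesis by simp
  qed
  show ?case
  proof (intro exI conjI allI)
    fix z w
    have "poly2 (pCons a P) z w - poly2 (pCons a P) z1 w1 =
       (poly a z - poly a z1) + (w - w1) * poly2 P z1 w1 + w * (poly2 P z w - poly2 P z1 w1)"
      by (simp add: algebra_simps)
    also have "\<dots> = (z - z1) * poly2 ([:q:] + pCons 0 J) z w + (w - w1) * poly2 ([:[:poly2 P z1 w1:]:] + pCons 0 K) z w"
      unfolding a1 JK(1) by (simp add: algebra_simps)
    finally show "poly2 (pCons a P) z w - poly2 (pCons a P) z1 w1 =
      (z - z1) * poly2 ([:q:] + pCons 0 J) z w + (w - w1) * poly2 ([:[:poly2 P z1 w1:]:] + pCons 0 K) z w" .
  qed (use JK a2 in \<open>auto simp: pderiv_pCons\<close>)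
qed (auto intro!: exI[of _ 0])

text \<open>On the curve the left side of the Hadamard identity is 0, so the difference quotient of
  \<phi> equals -J/K, and continuity of \<phi> gives its limit.\<close>

lemma implicit_derivative:
  fixes P :: "complex poly poly"
  assumes cont: "continuous_on \<Omega> \<phi>" and op: "open \<Omega>" and z1: "z1 \<in> \<Omega>"
    and zero: "\<And>z. z \<in> \<Omega> \<Longrightarrow> poly2 P z (\<phi> z) = 0" and nz: "poly2 (pderiv P) z1 (\<phi> z1) \<noteq> 0"
  shows "(\<phi> has_field_derivative (- poly2 (pderiv_x P) z1 (\<phi> z1) / poly2 (pderiv P) z1 (\<phi> z1))) (at z1)"
proof -
  obtain J K where JK: "\<And>z w. poly2 P z w - poly2 P z1 (\<phi> z1) = (z - z1) * poly2 J z w + (w - \<phi> z1) * poly2 K z w"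
     "poly2 J z1 (\<phi> z1) = poly2 (pderiv_x P) z1 (\<phi> z1)" "poly2 K z1 (\<phi> z1) = poly2 (pderiv P) z1 (\<phi> z1)"
    using poly2_hadamard by blast
  have lim: "((\<lambda>z. poly2 Q z (\<phi> z)) \<longlongrightarrow> poly2 Q z1 (\<phi> z1)) (at z1)" for Q
  proof -
    have "continuous_on \<Omega> (\<lambda>z. poly2 Q z (\<phi> z))" by (intro continuous_intros cont)
    thus ?thesis using op z1 by (simp add: continuous_on_eq_continuous_at isCont_def)
  qed
  have "\<forall>\<^sub>F z in at z1. z \<in> \<Omega> \<and> z \<noteq> z1"
    using op z1 eventually_at_in_open' eventually_at_filter by (auto simp: eventually_at_topological)
  moreover have "\<forall>\<^sub>F z in at z1. poly2 K z (\<phi> z) \<noteq> 0"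
    using tendsto_imp_eventually_ne[OF lim[of K], of 0] nz JK(3) by simp
  ultimately have ev: "\<forall>\<^sub>F z in at z1. - poly2 J z (\<phi> z) / poly2 K z (\<phi> z) = (\<phi> z - \<phi> z1) / (z - z1)"
  proof eventually_elim
    case (elim z)
    have "(z - z1) * poly2 J z (\<phi> z) + (\<phi> z - \<phi> z1) * poly2 K z (\<phi> z) = 0"
      using JK(1)[of z "\<phi> z"] zero[of z] zero[OF z1] elim by simp
    hence "(\<phi> z - \<phi> z1) * poly2 K z (\<phi> z) = - poly2 J z (\<phi> z) * (z - z1)"
      by (simp only: add_eq_0_iff mult_minus_left mult.commute[of "z - z1"])
    hence "(\<phi> z - \<phi> z1) / (z - z1) = - poly2 J z (\<phi> z) / poly2 K z (\<phi> z)"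
      using elim by (subst frac_eq_eq) auto
    thus ?case by (rule sym)
  qed
  have "((\<lambda>z. - poly2 J z (\<phi> z) / poly2 K z (\<phi> z)) \<longlongrightarrow> - poly2 J z1 (\<phi> z1) / poly2 K z1 (\<phi> z1)) (at z1)"
    using nz JK(3) by (intro tendsto_intros lim) auto
  hence "((\<lambda>z. (\<phi> z - \<phi> z1) / (z - z1)) \<longlongrightarrow> - poly2 J z1 (\<phi> z1) / poly2 K z1 (\<phi> z1)) (at z1)"
    using ev by (rule Lim_transform_eventually)
  thus ?thesis by (simp add: has_field_derivative_iff JK)
qed

text \<open>The plane slit along the rays that start at the points of \<open>B\<close> and point away from \<open>a\<close>.\<close>

definition star_domain :: "complex \<Rightarrow> complex set \<Rightarrow> complex set" where
  "star_domain a B = {z. \<forall>b\<in>B. \<not> (Im ((z - a) / (b - a)) = 0 \<and> Re ((z - a) / (b - a)) \<ge> 1)}"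

lemma star_domain_props:
  assumes "finite B" "a \<notin> B"
  shows "open (star_domain a B)" "a \<in> star_domain a B" "star_domain a B \<inter> B = {}" "starlike (star_domain a B)"
proof -
  have "open (\<Inter>b\<in>B. {z. Im ((z - a) / (b - a)) \<noteq> 0} \<union> {z. Re ((z - a) / (b - a)) < 1})"
    using assms by (intro open_INT ballI open_Un open_Collect_neq open_Collect_less continuous_intros) auto
  also have "(\<Inter>b\<in>B. {z. Im ((z - a) / (b - a)) \<noteq> 0} \<union> {z. Re ((z - a) / (b - a)) < 1}) = star_domain a B"
    by (auto simp: star_domain_def not_le)
  finally show "open (star_domain a B)" .
  show a: "a \<in> star_domain a B" by (simp add: star_domain_def)
  show "star_domain a B \<inter> B = {}" 
  proof -
    have "b \<notin> star_domain a B" if "b \<in> B" for b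
    proof -
      have "(b - a) / (b - a) = 1" using that assms by auto
      thus ?thesis using that unfolding star_domain_def by (intro notI) (metis (mono_tags, lifting) mem_Collect_eq one_complex.sel order_refl)
    qed
    thus ?thesis by blast
  qed
  have "x \<in> star_domain a B" if z: "z \<in> star_domain a B" and x: "x \<in> closed_segment a z" for x z
  proof -
    obtain t where t: "0 \<le> t" "t \<le> 1" "x = (1 - t) *\<^sub>R a + t *\<^sub>R z" using x by (auto simp: closed_segment_def)
    have xa: "x - a = of_real t * (z - a)" by (simp add: t scaleR_conv_of_real algebra_simps)
    show ?thesis unfolding star_domain_def
    proof (safe)
      fix b assume b: "b \<in> B" "Im ((x - a) / (b - a)) = 0" "1 \<le> Re ((x - a) / (b - a))"
      define u where "u = (z - a) / (b - a)"
      have u: "(x - a) / (b - a) = of_real t * u" by (simp add: u_def xa)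
      have "t * Im u = 0" "1 \<le> t * Re u" using b(2,3) unfolding u by auto
      hence "t \<noteq> 0" "Im u = 0" by auto
      moreover have "Re u \<ge> 1"
      proof (rule ccontr)
        assume "\<not> Re u \<ge> 1"
        hence "t * Re u < t * 1" using t \<open>t \<noteq> 0\<close> by (intro mult_strict_left_mono) auto
        thus False using \<open>1 \<le> t * Re u\<close> t by simp
      qed
      ultimately show False using z b(1) by (auto simp: star_domain_def u_def)
    qed
  qed
  thus "starlike (star_domain a B)" using a unfolding starlike_def by blast
qed

text \<open>A point of a removed ray is a + s (b - a) with s at least 1. If b has the height of a,
  the ray keeps distance |Im a| from the real axis and misses the open disc. Otherwise the small
  height of points in the disc bounds s, so the ray meets only discs with bounded n.\<close>

lemma star_domain_contains_balls:
  assumes "finite B" "a \<notin> B" "Im a \<noteq> 0"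
  shows "\<forall>\<^sub>F n in sequentially. ball (- of_nat n) \<bar>Im a\<bar> \<subseteq> star_domain a B"
proof -
  have "\<forall>\<^sub>F n in sequentially. \<forall>z\<in>ball (- of_nat n) \<bar>Im a\<bar>. \<not> (Im ((z - a) / (b - a)) = 0 \<and> Re ((z - a) / (b - a)) \<ge> 1)"
    if b: "b \<in> B" for b
  proof -
    have ba: "b \<noteq> a" using b assms by auto
    \<comment> \<open>Bound for the ray parameter: heights in the disc differ from Im a by at most 2
      |Im a|.\<close>
    define S where "S = 2 * \<bar>Im a\<bar> / \<bar>Im (b - a)\<bar>"
    obtain n0 :: nat where n0: "real n0 > norm a + S * norm (b - a) + \<bar>Im a\<bar>" using reals_Archimedean2 by blast
    show ?thesis
    proof (rule eventually_sequentiallyI[of n0], intro ballI notI)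
      fix n z assume n: "n \<ge> n0" and z: "z \<in> ball (- of_nat n) \<bar>Im a\<bar>"
        and *: "Im ((z - a) / (b - a)) = 0 \<and> Re ((z - a) / (b - a)) \<ge> 1"
      define s where "s = Re ((z - a) / (b - a))"
      have s: "s \<ge> 1" using * by (simp add: s_def)
      have "(z - a) / (b - a) = of_real s" using * by (simp add: complex_eq_iff s_def)
      hence za: "z - a = of_real s * (b - a)" using ba by (simp add: field_simps)
      have nz: "norm (z + of_nat n) < \<bar>Im a\<bar>" using z by (simp add: dist_norm norm_minus_commute add.commute)
      have imz: "\<bar>Im z\<bar> < \<bar>Im a\<bar>" using abs_Im_le_cmod[of "z + of_nat n"] nz by simp
      have im: "Im z - Im a = s * Im (b - a)" using arg_cong[OF za, of Im] by simp
      show False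
      proof (cases "Im (b - a) = 0")
        case True
        thus False using im imz by simp
      next
        case False
        have "s * \<bar>Im (b - a)\<bar> = \<bar>Im z - Im a\<bar>" using s by (simp add: im abs_mult)
        also have "\<dots> \<le> 2 * \<bar>Im a\<bar>" using imz by linarith
        finally have "s \<le> S" using False by (simp add: S_def field_simps)
        have "real n = norm (of_nat n :: complex)" by simp
        also have "\<dots> = norm ((z + of_nat n) - (z - a) - a)" by (rule arg_cong[of _ _ norm]) simp
        also have "\<dots> \<le> norm (z + of_nat n) + norm (z - a) + norm a"
          by (meson norm_triangle_ineq4 order_trans add_right_mono)
        also have "norm (z - a) = s * norm (b - a)" using s by (simp add: za norm_mult)
        also have "\<dots> \<le> S * norm (b - a)" using \<open>s \<le> S\<close> by (intro mult_right_mono) auto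
        finally have "real n < norm a + S * norm (b - a) + \<bar>Im a\<bar>" using nz by linarith
        thus False using n0 n by linarith
      qed
    qed
  qed
  hence "\<forall>\<^sub>F n in sequentially. \<forall>b\<in>B. \<forall>z\<in>ball (- of_nat n) \<bar>Im a\<bar>. \<not> (Im ((z - a) / (b - a)) = 0 \<and> Re ((z - a) / (b - a)) \<ge> 1)"
    using assms(1) by (simp add: eventually_ball_finite)
  thus ?thesis by eventually_elim (auto simp: star_domain_def)
qed

text \<open>Outside the zeros of \<open>D\<close> and of the leading coefficient, the Bezout
  identity makes all roots simple and their number constant. The roots then form a covering, and the
  inclusion of the slit plane lifts through (a, b). The last clause serves to recognise \<phi> as
  complex conjugation at points of the curve near \<open>a\<close>.\<close>

lemma algebraic_branch:
  fixes P :: "complex poly poly" and D :: "complex poly"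
  assumes deg: "degree P > 0" and bez: "A * P + B * pderiv P = [:D:]" and D: "poly D a \<noteq> 0"
    and lca: "poly (lead_coeff P) a \<noteq> 0" and a: "poly2 P a b = 0" "Im a \<noteq> 0"
  shows "\<exists>\<Omega> \<phi> d e. open \<Omega> \<and> connected \<Omega> \<and> a \<in> \<Omega> \<and> \<phi> holomorphic_on \<Omega> \<and>
    (\<forall>z\<in>\<Omega>. poly2 P z (\<phi> z) = 0) \<and>
    (\<forall>z\<in>\<Omega>. (\<phi> has_field_derivative (- poly2 (pderiv_x P) z (\<phi> z) / poly2 (pderiv P) z (\<phi> z))) (at z)) \<and>
    (\<forall>\<^sub>F n in sequentially. ball (- of_nat n) \<bar>Im a\<bar> \<subseteq> \<Omega>) \<and>
    d > 0 \<and> e > 0 \<and> ball a d \<subseteq> \<Omega> \<and>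
    (\<forall>z\<in>ball a d. \<forall>w\<in>ball b e. poly2 P z w = 0 \<longrightarrow> w = \<phi> z)"
proof -
  define Bad where "Bad = {z. poly (D * lead_coeff P) z = 0}"
  have "D * lead_coeff P \<noteq> 0" using D lca by auto
  hence fin: "finite Bad" unfolding Bad_def by (rule poly_roots_finite)
  have aB: "a \<notin> Bad" using D lca by (simp add: Bad_def)
  define \<Omega> where "\<Omega> = star_domain a Bad"
  note \<Omega> = star_domain_props[OF fin aB, folded \<Omega>_def]
  have nz: "poly2 (pderiv P) z w \<noteq> 0" if "z \<notin> Bad" "poly2 P z w = 0" for z w
  proof -
    have "poly2 B z w * poly2 (pderiv P) z w = poly D z"
      using arg_cong[OF bez, of "\<lambda>t. poly2 t z w"] that by simp
    thus ?thesis using that by (auto simp: Bad_def)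
  qed
  have lc: "poly (lead_coeff P) z \<noteq> 0" if "z \<in> - Bad" for z using that by (auto simp: Bad_def)
  have card: "card {w. poly2 P z w = 0} = degree P" if "z \<in> - Bad" for z
  proof -
    have dz: "degree (poly_at_x z P) = degree P" by (rule degree_poly_at_x[OF lc[OF that]])
    hence "poly_at_x z P \<noteq> 0" using deg by auto
    hence "card {w. poly (poly_at_x z P) w = 0} = degree (poly_at_x z P)"
      by (rule card_simple_roots) (use nz that in \<open>auto simp: pderiv_poly_at_x\<close>)
    thus ?thesis using dz by simp
  qed
  have opB: "open (- Bad)" using fin by (simp add: finite_imp_closed open_Compl)
  define C where "C = {(z, w). z \<in> - Bad \<and> poly2 P z w = 0}"
  have cov: "covering_space C fst (- Bad)"
    unfolding C_def by (rule covering_space_poly2[OF deg opB lc card])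
  obtain g where g: "continuous_on \<Omega> g" "g \<in> \<Omega> \<rightarrow> C" "g a = (a, b)" "\<And>y. y \<in> \<Omega> \<Longrightarrow> fst (g y) = y"
  proof (rule covering_space_lift_strong[OF cov, of "(a,b)" a \<Omega> "\<lambda>x. x"])
    show "(a, b) \<in> C" using a aB by (simp add: C_def)
    show "simply_connected \<Omega>" using \<Omega> starlike_imp_simply_connected by blast
    show "locally path_connected \<Omega>" using \<Omega> open_imp_locally_path_connected by blast
  qed (use \<Omega> in auto)
  define \<phi> where "\<phi> = (\<lambda>z. snd (g z))"
  have gz: "g z = (z, \<phi> z)" if "z \<in> \<Omega>" for z using g(4)[OF that] by (simp add: \<phi>_def prod_eq_iff)
  have zero: "poly2 P z (\<phi> z) = 0" and zB: "z \<notin> Bad" if "z \<in> \<Omega>" for z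
    using g(2) that gz[OF that] by (auto simp: C_def Pi_def)
  have cont: "continuous_on \<Omega> \<phi>" unfolding \<phi>_def by (intro continuous_intros g)
  have der: "(\<phi> has_field_derivative (- poly2 (pderiv_x P) z (\<phi> z) / poly2 (pderiv P) z (\<phi> z))) (at z)"
    if "z \<in> \<Omega>" for z
    by (rule implicit_derivative[OF cont \<Omega>(1) that zero nz]) (use that zero zB in auto)
  have phia: "\<phi> a = b" by (simp add: \<phi>_def g)
  have "a \<in> - Bad" using aB by simp
  from local_sheets[OF deg lc[OF this] card[OF this] zero_less_one]
  obtain e where e: "e > 0" "e \<le> 1"
    "\<forall>w w'. poly2 P a w = 0 \<longrightarrow> poly2 P a w' = 0 \<longrightarrow> w \<noteq> w' \<longrightarrow> ball w e \<inter> ball w' e = {}"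
    "\<forall>e'>0. e' \<le> e \<longrightarrow> (\<exists>d>0. \<forall>z\<in>ball a d. unramified_near P a e' z)"
    by (elim exE conjE) (rule that)
  obtain d1 where d1: "d1 > 0" "\<forall>z\<in>ball a d1. unramified_near P a e z"
    using e(4)[rule_format, OF e(1) order_refl] by (elim exE conjE) (rule that)
  obtain d2 where d2: "d2 > 0" "ball a d2 \<subseteq> \<Omega>" using \<Omega> open_contains_ball by blast
  have "isCont \<phi> a" using cont \<Omega> by (simp add: continuous_on_eq_continuous_at)
  then obtain d3 where d3: "d3 > 0" "\<And>z. dist z a < d3 \<Longrightarrow> dist (\<phi> z) (\<phi> a) < e"
    using e(1) unfolding continuous_at_eps_delta by blast
  \<comment> \<open>\<open>d1\<close> gives uniqueness of the root near \<open>b\<close>,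
    \<open>d2\<close> keeps z in the domain, and \<open>d3\<close> keeps \<phi> z in the disc of
    uniqueness.\<close>
  define d where "d = min d1 (min d2 d3)"
  have uniq: "w = \<phi> z" if "z \<in> ball a d" "w \<in> ball b e" "poly2 P z w = 0" for z w
  proof -
    have z: "z \<in> ball a d1" "z \<in> \<Omega>" "dist z a < d3" using that(1) d2 by (auto simp: d_def dist_commute)
    have "\<phi> z \<in> ball b e" using d3(2)[OF z(3)] phia by (simp add: dist_commute)
    thus ?thesis using unramified_nearD(1)[OF bspec[OF d1(2) z(1)] a(1)] that zero[OF z(2)] by blast
  qed
  show ?thesis
  proof (rule exI[of _ \<Omega>], rule exI[of _ \<phi>], rule exI[of _ d], rule exI[of _ e], intro conjI ballI impI)
    show "\<phi> holomorphic_on \<Omega>" unfolding holomorphic_on_def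
      using der field_differentiable_at_within field_differentiable_def by blast
    show "connected \<Omega>" using \<Omega> starlike_imp_connected by blast
    show "\<forall>\<^sub>F n in sequentially. ball (- of_nat n) \<bar>Im a\<bar> \<subseteq> \<Omega>"
      unfolding \<Omega>_def by (rule star_domain_contains_balls[OF fin aB a(2)])
    show "d > 0" "ball a d \<subseteq> \<Omega>" using d1 d2 d3 by (auto simp: d_def)
  qed (fact \<Omega> zero der e(1) uniq)+
qed

section \<open>Estimates for the reciprocal Gamma function\<close>

text \<open>The functional equation applied m times. This shape separates the simple zero, with
  slope (-1)^m m!, from a factor that tends to 1 as (m + 1) \<eta> tends to 0.\<close>

lemma rGamma_shift:
  fixes \<eta> :: complex
  shows "rGamma (\<eta> - of_nat m) = (-1) ^ m * fact m * \<eta> * ((\<Prod>k<m. 1 + (- \<eta> / of_nat (Suc k))) * rGamma (1 + \<eta>))"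
proof (induction m)
  case 0
  show ?case using rGamma_plus1[of \<eta>] by (simp add: add.commute)
next
  case (Suc m)
  have "rGamma (\<eta> - of_nat (Suc m)) = (\<eta> - of_nat (Suc m)) * rGamma (\<eta> - of_nat m)"
    using rGamma_plus1[of "\<eta> - of_nat (Suc m)"] by (simp add: algebra_simps)
  also have "(\<eta> - of_nat (Suc m)) * rGamma (\<eta> - of_nat m) =
      - of_nat (Suc m) * (1 + (- \<eta> / of_nat (Suc m))) * rGamma (\<eta> - of_nat m)"
    by (simp add: field_simps del: of_nat_Suc)
  finally show ?case unfolding Suc.IH by (simp add: mult_ac del: of_nat_Suc)
qed

text \<open>Uniformity in m comes from the condition on |\<eta>| (m + 1): the product in
  \<open>rGamma_shift\<close> differs from 1 by at most exp(m |\<eta>|) - 1, and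
  \<open>rGamma\<close> is continuous at 1 with value 1.\<close>

lemma rGamma_near_pole:
  fixes \<epsilon> :: real
  assumes "\<epsilon> > 0"
  shows "\<exists>\<delta>>0. \<forall>m (\<eta>::complex). norm \<eta> * real (Suc m) \<le> \<delta> \<longrightarrow>
       norm (rGamma (\<eta> - of_nat m) - (-1) ^ m * fact m * \<eta>) \<le> \<epsilon> * (fact m * norm \<eta>)"
proof -
  \<comment> \<open>The errors of the two factors combine to at most three times this number, since
    |F| is at most 2.\<close>
  define \<epsilon>' where "\<epsilon>' = min 1 (\<epsilon> / 4)"
  have \<epsilon>': "\<epsilon>' > 0" "\<epsilon>' \<le> 1" "4 * \<epsilon>' \<le> \<epsilon>" using assms by (auto simp: \<epsilon>'_def)
  have "isCont (\<lambda>\<eta>::complex. rGamma (1 + \<eta>)) 0" by (intro continuous_intros) 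
  then obtain \<delta>1 where \<delta>1: "\<delta>1 > 0" "\<And>\<eta>::complex. norm \<eta> < \<delta>1 \<Longrightarrow> norm (rGamma (1 + \<eta>) - 1) < \<epsilon>'"
    using \<epsilon>'(1) unfolding continuous_at_eps_delta by (fastforce simp: dist_norm)
  have "isCont exp (0::real)" by (intro continuous_intros)
  then obtain \<delta>2 where \<delta>2: "\<delta>2 > 0" "\<And>x::real. \<bar>x\<bar> < \<delta>2 \<Longrightarrow> \<bar>exp x - 1\<bar> < \<epsilon>'"
    using \<epsilon>'(1) unfolding continuous_at_eps_delta by (fastforce simp: dist_norm)
  define \<delta> where "\<delta> = min \<delta>1 \<delta>2 / 2"
  have \<delta>: "\<delta> > 0" "\<delta> < \<delta>1" "\<delta> < \<delta>2" using \<delta>1 \<delta>2 by (auto simp: \<delta>_def min_def)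
  show ?thesis
  proof (intro exI[of _ \<delta>] conjI allI impI \<delta>(1))
    fix m and \<eta> :: complex assume *: "norm \<eta> * real (Suc m) \<le> \<delta>"
    define F where "F = (\<Prod>k<m. 1 + (- \<eta> / of_nat (Suc k)))"
    define r where "r = rGamma (1 + \<eta>)"
    have "norm \<eta> * 1 \<le> norm \<eta> * real (Suc m)" by (intro mult_left_mono) auto
    hence "norm \<eta> < \<delta>1" using * \<delta> by linarith
    hence r: "norm (r - 1) < \<epsilon>'" using \<delta>1(2) by (simp add: r_def)
    have "norm (F - 1) \<le> (\<Prod>k<m. 1 + norm (- \<eta> / of_nat (Suc k))) - 1"
      unfolding F_def by (rule norm_prod_minus1_le_prod_minus1)
    also have "(\<Prod>k<m. 1 + norm (- \<eta> / of_nat (Suc k))) \<le> exp (\<Sum>k<m. norm (- \<eta> / of_nat (Suc k)))"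
      by (rule prod_le_exp_sum) auto
    also have "(\<Sum>k<m. norm (- \<eta> / of_nat (Suc k))) \<le> (\<Sum>k<m. norm \<eta>)"
      by (intro sum_mono) (simp add: norm_divide divide_le_eq mult_le_cancel_left1 del: of_nat_Suc)
    also have "(\<Sum>k<m. norm \<eta>) \<le> norm \<eta> * real (Suc m)" by (simp add: algebra_simps)
    finally have "norm (F - 1) \<le> exp (norm \<eta> * real (Suc m)) - 1" by simp
    also have "\<dots> < \<epsilon>'" using \<delta>2(2)[of "norm \<eta> * real (Suc m)"] * \<delta> by auto
    finally have F: "norm (F - 1) < \<epsilon>'" .
    have "norm F \<le> norm (F - 1) + norm (1::complex)" by (metis diff_add_cancel norm_triangle_ineq)
    hence F2: "norm F \<le> 2" using F \<epsilon>' by simp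
    have "F * r - 1 = F * (r - 1) + (F - 1)" by (simp add: algebra_simps)
    hence "norm (F * r - 1) \<le> norm F * norm (r - 1) + norm (F - 1)"
      by (metis norm_mult norm_triangle_ineq)
    also have "\<dots> \<le> 2 * \<epsilon>' + \<epsilon>'" using F F2 r by (intro add_mono mult_mono) auto
    finally have Fr: "norm (F * r - 1) \<le> \<epsilon>" using \<epsilon>' by linarith
    have "rGamma (\<eta> - of_nat m) - (-1) ^ m * fact m * \<eta> = (-1) ^ m * fact m * \<eta> * (F * r - 1)"
      unfolding rGamma_shift F_def r_def by (simp add: algebra_simps)
    hence "norm (rGamma (\<eta> - of_nat m) - (-1) ^ m * fact m * \<eta>) = fact m * norm \<eta> * norm (F * r - 1)"
      by (simp add: norm_mult norm_power)
    also have "\<dots> \<le> fact m * norm \<eta> * \<epsilon>" using Fr by (intro mult_left_mono) auto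
    finally show "norm (rGamma (\<eta> - of_nat m) - (-1) ^ m * fact m * \<eta>) \<le> \<epsilon> * (fact m * norm \<eta>)"
      by (simp add: mult_ac)
  qed
qed

section \<open>Factorials against powers\<close>

lemma fact_mult_power_le: "fact j * real j ^ i \<le> fact (j + i)"
proof (induction i)
  case (Suc i)
  have "fact j * real j ^ Suc i = (fact j * real j ^ i) * real j" by simp
  also have "\<dots> \<le> fact (j + i) * real (j + i + 1)" using Suc.IH by (intro mult_mono) auto
  also have "\<dots> = fact (j + Suc i)" by (simp add: mult.commute)
  finally show ?case .
qed simp

lemma half_power_mult_fact_le:
  assumes "2 * i \<le> n"
  shows "fact (n - i) * (real n / 2) ^ i \<le> fact n"
proof -
  have "(real n / 2) ^ i \<le> real (n - i) ^ i" using assms by (intro power_mono) (auto simp: of_nat_diff)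
  hence "fact (n - i) * (real n / 2) ^ i \<le> fact (n - i) * real (n - i) ^ i" by (intro mult_left_mono) auto
  also have "\<dots> \<le> fact (n - i + i)" by (rule fact_mult_power_le)
  finally show ?thesis using assms by simp
qed

lemma power_over_fact_tendsto_0: "(\<lambda>n. K * real n ^ N / fact n) \<longlonglongrightarrow> 0"
proof (rule Lim_null_comparison)
  show "\<forall>\<^sub>F n in sequentially. norm (K * real n ^ N / fact n) \<le> \<bar>K\<bar> * 2 ^ Suc N * inverse (real n)"
  proof (rule eventually_sequentiallyI[of "2 * Suc N"])
    fix n assume n: "n \<ge> 2 * Suc N"
    have "1 * (real n / 2) ^ Suc N \<le> fact (n - Suc N) * (real n / 2) ^ Suc N"
      by (intro mult_right_mono) auto
    also have "\<dots> \<le> fact n" by (rule half_power_mult_fact_le[OF n])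
    finally have "real n ^ N * real n \<le> fact n * 2 ^ Suc N" by (simp add: power_divide field_simps)
    hence "real n ^ N / fact n \<le> 2 ^ Suc N * inverse (real n)" using n by (simp add: field_simps)
    hence "\<bar>K\<bar> * (real n ^ N / fact n) \<le> \<bar>K\<bar> * (2 ^ Suc N * inverse (real n))" by (intro mult_left_mono) auto
    thus "norm (K * real n ^ N / fact n) \<le> \<bar>K\<bar> * 2 ^ Suc N * inverse (real n)" by (simp add: abs_mult)
  qed
  show "(\<lambda>n. \<bar>K\<bar> * 2 ^ Suc N * inverse (real n)) \<longlonglongrightarrow> 0"
    by (rule tendsto_mult_right_zero[OF lim_inverse_n])
qed

lemma eventually_power_over_fact_less:
  assumes "e > 0" shows "\<forall>\<^sub>F n in sequentially. K * real n ^ N / fact n < e"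
  using order_tendstoD(2)[OF power_over_fact_tendsto_0 assms] .

text \<open>If m exceeded n + M, then m!/n! would contain at least M + 1 factors larger than n, too
  many for a bound of order n^M.\<close>

lemma fact_le_upper:
  "\<forall>\<^sub>F n in sequentially. \<forall>m. fact m \<le> K * real n ^ M * fact n \<longrightarrow> m \<le> n + M"
proof -
  obtain n0 where n0: "real n0 > K" using reals_Archimedean2 by blast
  show ?thesis
  proof (rule eventually_sequentiallyI[of "Suc n0"], intro allI impI, rule ccontr)
    fix n m assume n: "n \<ge> Suc n0" and m: "fact m \<le> K * real n ^ M * fact n" "\<not> m \<le> n + M"
    have "fact n * real n ^ Suc M \<le> fact (n + Suc M)" by (rule fact_mult_power_le)
    also have "\<dots> \<le> (fact m :: real)" using m by (intro fact_mono) auto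
    also note m(1)
    finally have "real n * (fact n * real n ^ M) \<le> K * (fact n * real n ^ M)" by (simp add: mult_ac)
    hence "real n \<le> K" using n by (subst (asm) mult_le_cancel_right) auto
    thus False using n0 n by linarith
  qed
qed

text \<open>The counterpart for m far below n: the M + 1 surplus factors of n! are at least n/2 for
  large n, which costs the powers of 2.\<close>

lemma fact_le_lower:
  assumes "K > 0"
  shows "\<forall>\<^sub>F n in sequentially. \<forall>m. fact n \<le> K * real n ^ M * fact m \<longrightarrow> n \<le> m + M"
proof -
  obtain n0 where n0: "real n0 > K * 2 ^ Suc M" using reals_Archimedean2 by blast
  show ?thesis
  proof (rule eventually_sequentiallyI[of "2 * Suc M + Suc n0"], intro allI impI, rule ccontr)
    fix n m assume n: "n \<ge> 2 * Suc M + Suc n0" and m: "fact n \<le> K * real n ^ M * fact m" "\<not> n \<le> m + M"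
    have "fact m \<le> (fact (n - Suc M) :: real)" using m by (intro fact_mono) auto
    have "fact (n - Suc M) * (real n / 2) ^ Suc M \<le> fact n"
      by (rule half_power_mult_fact_le) (use n in auto)
    also note m(1)
    also have "K * real n ^ M * fact m \<le> K * real n ^ M * fact (n - Suc M)"
      using \<open>fact m \<le> _\<close> assms by (intro mult_left_mono) auto
    finally have "real n * (real n ^ M * fact (n - Suc M)) \<le> (K * 2 ^ Suc M) * (real n ^ M * fact (n - Suc M))"
      by (simp add: power_divide field_simps)
    hence "real n \<le> K * 2 ^ Suc M" using n by (subst (asm) mult_le_cancel_right) auto
    thus False using n0 n by linarith
  qed
qed

text \<open>On the real line near -n, (-1)^n \<open>rGamma\<close> deviates from n! s by at most
  half of n! |s|. The intermediate value theorem then reaches every value between -|c| and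
  |c|.\<close>

lemma rGamma_real_solution:
  fixes c :: real
  shows "\<forall>\<^sub>F n in sequentially. \<exists>s::real. \<bar>s\<bar> \<le> 2 * \<bar>c\<bar> / fact n \<and> rGamma (of_real s - of_nat n) = complex_of_real c"
proof -
  obtain \<delta> where \<delta>: "\<delta> > 0"
    "\<forall>m (\<eta>::complex). norm \<eta> * real (Suc m) \<le> \<delta> \<longrightarrow>
       norm (rGamma (\<eta> - of_nat m) - (-1) ^ m * fact m * \<eta>) \<le> (1/2) * (fact m * norm \<eta>)"
    using rGamma_near_pole[of "1/2"] half_gt_zero_iff zero_less_one by blast
  have "\<forall>\<^sub>F n in sequentially. (4 * \<bar>c\<bar>) * real n ^ 1 / fact n < \<delta>"
    by (rule eventually_power_over_fact_less[OF \<delta>(1)])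
  thus ?thesis using eventually_ge_at_top[of 1]
  proof eventually_elim
    case (elim n)
    \<comment> \<open>At distance \<open>S\<close> the main term has size 2 |c|, and half of it
      survives the error.\<close>
    define S where "S = 2 * \<bar>c\<bar> / fact n"
    have "S * real (Suc n) \<le> S * (2 * real n)" using elim by (intro mult_left_mono) (auto simp: S_def)
    also have "\<dots> = (4 * \<bar>c\<bar>) * real n ^ 1 / fact n" by (simp add: S_def)
    finally have S: "S * real (Suc n) < \<delta>" using elim by linarith
    define h where "h = (\<lambda>s. (-1) ^ n * rGamma (s - real n))"
    have h: "\<bar>h s - fact n * s\<bar> \<le> (1/2) * (fact n * \<bar>s\<bar>)" if s: "\<bar>s\<bar> \<le> S" for s
    proof -
      have "\<bar>s\<bar> * real (Suc n) \<le> S * real (Suc n)" using s by (intro mult_right_mono) auto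
      hence "norm (complex_of_real s) * real (Suc n) \<le> \<delta>" using S unfolding norm_of_real by linarith
      note \<delta>(2)[rule_format, OF this]
      also have "rGamma (complex_of_real s - of_nat n) - (-1) ^ n * fact n * of_real s =
          of_real ((-1) ^ n * (h s - fact n * s))"
        by (simp add: h_def algebra_simps flip: rGamma_complex_of_real power_mult_distrib)
      finally show ?thesis unfolding norm_of_real by (simp add: abs_mult)
    qed
    have cont: "continuous_on {-S..S} h"
      unfolding h_def by (intro continuous_at_imp_continuous_on ballI) (intro continuous_intros)
    have S0: "S \<ge> 0" "fact n * S = 2 * \<bar>c\<bar>" by (auto simp: S_def)
    have hS: "h S \<ge> \<bar>c\<bar>" "h (-S) \<le> -\<bar>c\<bar>" using h[of S] h[of "-S"] S0 by simp_all
    have "\<bar>(-1) ^ n * c\<bar> = \<bar>c\<bar>" by (simp add: abs_mult)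
    hence "h (-S) \<le> (-1) ^ n * c" "(-1) ^ n * c \<le> h S" using hS by linarith+
    then obtain s where s: "-S \<le> s" "s \<le> S" "h s = (-1) ^ n * c"
      using IVT'[of h "-S" "(-1) ^ n * c" S] cont S0 by auto
    have "rGamma (s - real n) = c" using s(3) by (simp add: h_def)
    hence "rGamma (of_real s - of_nat n) = complex_of_real c"
      by (metis of_real_diff of_real_of_nat_eq rGamma_complex_of_real)
    thus ?case using s by (intro exI[of _ s]) (auto simp: S_def)
  qed
qed

text \<open>The terms of the series are (z - 1) / ((k + 1) (z + k)). The distance condition bounds
  1/|z + k| by (2 + |z|) / (\<delta> (k + 1)), which leaves a multiple of the series of 1/(k + 1)^2.
  Up to sign, \<open>Digamma\<close> is the logarithmic derivative of \<open>rGamma\<close>.\<close>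

lemma Digamma_bound:
  "\<exists>C>0. \<forall>(z::complex) \<delta>. 0 < \<delta> \<longrightarrow> \<delta> \<le> 1 \<longrightarrow> (\<forall>k::nat. norm (z + of_nat k) \<ge> \<delta>) \<longrightarrow>
      norm (Digamma z) \<le> C * (2 + norm z) ^ 2 / \<delta>"
proof -
  define S where "S = (\<Sum>k. 1 / real (Suc k) ^ 2)"
  have sumS: "summable (\<lambda>k. 1 / real (Suc k) ^ 2)"
  proof -
    have "summable (\<lambda>k. inverse (real k ^ 2))" using inverse_power_summable[of 2, where ?'a = real] by simp
    hence "summable (\<lambda>k. inverse (real (Suc k) ^ 2))" by (subst summable_Suc_iff)
    thus ?thesis by (simp add: inverse_eq_divide)
  qed
  have S0: "S \<ge> 0" unfolding S_def by (intro suminf_nonneg sumS) auto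
  define C where "C = S + 1 + norm (euler_mascheroni :: complex)"
  show ?thesis
  proof (intro exI[of _ C] conjI allI impI)
    show "C > 0" using S0 by (simp add: C_def add_pos_nonneg)
    fix z :: complex and \<delta> :: real assume \<delta>: "0 < \<delta>" "\<delta> \<le> 1" and "\<forall>k::nat. norm (z + of_nat k) \<ge> \<delta>"
    hence far: "norm (z + of_nat k) \<ge> \<delta>" for k by blast
    define Y where "Y = (2 + norm z) ^ 2 / \<delta>"
    have Y1: "Y \<ge> 1"
    proof -
      have "1 \<le> (2 + norm z) ^ 2" by (intro one_le_power) auto
      hence "\<delta> \<le> (2 + norm z) ^ 2" using \<delta> by linarith
      thus ?thesis using \<delta> by (simp add: Y_def)
    qed
    have z0: "z \<noteq> 0" using far[of 0] \<delta> by auto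
    have term_le: "norm (inverse (of_nat (Suc k)) - inverse (z + of_nat k)) \<le> Y * (1 / real (Suc k) ^ 2)" for k
    proof -
      have zk: "z + of_nat k \<noteq> 0" "norm (z + of_nat k) > 0" using far[of k] \<delta> by auto
      have "real (Suc k) = norm ((z + of_nat k) - (z - 1))" by (simp add: norm_of_nat algebra_simps flip: of_nat_Suc)
      also have "\<dots> \<le> norm (z + of_nat k) + norm (z - 1)" by (rule norm_triangle_ineq4)
      also have "norm (z - 1) \<le> norm z + 1" using norm_triangle_ineq4[of z 1] by simp
      \<comment> \<open>The first summand uses that \<delta> is at most 1, the second that |z + k|
        is at least \<delta>.\<close>
      also have "norm (z + of_nat k) + (norm z + 1) \<le> norm (z + of_nat k) * ((2 + norm z) / \<delta>)"
      proof -
        have "(norm z + 1) * 1 \<le> (norm z + 1) * (norm (z + of_nat k) / \<delta>)"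
          using far[of k] \<delta> by (intro mult_left_mono) auto
        hence "norm (z + of_nat k) + (norm z + 1) \<le> norm (z + of_nat k) / \<delta> + (norm z + 1) * (norm (z + of_nat k) / \<delta>)"
          using \<delta> by (intro add_mono) (simp_all add: le_divide_eq mult_right_le_one_le)
        also have "\<dots> = norm (z + of_nat k) * ((2 + norm z) / \<delta>)" using \<delta> by (simp add: field_simps)
        finally show ?thesis .
      qed
      finally have k1: "1 / norm (z + of_nat k) \<le> (2 + norm z) / \<delta> / real (Suc k)"
        using zk \<delta>(1) by (simp add: field_simps del: of_nat_Suc)
      have "inverse (of_nat (Suc k)) - inverse (z + of_nat k) = (z - 1) / (of_nat (Suc k) * (z + of_nat k))"
      proof -
        have gen: "inverse a - inverse b = (b - a) / (a * b)" if "a \<noteq> 0" "b \<noteq> 0" for a b :: complex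
          using that by (simp add: field_simps)
        show ?thesis using gen[OF of_nat_neq_0[of k] zk(1)] by simp
      qed
      hence "norm (inverse (of_nat (Suc k)) - inverse (z + of_nat k)) = norm (z - 1) / real (Suc k) * (1 / norm (z + of_nat k))"
        by (simp add: norm_divide norm_mult del: of_nat_Suc)
      also have "\<dots> \<le> (2 + norm z) / real (Suc k) * ((2 + norm z) / \<delta> / real (Suc k))"
        using k1 norm_triangle_ineq4[of z 1] \<delta> by (intro mult_mono divide_right_mono) auto
      also have "\<dots> = Y * (1 / real (Suc k) ^ 2)" by (simp add: Y_def power2_eq_square field_simps)
      finally show ?thesis .
    qed
    have "norm (\<Sum>k. inverse (of_nat (Suc k)) - inverse (z + of_nat k)) \<le> (\<Sum>k. Y * (1 / real (Suc k) ^ 2))"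
      by (rule norm_suminf_le[OF term_le]) (intro summable_mult sumS)
    also have "\<dots> = Y * S" unfolding S_def by (rule suminf_mult[OF sumS])
    finally have 1: "norm (\<Sum>k. inverse (of_nat (Suc k)) - inverse (z + of_nat k)) \<le> Y * S" .
    have "norm (Digamma z) \<le> Y * S + norm (euler_mascheroni :: complex)"
      unfolding Digamma_def using 1 norm_triangle_ineq4 by (meson add_right_mono order_trans)
    also have "\<dots> \<le> Y * S + Y * norm (euler_mascheroni :: complex)" using Y1 by (simp add: mult_le_cancel_right1)
    also have "\<dots> \<le> Y * C" using Y1 by (simp add: C_def algebra_simps)
    finally show "norm (Digamma z) \<le> C * (2 + norm z) ^ 2 / \<delta>" by (simp add: Y_def mult.commute)
  qed
qed

text \<open>The derivative on the segment is at most A times the maximum of |\<open>rGamma\<close>|,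
  attained at \<open>v\<close>. By the smallness condition this maximum is at most twice the value
  at \<open>w1\<close>, so the bound refers to an endpoint alone.\<close>

lemma rGamma_diff_bound:
  fixes w1 w2 :: complex
  assumes far: "\<And>w. w \<in> closed_segment w1 w2 \<Longrightarrow> w \<notin> \<int>\<^sub>\<le>\<^sub>0 \<and> norm (Digamma w) \<le> A"
    and small: "A * norm (w1 - w2) \<le> 1/2"
  shows "norm (rGamma w1 - rGamma w2) \<le> 2 * norm (rGamma w1) * A * norm (w1 - w2)"
proof -
  let ?S = "closed_segment w1 w2"
  have A0: "A \<ge> 0" using far[of w1] norm_ge_zero order_trans by (metis ends_in_segment(1))
  have "continuous_on ?S (\<lambda>w. norm (rGamma w))" by (intro continuous_intros)
  then obtain v where v: "v \<in> ?S" "\<And>w. w \<in> ?S \<Longrightarrow> norm (rGamma w) \<le> norm (rGamma v)"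
    using continuous_attains_sup[of ?S "\<lambda>w. norm (rGamma w)"] by auto
  have lip: "norm (rGamma x - rGamma y) \<le> (norm (rGamma v) * A) * norm (x - y)" if "x \<in> ?S" "y \<in> ?S" for x y
  proof (rule field_differentiable_bound[OF convex_closed_segment _ _ that])
    show "(rGamma has_field_derivative -rGamma z * Digamma z) (at z within ?S)" if "z \<in> ?S" for z
      using far[OF that] by (intro has_field_derivative_rGamma_no_nonpos_int) auto
    show "norm (-rGamma z * Digamma z) \<le> norm (rGamma v) * A" if "z \<in> ?S" for z
      using far[OF that] v(2)[OF that] by (auto simp: norm_mult intro!: mult_mono)
  qed
  have "norm (v - w1) \<le> norm (w1 - w2)"
    using segment_bound1[OF v(1)] by (simp add: norm_minus_commute)
  hence "norm (rGamma v - rGamma w1) \<le> norm (rGamma v) * A * norm (w1 - w2)"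
    using lip[of v w1] v(1) A0 mult_left_mono[of "norm (v - w1)" "norm (w1 - w2)" "norm (rGamma v) * A"] by auto
  also have "\<dots> = norm (rGamma v) * (A * norm (w1 - w2))" by simp
  also have "\<dots> \<le> norm (rGamma v) * (1/2)" using small by (intro mult_left_mono) auto
  finally have "norm (rGamma v) \<le> 2 * norm (rGamma w1)"
    using norm_triangle_ineq2[of "rGamma v" "rGamma w1"] by linarith
  hence "norm (rGamma v) * A * norm (w1 - w2) \<le> 2 * norm (rGamma w1) * A * norm (w1 - w2)"
    using A0 by (intro mult_right_mono) auto
  thus ?thesis using lip[of w1 w2] by auto
qed

section \<open>Growth of algebraic functions near the negative integers\<close>

text \<open>Bounds are bare powers of n: any constant is absorbed by a further power once n is
  large. The disc of radius 1 contains all discs on which \<phi> will be studied.\<close>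

lemma poly_growth:
  fixes a :: "complex poly"
  shows "\<exists>N. \<forall>\<^sub>F n in sequentially. \<forall>z\<in>cball (- of_nat n) 1. norm (poly a z) \<le> real n ^ N"
proof (induction a)
  case 0
  show ?case by simp
next
  case (pCons c a)
  then obtain N where N: "\<forall>\<^sub>F n in sequentially. \<forall>z\<in>cball (- of_nat n) 1. norm (poly a z) \<le> real n ^ N" by blast
  have "\<forall>\<^sub>F n in sequentially. norm c \<le> real n"
    using filterlim_real_sequentially unfolding filterlim_at_top by blast
  with N eventually_ge_at_top[of 3]
  have "\<forall>\<^sub>F n in sequentially. \<forall>z\<in>cball (- of_nat n) 1. norm (poly (pCons c a) z) \<le> real n ^ (N + 2)"
  proof eventually_elim
    case (elim n)
    show ?case
    proof
      fix z :: complex assume z: "z \<in> cball (- of_nat n) 1"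
      have "norm z \<le> norm (of_nat n :: complex) + norm (z + of_nat n)"
        using norm_triangle_ineq4[of "z + of_nat n" "of_nat n"] by simp
      hence nz: "norm z \<le> real n + 1" using z by (simp add: dist_norm norm_minus_commute add.commute)
      have n1: "1 \<le> real n ^ N" using elim by (intro one_le_power) auto
      have "norm (poly (pCons c a) z) \<le> norm c + norm z * norm (poly a z)"
        using norm_triangle_ineq[of c "z * poly a z"] by (simp add: norm_mult)
      also have "\<dots> \<le> real n * real n ^ N + (real n + 1) * real n ^ N"
        using elim z nz n1 mult_mono[of "norm c" "real n" 1 "real n ^ N"]
        by (intro add_mono mult_mono) auto
      also have "\<dots> = (2 * real n + 1) * real n ^ N" by (simp add: algebra_simps)
      also have "\<dots> \<le> real n ^ 2 * real n ^ N"
      proof (intro mult_right_mono)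
        have "2 * real n + 1 \<le> 3 * real n" using elim by simp
        also have "\<dots> \<le> real n * real n" using elim by (intro mult_right_mono) auto
        finally show "2 * real n + 1 \<le> real n ^ 2" by (simp add: power2_eq_square)
      qed auto
      finally show "norm (poly (pCons c a) z) \<le> real n ^ (N + 2)" by (simp add: power_add power2_eq_square mult_ac)
    qed
  qed
  thus ?case by blast
qed

lemma power_max_bound:
  assumes "n \<ge> (2::nat)" "x \<le> real n ^ a" "y \<le> real n ^ b"
  shows "x + y \<le> real n ^ (Suc (max a b))"
proof -
  have "real n ^ a \<le> real n ^ max a b" "real n ^ b \<le> real n ^ max a b"
    using assms by (auto intro!: power_increasing)
  hence "x + y \<le> 2 * real n ^ max a b" using assms by linarith
  also have "\<dots> \<le> real n * real n ^ max a b" using assms by (intro mult_right_mono) auto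
  finally show ?thesis by simp
qed

lemma poly2_growth:
  fixes A :: "complex poly poly"
  shows "\<exists>N. \<forall>\<^sub>F n in sequentially. \<forall>z\<in>cball (- of_nat n) 1. \<forall>w. norm w \<le> real n ^ M \<longrightarrow> norm (poly2 A z w) \<le> real n ^ N"
proof (induction A)
  case 0
  show ?case by simp
next
  case (pCons a A)
  then obtain N where N: "\<forall>\<^sub>F n in sequentially. \<forall>z\<in>cball (- of_nat n) 1. \<forall>w. norm w \<le> real n ^ M \<longrightarrow> norm (poly2 A z w) \<le> real n ^ N" by blast
  obtain N' where N': "\<forall>\<^sub>F n in sequentially. \<forall>z\<in>cball (- of_nat n) 1. norm (poly a z) \<le> real n ^ N'"
    using poly_growth by blast
  from N N' eventually_ge_at_top[of 2]
  have "\<forall>\<^sub>F n in sequentially. \<forall>z\<in>cball (- of_nat n) 1. \<forall>w. norm w \<le> real n ^ M \<longrightarrow>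
          norm (poly2 (pCons a A) z w) \<le> real n ^ (Suc (max N' (M + N)))"
  proof eventually_elim
    case (elim n)
    show ?case
    proof (intro ballI allI impI)
      fix z w :: complex assume z: "z \<in> cball (- of_nat n) 1" and w: "norm w \<le> real n ^ M"
      have "norm (w * poly2 A z w) \<le> real n ^ (M + N)"
        unfolding norm_mult power_add using elim z w by (intro mult_mono) auto
      moreover have "norm (poly a z) \<le> real n ^ N'" using elim z by blast
      ultimately have "norm (poly a z) + norm (w * poly2 A z w) \<le> real n ^ (Suc (max N' (M + N)))"
        using elim by (intro power_max_bound)
      thus "norm (poly2 (pCons a A) z w) \<le> real n ^ (Suc (max N' (M + N)))"
        using norm_triangle_ineq[of "poly a z" "w * poly2 A z w"] unfolding poly2_simps by linarith
    qed
  qed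
  thus ?case by blast
qed

lemma poly_lower_bound:
  fixes a :: "complex poly"
  assumes "a \<noteq> 0"
  shows "\<exists>\<kappa>>0. \<forall>\<^sub>F n in sequentially. \<forall>z\<in>cball (- of_nat n) 1. norm (poly a z) \<ge> \<kappa>"
proof (cases "degree a = 0")
  case True
  then obtain c where "a = [:c:]" by (rule degree_eq_zeroE)
  thus ?thesis using assms by (intro exI[of _ "norm c"]) auto
next
  case False
  obtain c p where a: "a = pCons c p" by (cases a)
  hence "p \<noteq> 0" using False by auto
  from poly_infinity[OF this, of 1 c] obtain R where R: "\<And>z. R \<le> norm z \<Longrightarrow> 1 \<le> norm (poly a z)" using a by blast
  obtain n0 where n0: "real n0 \<ge> R + 1" using real_arch_simple by blast
  have "\<forall>\<^sub>F n in sequentially. \<forall>z\<in>cball (- of_nat n) 1. norm (poly a z) \<ge> 1"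
  proof (rule eventually_sequentiallyI[of n0], rule ballI, rule R)
    fix n and z :: complex assume n: "n \<ge> n0" and z: "z \<in> cball (- of_nat n) 1"
    have "norm (of_nat n :: complex) \<le> norm (z + of_nat n) + norm z"
      using norm_triangle_ineq4[of "z + of_nat n" z] by simp
    moreover have "norm (z + of_nat n) \<le> 1" using z by (simp add: dist_norm norm_minus_commute add.commute)
    ultimately have "real n \<le> 1 + norm z" by simp
    thus "R \<le> norm z" using n0 n by linarith
  qed
  thus ?thesis by (intro exI[of _ 1]) auto
qed

text \<open>Cauchy's bound for roots, kept free of division because the leading coefficient will
  depend on z.\<close>

lemma poly_root_bound:
  fixes f :: "complex poly"
  assumes d: "degree f > 0" and w: "poly f w = 0"
  shows "norm (lead_coeff f) * norm w \<le> norm (lead_coeff f) + (\<Sum>i<degree f. norm (coeff f i))"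
proof (cases "norm w \<le> 1")
  case True
  have "norm (lead_coeff f) * norm w \<le> norm (lead_coeff f) * 1" using True by (intro mult_left_mono) auto
  moreover have "(\<Sum>i<degree f. norm (coeff f i)) \<ge> 0" by (intro sum_nonneg) auto
  ultimately show ?thesis by linarith
next
  case False
  obtain e where e: "degree f = Suc e" using d by (cases "degree f") auto
  have "(\<Sum>i<degree f. coeff f i * w ^ i) + lead_coeff f * w ^ degree f = 0"
    using w by (simp add: poly_altdef lessThan_Suc_atMost[symmetric])
  hence "lead_coeff f * w ^ degree f = - (\<Sum>i<degree f. coeff f i * w ^ i)" by (simp add: add_eq_0_iff)
  hence "norm (lead_coeff f * w ^ degree f) = norm (\<Sum>i<degree f. coeff f i * w ^ i)" by simp
  also have "\<dots> \<le> (\<Sum>i<degree f. norm (coeff f i) * norm w ^ e)"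
    using False e by (intro sum_norm_le) (auto simp: norm_mult norm_power intro!: mult_left_mono power_increasing)
  also have "\<dots> = (\<Sum>i<degree f. norm (coeff f i)) * norm w ^ e" by (rule sum_distrib_right[symmetric])
  also have "norm (lead_coeff f * w ^ degree f) = (norm (lead_coeff f) * norm w) * norm w ^ e"
    by (simp add: norm_mult norm_power e)
  finally have "(norm (lead_coeff f) * norm w) * norm w ^ e \<le> (\<Sum>i<degree f. norm (coeff f i)) * norm w ^ e" .
  moreover have "norm w ^ e > 0" using False by (intro zero_less_power) linarith
  ultimately have "norm (lead_coeff f) * norm w \<le> (\<Sum>i<degree f. norm (coeff f i))"
    using mult_le_cancel_right_pos by blast
  thus ?thesis using norm_ge_zero[of "lead_coeff f"] by linarith
qed

lemma sum_growth:
  assumes "finite I" "\<And>i. i \<in> I \<Longrightarrow> \<exists>N. \<forall>\<^sub>F n in sequentially. \<forall>z\<in>cball (- of_nat n :: complex) 1. f i z \<le> real n ^ N"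
  shows "\<exists>N. \<forall>\<^sub>F n in sequentially. \<forall>z\<in>cball (- of_nat n) 1. (\<Sum>i\<in>I. f i z) \<le> real n ^ N"
  using assms
proof (induction I rule: finite_induct)
  case (insert j I)
  obtain N1 where N1: "\<forall>\<^sub>F n in sequentially. \<forall>z\<in>cball (- of_nat n :: complex) 1. f j z \<le> real n ^ N1"
    using insert.prems[of j] by blast
  obtain N2 where N2: "\<forall>\<^sub>F n in sequentially. \<forall>z\<in>cball (- of_nat n :: complex) 1. (\<Sum>i\<in>I. f i z) \<le> real n ^ N2"
    using insert.IH insert.prems by blast
  from N1 N2 eventually_ge_at_top[of 2]
  have "\<forall>\<^sub>F n in sequentially. \<forall>z\<in>cball (- of_nat n :: complex) 1. (\<Sum>i\<in>insert j I. f i z) \<le> real n ^ Suc (max N1 N2)"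
  proof eventually_elim
    case (elim n)
    thus ?case using insert.hyps power_max_bound[of n] by simp
  qed
  thus ?case by blast
qed auto

lemma algebraic_growth:
  fixes P :: "complex poly poly"
  assumes d: "degree P > 0"
  shows "\<exists>M. \<forall>\<^sub>F n in sequentially. \<forall>z\<in>cball (- of_nat n) 1. \<forall>w. poly2 P z w = 0 \<longrightarrow> norm w \<le> real n ^ M"
proof -
  have "lead_coeff P \<noteq> 0" using d by auto
  then obtain \<kappa> where \<kappa>: "\<kappa> > 0" "\<forall>\<^sub>F n in sequentially. \<forall>z\<in>cball (- of_nat n) 1. norm (poly (lead_coeff P) z) \<ge> \<kappa>"
    using poly_lower_bound by blast
  obtain N1 where N1: "\<forall>\<^sub>F n in sequentially. \<forall>z\<in>cball (- of_nat n) 1. norm (poly (lead_coeff P) z) \<le> real n ^ N1"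
    using poly_growth by blast
  obtain N2 where N2: "\<forall>\<^sub>F n in sequentially. \<forall>z\<in>cball (- of_nat n) 1. (\<Sum>i<degree P. norm (poly (coeff P i) z)) \<le> real n ^ N2"
    using sum_growth[of "{..<degree P}" "\<lambda>i z. norm (poly (coeff P i) z)"] poly_growth by blast
  have "\<forall>\<^sub>F n in sequentially. 1 / \<kappa> \<le> real n"
    using filterlim_real_sequentially unfolding filterlim_at_top by blast
  with \<kappa>(2) N1 N2 eventually_ge_at_top[of 2]
  have "\<forall>\<^sub>F n in sequentially. \<forall>z\<in>cball (- of_nat n) 1. \<forall>w. poly2 P z w = 0 \<longrightarrow> norm w \<le> real n ^ Suc (Suc (max N1 N2))"
  proof eventually_elim
    case (elim n)
    show ?case
    proof (intro ballI allI impI)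
      fix z w :: complex assume z: "z \<in> cball (- of_nat n) 1" and w: "poly2 P z w = 0"
      have k: "norm (poly (lead_coeff P) z) \<ge> \<kappa>" using elim z by blast
      hence lc: "poly (lead_coeff P) z \<noteq> 0" using \<kappa>(1) by auto
      have dz: "degree (poly_at_x z P) = degree P" by (rule degree_poly_at_x[OF lc])
      have "\<kappa> * norm w \<le> norm (poly (lead_coeff P) z) * norm w" using k by (intro mult_right_mono) auto
      also have "\<dots> \<le> norm (poly (lead_coeff P) z) + (\<Sum>i<degree P. norm (poly (coeff P i) z))"
        using poly_root_bound[of "poly_at_x z P" w] dz d w by simp
      also have "\<dots> \<le> real n ^ Suc (max N1 N2)" using elim z by (intro power_max_bound) auto
      finally have "norm w \<le> 1 / \<kappa> * real n ^ Suc (max N1 N2)" using \<kappa>(1) by (simp add: field_simps)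
      also have "\<dots> \<le> real n * real n ^ Suc (max N1 N2)" using elim by (intro mult_right_mono) auto
      finally show "norm w \<le> real n ^ Suc (Suc (max N1 N2))" by simp
    qed
  qed
  thus ?thesis by blast
qed

text \<open>On the curve P = 0 the identity reads B F = D. As |D| is bounded below near -n and
  \<open>B\<close> grows at most like a power of n, \<open>F\<close> is at least an inverse power of
  n.\<close>

lemma bezout_lower_bound:
  fixes P F A B :: "complex poly poly" and D :: "complex poly"
  assumes bez: "A * P + B * F = [:D:]" and D: "D \<noteq> 0"
  shows "\<exists>N. \<forall>\<^sub>F n in sequentially. \<forall>z\<in>cball (- of_nat n) 1. \<forall>w. norm w \<le> real n ^ M \<longrightarrow> poly2 P z w = 0 \<longrightarrow>
           1 \<le> norm (poly2 F z w) * real n ^ N"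
proof -
  obtain \<kappa> where \<kappa>: "\<kappa> > 0" "\<forall>\<^sub>F n in sequentially. \<forall>z\<in>cball (- of_nat n) 1. norm (poly D z) \<ge> \<kappa>"
    using poly_lower_bound[OF D] by blast
  obtain N where N: "\<forall>\<^sub>F n in sequentially. \<forall>z\<in>cball (- of_nat n) 1. \<forall>w. norm w \<le> real n ^ M \<longrightarrow> norm (poly2 B z w) \<le> real n ^ N"
    using poly2_growth by blast
  have "\<forall>\<^sub>F n in sequentially. 1 / \<kappa> \<le> real n"
    using filterlim_real_sequentially unfolding filterlim_at_top by blast
  with \<kappa>(2) N 
  have "\<forall>\<^sub>F n in sequentially. \<forall>z\<in>cball (- of_nat n) 1. \<forall>w. norm w \<le> real n ^ M \<longrightarrow> poly2 P z w = 0 \<longrightarrow>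
           1 \<le> norm (poly2 F z w) * real n ^ Suc N"
  proof eventually_elim
    case (elim n)
    show ?case
    proof (intro ballI allI impI)
      fix z w :: complex assume z: "z \<in> cball (- of_nat n) 1" and w: "norm w \<le> real n ^ M" "poly2 P z w = 0"
      have eq: "poly2 B z w * poly2 F z w = poly D z" using arg_cong[OF bez, of "\<lambda>t. poly2 t z w"] w by simp
      have "1 \<le> real n * \<kappa>" using elim \<kappa>(1) by (simp add: field_simps)
      also have "\<dots> \<le> real n * norm (poly D z)" using elim z by (intro mult_left_mono) auto
      also have "\<dots> = real n * (norm (poly2 B z w) * norm (poly2 F z w))" by (simp flip: eq add: norm_mult)
      also have "\<dots> \<le> real n * (real n ^ N * norm (poly2 F z w))"
        using elim z w by (intro mult_left_mono mult_right_mono) auto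
      finally show "1 \<le> norm (poly2 F z w) * real n ^ Suc N" by (simp add: mult_ac)
    qed
  qed
  thus ?thesis by blast
qed

section \<open>Algebraically related values of the Gamma function\<close>

lemma poly_poly_eq_poly2: "poly (poly P q) z = poly2 P z (poly q z)"
  by (induction P) auto

text \<open>The Bezout identities serve to bound \<open>\<phi>'\<close> from above and from below by powers of \<open>n\<close>.\<close>

locale gamma_branch =
  fixes P Q A1 B1 A2 B2 :: "complex poly poly" and D1 D2 :: "complex poly"
    and \<phi> :: "complex \<Rightarrow> complex" and r :: real
  assumes r: "0 < r" "r \<le> 1"
    and deg: "degree P > 0"
    and bez1: "A1 * P + B1 * pderiv P = [:D1:]" "D1 \<noteq> 0"
    and bez2: "A2 * P + B2 * pderiv_x P = [:D2:]" "D2 \<noteq> 0"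
    and Q: "Q \<noteq> 0" "\<And>b. poly Q [:b:] \<noteq> 0"
    and der: "\<forall>\<^sub>F n in sequentially. \<forall>z\<in>ball (- of_nat n) r.
       (\<phi> has_field_derivative (- poly2 (pderiv_x P) z (\<phi> z) / poly2 (pderiv P) z (\<phi> z))) (at z)"
    and zero: "\<forall>\<^sub>F n in sequentially. \<forall>z\<in>ball (- of_nat n) r. poly2 P z (\<phi> z) = 0"
    and rel: "\<forall>\<^sub>F n in sequentially. \<forall>z\<in>ball (- of_nat n) r. poly2 Q (rGamma z) (rGamma (\<phi> z)) = 0"
begin

definition d\<phi> :: "complex \<Rightarrow> complex" where
  "d\<phi> z = - poly2 (pderiv_x P) z (\<phi> z) / poly2 (pderiv P) z (\<phi> z)"

lemma derivative_bounds:
  "\<exists>M. \<forall>\<^sub>F n in sequentially. \<forall>z\<in>ball (- of_nat n) r.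
     norm (\<phi> z) \<le> real n ^ M \<and> norm (d\<phi> z) \<le> real n ^ M \<and> 1 \<le> norm (d\<phi> z) * real n ^ M"
proof -
  obtain M0 where M0: "\<forall>\<^sub>F n in sequentially. \<forall>z\<in>cball (- of_nat n) 1. \<forall>w. poly2 P z w = 0 \<longrightarrow> norm w \<le> real n ^ M0"
    using algebraic_growth[OF deg] by blast
  obtain N1 where N1: "\<forall>\<^sub>F n in sequentially. \<forall>z\<in>cball (- of_nat n) 1. \<forall>w. norm w \<le> real n ^ M0 \<longrightarrow> poly2 P z w = 0 \<longrightarrow>
           1 \<le> norm (poly2 (pderiv P) z w) * real n ^ N1"
    using bezout_lower_bound[OF bez1] by blast
  obtain N2 where N2: "\<forall>\<^sub>F n in sequentially. \<forall>z\<in>cball (- of_nat n) 1. \<forall>w. norm w \<le> real n ^ M0 \<longrightarrow> poly2 P z w = 0 \<longrightarrow>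
           1 \<le> norm (poly2 (pderiv_x P) z w) * real n ^ N2"
    using bezout_lower_bound[OF bez2] by blast
  obtain N3 where N3: "\<forall>\<^sub>F n in sequentially. \<forall>z\<in>cball (- of_nat n) 1. \<forall>w. norm w \<le> real n ^ M0 \<longrightarrow> norm (poly2 (pderiv P) z w) \<le> real n ^ N3"
    using poly2_growth by blast
  obtain N4 where N4: "\<forall>\<^sub>F n in sequentially. \<forall>z\<in>cball (- of_nat n) 1. \<forall>w. norm w \<le> real n ^ M0 \<longrightarrow> norm (poly2 (pderiv_x P) z w) \<le> real n ^ N4"
    using poly2_growth by blast
  define M where "M = M0 + (N1 + N4) + (N2 + N3)"
  from M0 N1 N2 N3 N4 zero eventually_ge_at_top[of 1]
  have "\<forall>\<^sub>F n in sequentially. \<forall>z\<in>ball (- of_nat n) r.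
     norm (\<phi> z) \<le> real n ^ M \<and> norm (d\<phi> z) \<le> real n ^ M \<and> 1 \<le> norm (d\<phi> z) * real n ^ M"
  proof eventually_elim
    case (elim n)
    show ?case
    proof
      fix z :: complex assume z: "z \<in> ball (- of_nat n) r"
      hence z1: "z \<in> cball (- of_nat n) 1" using r by auto
      have P0: "poly2 P z (\<phi> z) = 0" using elim z by blast
      hence w: "norm (\<phi> z) \<le> real n ^ M0" using elim z1 by blast
      define u v where "u = norm (poly2 (pderiv P) z (\<phi> z))" and "v = norm (poly2 (pderiv_x P) z (\<phi> z))"
      have u: "1 \<le> u * real n ^ N1" "u \<le> real n ^ N3" and v: "1 \<le> v * real n ^ N2" "v \<le> real n ^ N4"
        using elim z1 w P0 by (auto simp: u_def v_def)
      have u0: "u > 0" and v0: "v \<ge> 0" using u by (auto simp: u_def v_def)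
      have d: "norm (d\<phi> z) = v / u" by (simp add: d\<phi>_def u_def v_def norm_divide)
      have mono: "real n ^ a \<le> real n ^ M" if "a \<le> M" for a using that elim by (intro power_increasing) auto
      have "v / u \<le> real n ^ (N1 + N4)"
      proof -
        have "v * 1 \<le> real n ^ N4 * (u * real n ^ N1)" using u v v0 by (intro mult_mono) auto
        thus ?thesis using u0 by (simp add: divide_le_eq power_add mult_ac)
      qed
      moreover have "1 \<le> v / u * real n ^ (N2 + N3)"
      proof -
        have "u * 1 \<le> real n ^ N3 * (v * real n ^ N2)" using u v u0 by (intro mult_mono) auto
        thus ?thesis using u0 by (simp add: le_divide_eq power_add mult_ac)
      qed
      moreover have "v / u * real n ^ (N2 + N3) \<le> v / u * real n ^ M"
        using u0 v0 by (intro mult_left_mono mono) (auto simp: M_def)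
      ultimately show "norm (\<phi> z) \<le> real n ^ M \<and> norm (d\<phi> z) \<le> real n ^ M \<and> 1 \<le> norm (d\<phi> z) * real n ^ M"
        using w mono[of M0] mono[of "N1 + N4"] unfolding d by (auto simp: M_def)
    qed
  qed
  thus ?thesis by blast
qed

text \<open>The upper bound is the mean value inequality. For the lower one, Cauchy's estimate
  bounds \<phi>'' polynomially, so over distances of inverse polynomial size \<phi> differs from its
  linearization by at most half of the linear term.\<close>

lemma difference_bounds:
  "\<exists>M. \<forall>\<^sub>F n in sequentially. \<forall>z1\<in>cball (- of_nat n) (r/4). \<forall>z2\<in>cball (- of_nat n) (r/4).
     norm (\<phi> z1) \<le> real n ^ M \<and> norm (\<phi> z1 - \<phi> z2) \<le> real n ^ M * norm (z1 - z2) \<and>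
     (real n ^ M * norm (z1 - z2) \<le> 1 \<longrightarrow> norm (z1 - z2) \<le> real n ^ M * norm (\<phi> z1 - \<phi> z2))"
proof -
  obtain M where M: "\<forall>\<^sub>F n in sequentially. \<forall>z\<in>ball (- of_nat n) r.
     norm (\<phi> z) \<le> real n ^ M \<and> norm (d\<phi> z) \<le> real n ^ M \<and> 1 \<le> norm (d\<phi> z) * real n ^ M"
    using derivative_bounds by blast
  have "\<forall>\<^sub>F n in sequentially. 4 / r \<le> real n"
    using filterlim_real_sequentially unfolding filterlim_at_top by blast
  \<comment> \<open>In the exponent 2 M + 1, one n^M comes from the lower bound for \<phi>' and one
    from the bound for \<phi>''; the extra n absorbs 4 / r.\<close>
  with M der eventually_ge_at_top[of 2]
  have "\<forall>\<^sub>F n in sequentially. \<forall>z1\<in>cball (- of_nat n) (r/4). \<forall>z2\<in>cball (- of_nat n) (r/4).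
     norm (\<phi> z1) \<le> real n ^ (2*M+1) \<and> norm (\<phi> z1 - \<phi> z2) \<le> real n ^ (2*M+1) * norm (z1 - z2) \<and>
     (real n ^ (2*M+1) * norm (z1 - z2) \<le> 1 \<longrightarrow> norm (z1 - z2) \<le> real n ^ (2*M+1) * norm (\<phi> z1 - \<phi> z2))"
  proof eventually_elim
    case (elim n)
    let ?S = "ball (- of_nat n :: complex) r" and ?T = "cball (- of_nat n :: complex) (r/4)"
    have TS: "?T \<subseteq> ?S" using r by auto
    have d: "(\<phi> has_field_derivative d\<phi> z) (at z)" if "z \<in> ?S" for z
      using elim that unfolding d\<phi>_def by blast
    hence hol: "\<phi> holomorphic_on ?S"
      unfolding holomorphic_on_def using field_differentiable_at_within field_differentiable_def by blast
    have dd: "deriv \<phi> z = d\<phi> z" if "z \<in> ?S" for z using DERIV_imp_deriv[OF d[OF that]] .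
    have hol': "deriv \<phi> holomorphic_on ?S" using hol by (intro holomorphic_deriv) auto
    define x where "x = real n ^ M"
    have x1: "x \<ge> 1" unfolding x_def using elim by (intro one_le_power) auto
    have dbound: "norm (deriv \<phi> z) \<le> x" if "z \<in> ?S" for z using elim that dd by (simp add: x_def)
    have d2: "norm (deriv (deriv \<phi>) z) \<le> 2 * x / r" if z: "z \<in> ?T" for z
    proof -
      \<comment> \<open>As r/4 + r/2 stays below r, Cauchy's estimate has room.\<close>
      have sub: "cball z (r/2) \<subseteq> ?S"
      proof
        fix y assume "y \<in> cball z (r/2)"
        hence "dist (- of_nat n) y \<le> r/4 + r/2" using z dist_triangle[of "- of_nat n" y z] by auto
        thus "y \<in> ?S" using r by auto
      qed
      have "norm ((deriv ^^ 1) (deriv \<phi>) z) \<le> fact 1 * x / (r/2) ^ 1"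
      proof (rule Cauchy_inequality)
        show "deriv \<phi> holomorphic_on ball z (r/2)" using hol' sub ball_subset_cball holomorphic_on_subset by blast
        show "continuous_on (cball z (r/2)) (deriv \<phi>)"
          using hol' sub holomorphic_on_imp_continuous_on holomorphic_on_subset by blast
        show "norm (deriv \<phi> y) \<le> x" if "norm (z - y) = r/2" for y
          using that sub by (intro dbound) (auto simp: dist_norm)
      qed (use r in auto)
      thus ?thesis using r by (simp add: field_simps)
    qed
    have lip1: "norm (\<phi> z1 - \<phi> z2) \<le> x * norm (z1 - z2)" if "z1 \<in> ?T" "z2 \<in> ?T" for z1 z2
    proof (rule field_differentiable_bound[OF convex_cball _ _ that])
      show "(\<phi> has_field_derivative d\<phi> z) (at z within ?T)" if "z \<in> ?T" for z
        using has_field_derivative_at_within[OF d] TS that by blast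
      show "norm (d\<phi> z) \<le> x" if "z \<in> ?T" for z using dbound[of z] dd[of z] TS that by auto
    qed
    have lip2: "norm (d\<phi> z1 - d\<phi> z2) \<le> 2 * x / r * norm (z1 - z2)" if "z1 \<in> ?T" "z2 \<in> ?T" for z1 z2
    proof -
      have "norm (deriv \<phi> z1 - deriv \<phi> z2) \<le> 2 * x / r * norm (z1 - z2)"
      proof (rule field_differentiable_bound[OF convex_cball _ d2 that])
        show "(deriv \<phi> has_field_derivative deriv (deriv \<phi>) z) (at z within ?T)" if "z \<in> ?T" for z
          using holomorphic_derivI[OF hol' open_ball] TS that has_field_derivative_at_within by blast
      qed
      thus ?thesis unfolding dd[OF subsetD[OF TS that(1)]] dd[OF subsetD[OF TS that(2)]] .
    qed
    show ?case
    proof (intro ballI conjI impI)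
      fix z1 z2 assume z: "z1 \<in> ?T" "z2 \<in> ?T"
      have xM: "x \<le> real n ^ (2*M+1)" unfolding x_def using elim by (intro power_increasing) auto
      show "norm (\<phi> z1) \<le> real n ^ (2*M+1)" using elim z TS xM by (force simp: x_def)
      show "norm (\<phi> z1 - \<phi> z2) \<le> real n ^ (2*M+1) * norm (z1 - z2)"
        using lip1[OF z] xM mult_right_mono[OF xM norm_ge_zero] order_trans by blast
      assume small: "real n ^ (2*M+1) * norm (z1 - z2) \<le> 1"
      define t where "t = norm (z1 - z2)"
      let ?D = "norm (\<phi> z1 - \<phi> z2)"
      have t0: "t \<ge> 0" by (simp add: t_def)
      \<comment> \<open>Mean value inequality for \<phi> minus its linear part at \<open>z1\<close>,
        whose derivative is small along the segment.\<close>
      have "norm ((\<phi> z1 - d\<phi> z1 * z1) - (\<phi> z2 - d\<phi> z1 * z2)) \<le> (2 * x / r * t) * norm (z1 - z2)"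
      proof (rule field_differentiable_bound[OF convex_closed_segment])
        fix y assume y: "y \<in> closed_segment z1 z2"
        have yT: "y \<in> ?T" using y z convex_cball closed_segment_subset by blast
        show "((\<lambda>z. \<phi> z - d\<phi> z1 * z) has_field_derivative (d\<phi> y - d\<phi> z1)) (at y within closed_segment z1 z2)"
          by (rule has_field_derivative_at_within) (use d[OF subsetD[OF TS yT]] in \<open>auto intro!: derivative_eq_intros\<close>)
        have "norm (d\<phi> y - d\<phi> z1) \<le> 2 * x / r * norm (y - z1)" by (rule lip2[OF yT z(1)])
        also have "\<dots> \<le> 2 * x / r * t"
          using segment_bound1[OF y] x1 r by (intro mult_left_mono) (auto simp: t_def norm_minus_commute)
        finally show "norm (d\<phi> y - d\<phi> z1) \<le> 2 * x / r * t" .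
      qed auto
      moreover have "(\<phi> z1 - d\<phi> z1 * z1) - (\<phi> z2 - d\<phi> z1 * z2) = (\<phi> z1 - \<phi> z2) - d\<phi> z1 * (z1 - z2)"
        by (simp add: algebra_simps)
      ultimately have "norm ((\<phi> z1 - \<phi> z2) - d\<phi> z1 * (z1 - z2)) \<le> (2 * x / r * t) * t" by (simp add: t_def)
      hence low: "norm (d\<phi> z1) * t \<le> ?D + (2 * x / r * t) * t"
        using norm_triangle_ineq2[of "d\<phi> z1 * (z1 - z2)" "\<phi> z1 - \<phi> z2"]
        by (simp add: norm_mult t_def norm_minus_commute)
      have "1 \<le> norm (d\<phi> z1) * x" using elim z TS unfolding x_def by blast
      hence "1 * t \<le> (norm (d\<phi> z1) * x) * t" using t0 by (intro mult_right_mono) auto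
      also have "\<dots> = x * (norm (d\<phi> z1) * t)" by simp
      also have "\<dots> \<le> x * (?D + (2 * x / r * t) * t)" using low x1 by (intro mult_left_mono) auto
      also have "\<dots> = x * ?D + (2 / r * (x * x * t)) * t" by (simp add: algebra_simps)
      also have "\<dots> \<le> x * ?D + 1/2 * t"
      proof -
        have "4 / r * (x * x * t) \<le> real n * (x * x * t)" using elim t0 x1 by (intro mult_right_mono) auto
        also have "\<dots> = real n ^ (2*M+1) * t" by (simp add: x_def power_add mult_2)
        also have "\<dots> \<le> 1" using small by (simp add: t_def)
        finally have "2 / r * (x * x * t) \<le> 1/2" by simp
        thus ?thesis using t0 by (intro add_left_mono mult_right_mono)
      qed
      finally have "t \<le> 2 * x * ?D" by simp
      also have "\<dots> \<le> real n ^ (2*M+1) * ?D"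
      proof (intro mult_right_mono)
        have "2 * x \<le> real n * x" using elim x1 by (intro mult_right_mono) auto
        also have "\<dots> \<le> real n * (x * x)" using x1 elim by (intro mult_left_mono) (auto simp: mult_le_cancel_left1)
        also have "\<dots> = real n ^ (2*M+1)" by (simp add: x_def power_add mult_2)
        finally show "2 * x \<le> real n ^ (2*M+1)" .
      qed auto
      finally show "norm (z1 - z2) \<le> real n ^ (2*M+1) * norm (\<phi> z1 - \<phi> z2)" by (simp add: t_def)
    qed
  qed
  thus ?thesis by blast
qed

text \<open>For all but finitely many real c, Q(c, .) is a nonzero polynomial. Each of the finitely
  many roots b of Q(c1, .) is a root of Q(c, .) for only finitely many c, since Q(., b) is never
  identically zero; so \<open>c2\<close> can be chosen to make the root sets disjoint.\<close>

lemma test_values: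
  "\<exists>(c1::real) (c2::real) R1 R2 C \<kappa>. c1 \<noteq> c2 \<and> 0 < C \<and> 0 < \<kappa> \<and>
     (\<forall>b. poly2 Q (of_real c1) b = 0 \<longrightarrow> b \<in> R1) \<and> (\<forall>b. poly2 Q (of_real c2) b = 0 \<longrightarrow> b \<in> R2) \<and>
     (\<forall>b\<in>R1 \<union> R2. norm b \<le> C) \<and> (\<forall>b1\<in>R1. \<forall>b2\<in>R2. \<kappa> \<le> norm (b1 - b2))"
proof -
  have fin: "finite {c::real. of_real c \<in> X}" if "finite X" for X :: "complex set"
    using finite_vimageI[OF that, of of_real] by (simp add: vimage_def inj_def)
  have bad: "finite {c. poly_at_x c Q = 0}" by (rule poly_at_x_eq_0_finite[OF Q(1)])
  obtain c1 :: real where c1: "poly_at_x (of_real c1) Q \<noteq> 0"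
    using ex_new_if_finite[OF infinite_UNIV_char_0 fin[OF bad]] by auto
  define R1 where "R1 = {b. poly2 Q (of_real c1) b = 0}"
  have R1: "finite R1" using poly_roots_finite[OF c1] by (simp add: R1_def)
  have "finite {c. poly2 Q c b = 0}" for b using poly_roots_finite[OF Q(2)[of b]] by (simp add: poly2_def)
  hence "finite ({c. poly_at_x c Q = 0} \<union> {of_real c1} \<union> (\<Union>b\<in>R1. {c. poly2 Q c b = 0}))" using R1 bad by auto
  from ex_new_if_finite[OF infinite_UNIV_char_0 fin[OF this]]
  obtain c2 :: real where c2: "poly_at_x (of_real c2) Q \<noteq> 0" "c2 \<noteq> c1" "\<And>b. b \<in> R1 \<Longrightarrow> poly2 Q (of_real c2) b \<noteq> 0"
    by auto
  define R2 where "R2 = {b. poly2 Q (of_real c2) b = 0}"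
  have R2: "finite R2" using poly_roots_finite[OF c2(1)] by (simp add: R2_def)
  have "R1 \<inter> R2 = {}" using c2 by (auto simp: R2_def)
  then obtain \<kappa> where \<kappa>: "\<kappa> > 0" "\<And>b1 b2. b1 \<in> R1 \<Longrightarrow> b2 \<in> R2 \<Longrightarrow> \<kappa> \<le> dist b1 b2"
    using separate_compact_closed[of R1 R2] R1 R2 finite_imp_compact finite_imp_closed by metis
  have "bounded (R1 \<union> R2)" using R1 R2 finite_imp_bounded by blast
  then obtain C where C: "C > 0" "\<And>b. b \<in> R1 \<union> R2 \<Longrightarrow> norm b \<le> C" unfolding bounded_pos by blast
  show ?thesis
  proof (intro exI conjI)
    show "c1 \<noteq> c2" "0 < C" "0 < \<kappa>" using c2 C \<kappa> by auto
    show "\<forall>b. poly2 Q (of_real c1) b = 0 \<longrightarrow> b \<in> R1" by (simp add: R1_def)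
    show "\<forall>b. poly2 Q (of_real c2) b = 0 \<longrightarrow> b \<in> R2" by (simp add: R2_def)
    show "\<forall>b\<in>R1 \<union> R2. norm b \<le> C" using C(2) by blast
    show "\<forall>b1\<in>R1. \<forall>b2\<in>R2. \<kappa> \<le> norm (b1 - b2)" using \<kappa>(2) by (simp add: dist_norm)
  qed
qed

text \<open>The points \<open>z\<^sub>1\<close>, \<open>z\<^sub>2\<close> with \<open>1/\<Gamma> = c\<^sub>1, c\<^sub>2\<close> near \<open>-n\<close> have distance about \<open>1/n!\<close>, but the values of
  \<open>1/\<Gamma>\<close> at their images \<open>w\<^sub>1\<close>, \<open>w\<^sub>2\<close> lie in two disjoint finite sets. Since the logarithmic derivative of
  \<open>1/\<Gamma>\<close> is polynomially bounded away from the poles of \<open>\<Gamma>\<close>, the images must be close to some \<open>-m\<close>, where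
  \<open>1/\<Gamma>\<close> has slope about \<open>m!\<close>. Comparing slopes, \<open>m!/n!\<close> is polynomially bounded in both directions.\<close>

lemma near_integer_points:
  "\<exists>K M. K > 0 \<and> (\<forall>\<^sub>F n in sequentially. \<exists>z w m. poly2 P z w = 0 \<and> norm (z + of_nat n) \<le> K / fact n \<and>
      norm (w + of_nat m) \<le> K * real n ^ M / fact n \<and> m \<le> n + M \<and> n \<le> m + M)"
proof -
  from test_values obtain c1 c2 :: real and R1 R2 C \<kappa> where c: "c1 \<noteq> c2" and C0: "0 < C" and \<kappa>0: "0 < \<kappa>"
    and R1: "\<forall>b. poly2 Q (of_real c1) b = 0 \<longrightarrow> b \<in> R1" and R2: "\<forall>b. poly2 Q (of_real c2) b = 0 \<longrightarrow> b \<in> R2"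
    and RC: "\<forall>b\<in>R1 \<union> R2. norm b \<le> C" and R\<kappa>: "\<forall>b1\<in>R1. \<forall>b2\<in>R2. \<kappa> \<le> norm (b1 - b2)"
    by (elim exE conjE) (rule that)
  obtain M where M: "\<forall>\<^sub>F n in sequentially. \<forall>z1\<in>cball (- of_nat n) (r/4). \<forall>z2\<in>cball (- of_nat n) (r/4).
     norm (\<phi> z1) \<le> real n ^ M \<and> norm (\<phi> z1 - \<phi> z2) \<le> real n ^ M * norm (z1 - z2) \<and>
     (real n ^ M * norm (z1 - z2) \<le> 1 \<longrightarrow> norm (z1 - z2) \<le> real n ^ M * norm (\<phi> z1 - \<phi> z2))"
    using difference_bounds by blast
  define X where "X = \<bar>c1\<bar> + \<bar>c2\<bar> + 1"
  have X: "X \<ge> 1" "\<bar>c1\<bar> \<le> X" "\<bar>c2\<bar> \<le> X" "\<bar>c1\<bar> + \<bar>c2\<bar> \<le> X" by (auto simp: X_def)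
  define k0 where "k0 = \<bar>c1 - c2\<bar> / 2"
  have k0: "k0 > 0" using c by (simp add: k0_def)
  \<comment> \<open>The three bounds serve, in this order, to solve the estimate near -m for m!
    |\<eta>|, to keep the two points near -n apart, and to keep the slope error near -m at most
    \<kappa> / 2.\<close>
  define \<epsilon> where "\<epsilon> = min (1/2) (min (\<bar>c1 - c2\<bar> / (4 * X)) (\<kappa> / (8 * C)))"
  have \<epsilon>: "\<epsilon> > 0" "\<epsilon> \<le> 1/2" "\<epsilon> * (4 * X) \<le> \<bar>c1 - c2\<bar>" "\<epsilon> * (8 * C) \<le> \<kappa>"
  proof -
    have "\<epsilon> \<le> \<bar>c1 - c2\<bar> / (4 * X)" "\<epsilon> \<le> \<kappa> / (8 * C)" by (simp_all add: \<epsilon>_def)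
    thus "\<epsilon> * (4 * X) \<le> \<bar>c1 - c2\<bar>" "\<epsilon> * (8 * C) \<le> \<kappa>" using X C0 by (simp_all add: le_divide_eq)
  qed (use c C0 \<kappa>0 X in \<open>auto simp: \<epsilon>_def\<close>)
  from rGamma_near_pole[OF \<epsilon>(1)] obtain \<delta> where \<delta>0: "\<delta> > 0" and
    "\<forall>m (\<eta>::complex). norm \<eta> * real (Suc m) \<le> \<delta> \<longrightarrow>
       norm (rGamma (\<eta> - of_nat m) - (-1) ^ m * fact m * \<eta>) \<le> \<epsilon> * (fact m * norm \<eta>)"
    by (elim exE conjE) (rule that)
  note \<delta> = this(1) this(2)[rule_format]
  from Digamma_bound obtain C\<psi> where "C\<psi> > 0" and "\<forall>(z::complex) \<delta>. 0 < \<delta> \<longrightarrow> \<delta> \<le> 1 \<longrightarrow> (\<forall>k::nat. norm (z + of_nat k) \<ge> \<delta>) \<longrightarrow>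
      norm (Digamma z) \<le> C\<psi> * (2 + norm z) ^ 2 / \<delta>" by (elim exE conjE) (rule that)
  note C\<psi> = this(1) this(2)[rule_format]
  define K0 where "K0 = 2 * X"
  \<comment> \<open>The first summand bounds m!/n!, the second n!/m!, each up to a factor
    n^M.\<close>
  define K1 where "K1 = 4 * C / k0 + 4 * K0 / \<kappa>"
  have K1: "4 * C / k0 \<le> K1" "4 * K0 / \<kappa> \<le> K1" "K1 > 0" using C0 k0 \<kappa>0 X by (auto simp: K1_def K0_def add_pos_pos)
  define K where "K = K0 + 2 * C * K1"
  have Kpos: "K > 0" "K0 \<le> K" "2 * C * K1 \<le> K" using K1 C0 X by (auto simp: K_def K0_def add_pos_pos)
  \<comment> \<open>One power more than in the bound n^M for \<phi>: for m of order n^M and |\<eta>|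
    at most 2 / n^(M+1), the product |\<eta>| (m + 1) is of order 1/n, as
    \<open>rGamma_near_pole\<close> requires.\<close>
  let ?L = "M + 1"
  have ev1: "\<forall>\<^sub>F n in sequentially. K0 * real n ^ 0 / fact n < r / 4"
    by (rule eventually_power_over_fact_less) (use r in auto)
  have ev2: "\<forall>\<^sub>F n in sequentially. (2 * K0) * real n ^ 1 / fact n < \<delta>"
    by (rule eventually_power_over_fact_less) (use \<delta> in auto)
  have ev3: "\<forall>\<^sub>F n in sequentially. K0 * real n ^ (M + ?L) / fact n < 1/2"
    by (rule eventually_power_over_fact_less) auto
  have ev4: "\<forall>\<^sub>F n in sequentially. (32 * C\<psi> * K0) * real n ^ (2 * M + ?L + M) / fact n < min (1/2) (\<kappa> / (4 * C))"
    by (rule eventually_power_over_fact_less) (use \<kappa>0 C0 in auto)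
  have ev5: "\<forall>\<^sub>F n in sequentially. 8 / \<delta> \<le> real n"
    using filterlim_real_sequentially unfolding filterlim_at_top by blast
  note ev6 = fact_le_upper[of K1 M] and ev7 = fact_le_lower[OF K1(3), of M]
  have "\<forall>\<^sub>F n in sequentially. \<exists>z w m. poly2 P z w = 0 \<and> norm (z + of_nat n) \<le> K / fact n \<and>
      norm (w + of_nat m) \<le> K * real n ^ M / fact n \<and> m \<le> n + M \<and> n \<le> m + M"
    using rGamma_real_solution[of c1] rGamma_real_solution[of c2] M zero rel ev1 ev2 ev3 ev4 ev5 ev6 ev7 eventually_ge_at_top[of 2]
  proof eventually_elim
    case (elim n)
    define x where "x = real n ^ M"
    have x1: "x \<ge> 1" unfolding x_def using elim by (intro one_le_power) auto
    have n1: "real n \<ge> 2" using elim by simp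
    obtain s1 :: real where s1: "\<bar>s1\<bar> \<le> 2 * \<bar>c1\<bar> / fact n" "rGamma (of_real s1 - of_nat n) = complex_of_real c1" using elim(1) by blast
    obtain s2 :: real where s2: "\<bar>s2\<bar> \<le> 2 * \<bar>c2\<bar> / fact n" "rGamma (of_real s2 - of_nat n) = complex_of_real c2" using elim(2) by blast
    define z1 z2 :: complex where "z1 = of_real s1 - of_nat n" and "z2 = of_real s2 - of_nat n"
    have K0n: "2 * \<bar>c1\<bar> / fact n \<le> K0 / fact n" "2 * \<bar>c2\<bar> / fact n \<le> K0 / fact n"
      using X by (auto simp: K0_def divide_right_mono)
    have sK: "\<bar>s1\<bar> \<le> K0 / fact n" "\<bar>s2\<bar> \<le> K0 / fact n" using s1 s2 K0n by linarith+
    have zT: "z1 \<in> cball (- of_nat n) (r/4)" "z2 \<in> cball (- of_nat n) (r/4)"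
    proof -
      have "\<bar>s1\<bar> \<le> r / 4" "\<bar>s2\<bar> \<le> r / 4" using sK elim(6) unfolding power_0 mult_1_right by linarith+
      thus "z1 \<in> cball (- of_nat n) (r/4)" "z2 \<in> cball (- of_nat n) (r/4)" by (auto simp: z1_def z2_def dist_norm)
    qed
    hence zS: "z1 \<in> ball (- of_nat n) r" "z2 \<in> ball (- of_nat n) r" using r by auto
    define w1 w2 where "w1 = \<phi> z1" and "w2 = \<phi> z2"
    define b1 b2 where "b1 = rGamma w1" and "b2 = rGamma w2"
    have "poly2 Q (of_real c1) b1 = 0" "poly2 Q (of_real c2) b2 = 0"
      using bspec[OF elim(5) zS(1)] bspec[OF elim(5) zS(2)] s1(2) s2(2)
      unfolding b1_def b2_def w1_def w2_def z1_def z2_def by simp_all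
    hence b: "b1 \<in> R1" "b2 \<in> R2" using R1 R2 by blast+
    have bC: "norm b1 \<le> C" "norm b2 \<le> C" and b\<kappa>: "\<kappa> \<le> norm (b1 - b2)" using b RC R\<kappa> by auto
    define t where "t = norm (z1 - z2)"
    define D where "D = norm (w1 - w2)"
    have t: "t = \<bar>s1 - s2\<bar>" unfolding t_def z1_def z2_def by (simp flip: of_real_diff)
    have S: "norm (complex_of_real s) * real (Suc n) \<le> \<delta>" if "\<bar>s\<bar> \<le> K0 / fact n" for s
    proof -
      have "\<bar>s\<bar> * real (Suc n) \<le> K0 / fact n * (2 * real n)"
        using that n1 X by (intro mult_mono) (auto simp: K0_def)
      also have "\<dots> = (2 * K0) * real n ^ 1 / fact n" by simp
      finally show ?thesis using elim(7) unfolding norm_of_real by linarith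
    qed
    have approx: "\<bar>c - (-1) ^ n * fact n * s\<bar> \<le> \<epsilon> * (2 * \<bar>c\<bar>)"
      if "rGamma (of_real s - of_nat n) = complex_of_real c" "\<bar>s\<bar> \<le> K0 / fact n" "\<bar>s\<bar> \<le> 2 * \<bar>c\<bar> / fact n" for s c
    proof -
      have "norm (complex_of_real c - (-1) ^ n * fact n * of_real s) \<le> \<epsilon> * (fact n * norm (complex_of_real s))"
        using \<delta>(2)[OF S[OF that(2)]] that(1) by simp
      also have "complex_of_real c - (-1) ^ n * fact n * of_real s = of_real (c - (-1) ^ n * fact n * s)" by simp
      finally have "\<bar>c - (-1) ^ n * fact n * s\<bar> \<le> \<epsilon> * (fact n * \<bar>s\<bar>)" unfolding norm_of_real .
      also have "\<dots> \<le> \<epsilon> * (2 * \<bar>c\<bar>)" using that(3) \<epsilon>(1) by (intro mult_left_mono) (auto simp: field_simps)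
      finally show ?thesis .
    qed
    \<comment> \<open>By \<open>approx\<close>, n! t is at least |c1 - c2| minus an error, which the
      choice of \<epsilon> makes at most half of |c1 - c2|.\<close>
    have "k0 \<le> fact n * t"
    proof -
      have "\<bar>c1 - c2\<bar> \<le> \<bar>(-1) ^ n * fact n * s1 - (-1) ^ n * fact n * s2\<bar> + (\<epsilon> * (2 * \<bar>c1\<bar>) + \<epsilon> * (2 * \<bar>c2\<bar>))"
        using approx[OF s1(2) sK(1) s1(1)] approx[OF s2(2) sK(2) s2(1)] by linarith
      also have "(-1) ^ n * fact n * s1 - (-1) ^ n * fact n * s2 = (-1) ^ n * (fact n * (s1 - s2))" by (simp add: algebra_simps)
      also have "\<bar>\<dots>\<bar> = fact n * t" by (simp add: abs_mult t)
      also have "\<epsilon> * (2 * \<bar>c1\<bar>) + \<epsilon> * (2 * \<bar>c2\<bar>) = 2 * (\<epsilon> * (\<bar>c1\<bar> + \<bar>c2\<bar>))" by (simp add: algebra_simps)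
      also have "\<dots> \<le> 2 * (\<epsilon> * X)" using X \<epsilon>(1) by (intro mult_left_mono) auto
      finally show ?thesis using \<epsilon>(3) by (simp add: k0_def)
    qed
    have tU: "t \<le> K0 / fact n"
    proof -
      have "t \<le> \<bar>s1\<bar> + \<bar>s2\<bar>" unfolding t by linarith
      also have "\<dots> \<le> 2 * \<bar>c1\<bar> / fact n + 2 * \<bar>c2\<bar> / fact n" using s1(1) s2(1) by linarith
      also have "\<dots> = 2 * (\<bar>c1\<bar> + \<bar>c2\<bar>) / fact n" by (simp add: add_divide_distrib)
      also have "\<dots> \<le> K0 / fact n" using X by (intro divide_right_mono) (auto simp: K0_def)
      finally show ?thesis .
    qed
    define y where "y = real n ^ ?L"
    have y: "y = real n * x" by (simp add: y_def x_def)
    have y1: "y \<ge> 2" using mult_mono[of 2 "real n" 1 x] n1 x1 by (simp add: y)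
    have xy: "x * t * y < 1/2"
    proof -
      have "x * t * y \<le> x * (K0 / fact n) * y" using tU x1 y1 by (intro mult_right_mono mult_left_mono) auto
      also have "\<dots> = K0 * real n ^ (M + ?L) / fact n" unfolding x_def y_def by (simp only: power_add) simp
      finally show ?thesis using elim(8) by linarith
    qed
    have t0: "t \<ge> 0" and D0: "D \<ge> 0" by (simp_all add: t_def D_def)
    have "x * t * 1 \<le> x * t * y" using y1 x1 t0 by (intro mult_left_mono) auto
    hence xt: "x * t \<le> 1" using xy by linarith
    have Dxt: "D \<le> x * t" and txD: "t \<le> x * D" and w1x: "norm w1 \<le> x"
      using elim(3) zT xt unfolding D_def t_def w1_def w2_def x_def by blast+
    have Dy: "D * y < 1/2" using xy mult_right_mono[OF Dxt, of y] y1 by linarith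
    have Dy2: "D \<le> 1 / (2 * y)" using Dy y1 by (simp add: field_simps)
    have "1 / (2 * y) \<le> 1" using y1 by simp
    hence D1: "D \<le> 1" using Dy2 by linarith
    \<comment> \<open>If \<open>w1\<close> stayed away from all -k, the logarithmic derivative would
      be polynomially bounded on the segment, whose length is of order at most n^M / n!, and
      \<open>b1\<close>, \<open>b2\<close> could not differ by \<kappa>.\<close>
    have "\<exists>m::nat. norm (w1 + of_nat m) < 1 / y"
    proof (rule ccontr)
      assume "\<not> ?thesis"
      hence far: "norm (w1 + of_nat k) \<ge> 1 / y" for k :: nat by (simp add: not_less)
      \<comment> \<open>The value of the \<open>Digamma\<close> bound when 2 + |w| is at most 4 n^M
        and the distance to the points -k is at least 1 / (2 y).\<close>
      define A where "A = 32 * C\<psi> * x ^ 2 * y"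
      have seg: "w \<notin> \<int>\<^sub>\<le>\<^sub>0 \<and> norm (Digamma w) \<le> A" if w: "w \<in> closed_segment w1 w2" for w
      proof -
        have ww: "norm (w - w1) \<le> D" using segment_bound1[OF w] by (simp add: D_def norm_minus_commute)
        have fk: "norm (w + of_nat k) \<ge> 1 / (2 * y)" for k :: nat
        proof -
          have "norm (w1 + of_nat k) \<le> norm (w + of_nat k) + norm (w - w1)"
            using norm_triangle_ineq4[of "w + of_nat k" "w - w1"] by (simp add: algebra_simps)
          hence "1 / y \<le> norm (w + of_nat k) + 1 / (2 * y)" using far[of k] ww Dy2 by linarith
          moreover have "1 / y = 1 / (2 * y) + 1 / (2 * y)" using y1 by simp
          ultimately show ?thesis by linarith
        qed
        have pos: "0 < 1 / (2 * y)" "1 / (2 * y) \<le> 1" using y1 by auto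
        have "w \<notin> \<int>\<^sub>\<le>\<^sub>0"
        proof
          assume "w \<in> \<int>\<^sub>\<le>\<^sub>0"
          then obtain k where "w = - of_nat k" by (elim nonpos_Ints_cases')
          thus False using fk[of k] pos by simp
        qed
        moreover have "norm (Digamma w) \<le> C\<psi> * (2 + norm w) ^ 2 / (1 / (2 * y))"
          by (rule C\<psi>(2)[OF pos fk])
        moreover have "C\<psi> * (2 + norm w) ^ 2 / (1 / (2 * y)) \<le> C\<psi> * (4 * x) ^ 2 / (1 / (2 * y))"
        proof -
          have "norm w \<le> norm w1 + norm (w - w1)" by (metis norm_triangle_sub)
          hence "2 + norm w \<le> 4 * x" using w1x ww D1 x1 by linarith
          thus ?thesis using C\<psi>(1) pos by (intro divide_right_mono mult_left_mono power_mono) auto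
        qed
        moreover have "C\<psi> * (4 * x) ^ 2 / (1 / (2 * y)) = A" by (simp add: A_def power_mult_distrib)
        ultimately show ?thesis by linarith
      qed
      have A0: "A \<ge> 0" using C\<psi>(1) y1 by (simp add: A_def)
      have AD: "A * D < min (1/2) (\<kappa> / (4 * C))"
      proof -
        have "A * D \<le> A * (x * (K0 / fact n))"
          using A0 Dxt mult_left_mono[OF tU, of x] x1 by (intro mult_left_mono) auto
        also have "\<dots> = (32 * C\<psi> * K0) * real n ^ (2 * M + ?L + M) / fact n"
        proof -
          have "real n ^ (2 * M + ?L + M) = x ^ 2 * y * x"
            unfolding x_def y_def by (simp only: power_add mult_2 power2_eq_square)
          thus ?thesis by (simp add: A_def)
        qed
        finally show ?thesis using elim(9) by linarith
      qed
      have "norm (b1 - b2) \<le> 2 * norm b1 * A * D"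
        unfolding b1_def b2_def D_def by (rule rGamma_diff_bound[OF seg]) (use AD in \<open>auto simp: D_def\<close>)
      also have "\<dots> = 2 * norm b1 * (A * D)" by simp
      also have "\<dots> \<le> 2 * C * (\<kappa> / (4 * C))" using AD A0 D0 bC C0 by (intro mult_mono) auto
      also have "\<dots> = \<kappa> / 2" using C0 by simp
      finally show False using b\<kappa> \<kappa>0 by linarith
    qed
    then obtain m :: nat where m: "norm (w1 + of_nat m) < 1 / y" by blast
    define \<eta>1 \<eta>2 where "\<eta>1 = w1 + of_nat m" and "\<eta>2 = w2 + of_nat m"
    have \<eta>D: "norm (\<eta>1 - \<eta>2) = D" by (simp add: \<eta>1_def \<eta>2_def D_def)
    have "1 / y + 1 / (2 * y) \<le> 2 / y" "1 / y \<le> 2 / y" using y1 by (simp_all add: field_simps)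
    moreover have "norm \<eta>2 \<le> norm \<eta>1 + D" using norm_triangle_ineq4[of \<eta>1 "\<eta>1 - \<eta>2"] \<eta>D by simp
    ultimately have \<eta>y: "norm \<eta>1 \<le> 2 / y" "norm \<eta>2 \<le> 2 / y" using m Dy2 unfolding \<eta>1_def[symmetric] by linarith+
    have mx: "real (Suc m) \<le> 4 * x"
    proof -
      have "real m = norm (\<eta>1 - w1)" by (simp add: \<eta>1_def)
      also have "\<dots> \<le> norm \<eta>1 + norm w1" by (rule norm_triangle_ineq4)
      also have "norm \<eta>1 \<le> 1"
      proof -
        have "2 / y \<le> 1" using y1 by simp
        thus ?thesis using \<eta>y(1) by linarith
      qed
      finally show ?thesis using w1x x1 by simp
    qed
    have small: "norm \<eta> * real (Suc m) \<le> \<delta>" if "norm \<eta> \<le> 2 / y" for \<eta> :: complex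
    proof -
      have "norm \<eta> * real (Suc m) \<le> 2 / y * (4 * x)" using that mx y1 by (intro mult_mono) auto
      also have "\<dots> = 8 / real n" using x1 n1 by (simp add: y)
      also have "\<dots> \<le> \<delta>" using elim(10) \<delta>(1) n1 by (simp add: field_simps)
      finally show ?thesis .
    qed
    define F where "F = (fact m :: real)"
    have F0: "F > 0" by (simp add: F_def)
    have e1: "norm (b1 - (-1) ^ m * fact m * \<eta>1) \<le> \<epsilon> * (F * norm \<eta>1)"
      using \<delta>(2)[OF small[OF \<eta>y(1)]] by (simp add: b1_def \<eta>1_def F_def)
    have e2: "norm (b2 - (-1) ^ m * fact m * \<eta>2) \<le> \<epsilon> * (F * norm \<eta>2)"
      using \<delta>(2)[OF small[OF \<eta>y(2)]] by (simp add: b2_def \<eta>2_def F_def)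
    \<comment> \<open>As \<epsilon> is at most 1/2, half of the linear term is already bounded by
      |b|.\<close>
    have F\<eta>: "F * norm \<eta> \<le> 2 * C" if "norm (b - (-1) ^ m * fact m * \<eta>) \<le> \<epsilon> * (F * norm \<eta>)" "norm b \<le> C" for b \<eta> :: complex
    proof -
      have "norm ((-1) ^ m * fact m * \<eta>) = F * norm \<eta>" by (simp add: norm_mult norm_power F_def)
      hence "F * norm \<eta> \<le> norm b + \<epsilon> * (F * norm \<eta>)"
        using that(1) norm_triangle_ineq2[of "(-1) ^ m * fact m * \<eta>" b] norm_minus_commute[of b "(-1) ^ m * fact m * \<eta>"] by linarith
      moreover have "\<epsilon> * (F * norm \<eta>) \<le> 1/2 * (F * norm \<eta>)" using \<epsilon>(2) F0 by (intro mult_right_mono) auto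
      ultimately show ?thesis using that(2) by linarith
    qed
    note F\<eta>1 = F\<eta>[OF e1 bC(1)] and F\<eta>2 = F\<eta>[OF e2 bC(2)]
    have "norm ((b1 - b2) - (-1) ^ m * fact m * (\<eta>1 - \<eta>2)) \<le> \<kappa> / 2"
    proof -
      have "norm ((b1 - b2) - (-1) ^ m * fact m * (\<eta>1 - \<eta>2)) =
          norm ((b1 - (-1) ^ m * fact m * \<eta>1) - (b2 - (-1) ^ m * fact m * \<eta>2))" by (simp add: algebra_simps)
      also have "\<dots> \<le> \<epsilon> * (F * norm \<eta>1) + \<epsilon> * (F * norm \<eta>2)" using norm_triangle_ineq4 e1 e2 by (meson add_mono order_trans)
      also have "\<dots> \<le> \<epsilon> * (2 * C) + \<epsilon> * (2 * C)" using F\<eta>1 F\<eta>2 \<epsilon>(1) by (intro add_mono mult_left_mono) auto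
      also have "\<dots> = \<epsilon> * (8 * C) / 2" by (simp add: field_simps)
      finally show ?thesis using \<epsilon>(4) by linarith
    qed
    moreover have "norm ((-1) ^ m * fact m * (\<eta>1 - \<eta>2)) = F * D" by (simp add: norm_mult norm_power F_def \<eta>D)
    ultimately have "\<bar>norm (b1 - b2) - F * D\<bar> \<le> \<kappa> / 2" using norm_triangle_ineq3 by (metis order_trans)
    moreover have "norm (b1 - b2) \<le> 2 * C" using norm_triangle_ineq4[of b1 b2] bC by linarith
    \<comment> \<open>Slope comparison near -m: m! D and |b1 - b2| agree up to \<kappa> / 2, and the
      latter lies between \<kappa> and 2 C.\<close>
    ultimately have FD: "\<kappa> / 2 \<le> F * D" "F * D \<le> 4 * C" using b\<kappa> C0 by linarith+
    \<comment> \<open>Combines m! D \<le> 4 C with t \<le> n^M D and k0 \<le> n! t.\<close>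
    have mn: "fact m \<le> K1 * real n ^ M * fact n"
    proof -
      have "F * k0 \<le> F * (fact n * t)" using \<open>k0 \<le> fact n * t\<close> F0 by (intro mult_left_mono) auto
      also have "\<dots> \<le> F * (fact n * (x * D))" using txD F0 by (intro mult_left_mono) auto
      also have "\<dots> = (F * D) * (x * fact n)" by (simp add: mult_ac)
      also have "\<dots> \<le> 4 * C * (x * fact n)" using FD x1 by (intro mult_right_mono) auto
      finally have "F \<le> 4 * C / k0 * (x * fact n)" using k0 by (simp add: field_simps)
      also have "\<dots> \<le> K1 * (x * fact n)" using K1 x1 by (intro mult_right_mono) auto
      finally show ?thesis by (simp add: F_def x_def mult_ac)
    qed
    \<comment> \<open>The reverse direction: D \<le> n^M t with t at most K0 / n!, against the lower
      bound \<kappa> / 2 for m! D.\<close>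
    have nm: "fact n \<le> K1 * real n ^ M * fact m"
    proof -
      have "\<kappa> / 2 \<le> F * (x * (K0 / fact n))"
      proof -
        have "x * t \<le> x * (K0 / fact n)" using tU x1 by (intro mult_left_mono) auto
        hence "D \<le> x * (K0 / fact n)" using Dxt by linarith
        hence "F * D \<le> F * (x * (K0 / fact n))" using F0 by (intro mult_left_mono) auto
        thus ?thesis using FD(1) by linarith
      qed
      hence "fact n \<le> 2 * K0 / \<kappa> * (x * F)" using \<kappa>0 by (simp add: field_simps)
      also have "\<dots> \<le> K1 * (x * F)" 
      proof (intro mult_right_mono)
        have "2 * K0 / \<kappa> \<le> 4 * K0 / \<kappa>" using X \<kappa>0 by (intro divide_right_mono) (auto simp: K0_def)
        thus "2 * K0 / \<kappa> \<le> K1" using K1 by linarith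
      qed (use x1 F0 in auto)
      finally show ?thesis by (simp add: F_def x_def mult_ac)
    qed
    show ?case
    proof (rule exI[of _ z1], rule exI[of _ w1], rule exI[of _ m], intro conjI)
      show "poly2 P z1 w1 = 0" using elim(4) zS by (simp add: w1_def)
      have "norm (z1 + of_nat n) = \<bar>s1\<bar>" by (simp add: z1_def)
      also have "\<dots> \<le> K / fact n" using sK(1) Kpos(2) divide_right_mono[of K0 K "fact n"] by simp
      finally show "norm (z1 + of_nat n) \<le> K / fact n" .
      show "m \<le> n + M" using elim(11) mn by blast
      show "n \<le> m + M" using elim(12) nm by blast
      have "norm \<eta>1 * fact n \<le> norm \<eta>1 * (K1 * x * F)" using nm by (intro mult_left_mono) (auto simp: x_def F_def)
      also have "\<dots> = (F * norm \<eta>1) * (K1 * x)" by (simp add: mult_ac)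
      also have "\<dots> \<le> (2 * C) * (K1 * x)" using F\<eta>1 K1 x1 by (intro mult_right_mono) auto
      also have "\<dots> = (2 * C * K1) * x" by simp
      also have "\<dots> \<le> K * x" using Kpos x1 by (intro mult_right_mono) auto
      finally show "norm (w1 + of_nat m) \<le> K * real n ^ M / fact n" by (simp add: \<eta>1_def x_def field_simps)
    qed
  qed
  thus ?thesis using Kpos(1) by blast
qed

text \<open>Boundedness of n - m makes one integer k occur for infinitely many n. On the segment
  from (-n, -n + k) to the zero (z, w), the derivatives of \<open>P\<close> are polynomially
  bounded, so |P(-n, -n + k)| is at most of order n^N / n!. A nonzero polynomial stays bounded away
  from 0 at -n for large n.\<close>

lemma shift_divides: "\<exists>k::int. poly P [:of_int k, 1:] = 0"
proof -
  obtain K M where K: "K > 0" and ev: "\<forall>\<^sub>F n in sequentially. \<exists>z w m. poly2 P z w = 0 \<and> norm (z + of_nat n) \<le> K / fact n \<and>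
      norm (w + of_nat m) \<le> K * real n ^ M / fact n \<and> m \<le> n + M \<and> n \<le> m + M"
    using near_integer_points by blast
  define R where "R = (\<lambda>n (k::int). \<exists>z w. poly2 P z w = 0 \<and> norm (z + of_nat n) \<le> K / fact n \<and>
      norm (w + of_nat n - of_int k) \<le> K * real n ^ M / fact n)"
  have "\<forall>\<^sub>F n in sequentially. \<exists>k\<in>{- int M..int M}. R n k"
    using ev
  proof eventually_elim
    case (elim n)
    then obtain z w m where zw: "poly2 P z w = 0" "norm (z + of_nat n) \<le> K / fact n"
      "norm (w + of_nat m) \<le> K * real n ^ M / fact n" "m \<le> n + M" "n \<le> m + M" by blast
    have "w + of_nat n - of_int (int n - int m) = w + of_nat m" by simp
    hence "R n (int n - int m)" unfolding R_def using zw by metis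
    moreover have "int n - int m \<in> {- int M..int M}" using zw by auto
    ultimately show ?case by blast
  qed
  \<comment> \<open>Pigeonhole principle in filter form: otherwise finitely many eventual failures
    would combine.\<close>
  have "\<exists>k\<in>{- int M..int M}. \<exists>\<^sub>F n in sequentially. R n k"
  proof (rule ccontr)
    assume "\<not> ?thesis"
    hence "\<forall>k\<in>{- int M..int M}. \<forall>\<^sub>F n in sequentially. \<not> R n k" by (auto simp: frequently_def)
    hence "\<forall>\<^sub>F n in sequentially. \<forall>k\<in>{- int M..int M}. \<not> R n k" by (intro eventually_ball_finite) auto
    with \<open>\<forall>\<^sub>F n in sequentially. \<exists>k\<in>{- int M..int M}. R n k\<close>
    have "\<forall>\<^sub>F n in sequentially. False" by eventually_elim blast
    thus False by simp
  qed
  then obtain k where k: "\<exists>\<^sub>F n in sequentially. R n k" by blast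
  define g where "g = poly P [:of_int k, 1:]"
  have "g = 0"
  proof (rule ccontr)
    assume "g \<noteq> 0"
    then obtain \<kappa> where \<kappa>: "\<kappa> > 0" "\<forall>\<^sub>F n in sequentially. \<forall>z\<in>cball (- of_nat n) 1. norm (poly g z) \<ge> \<kappa>"
      using poly_lower_bound by blast
    \<comment> \<open>The exponent 2 suffices on the segment, because n + |k| + 1 is at most 2 n,
      hence at most n^2, for large n.\<close>
    obtain N1 where N1: "\<forall>\<^sub>F n in sequentially. \<forall>z\<in>cball (- of_nat n) 1. \<forall>w. norm w \<le> real n ^ 2 \<longrightarrow> norm (poly2 (pderiv_x P) z w) \<le> real n ^ N1"
      using poly2_growth by blast
    obtain N2 where N2: "\<forall>\<^sub>F n in sequentially. \<forall>z\<in>cball (- of_nat n) 1. \<forall>w. norm w \<le> real n ^ 2 \<longrightarrow> norm (poly2 (pderiv P) z w) \<le> real n ^ N2"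
      using poly2_growth by blast
    have ev1: "\<forall>\<^sub>F n in sequentially. K * real n ^ M / fact n < 1" by (rule eventually_power_over_fact_less) simp
    have ev2: "\<forall>\<^sub>F n in sequentially. K * real n ^ N1 / fact n < \<kappa> / 2" by (rule eventually_power_over_fact_less) (use \<kappa> in simp)
    have ev3: "\<forall>\<^sub>F n in sequentially. K * real n ^ (N2 + M) / fact n < \<kappa> / 2" by (rule eventually_power_over_fact_less) (use \<kappa> in simp)
    have ev4: "\<forall>\<^sub>F n in sequentially. real_of_int \<bar>k\<bar> + 2 \<le> real n"
      using filterlim_real_sequentially unfolding filterlim_at_top by blast
    have "\<forall>\<^sub>F n in sequentially. \<not> R n k"
      using \<kappa>(2) N1 N2 ev1 ev2 ev3 ev4
    proof eventually_elim
      case (elim n)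
      show ?case
      proof
        assume "R n k"
        then obtain z w where zw: "poly2 P z w = 0" "norm (z + of_nat n) \<le> K / fact n"
          "norm (w + of_nat n - of_int k) \<le> K * real n ^ M / fact n" unfolding R_def by blast
        have n2: "real n \<ge> 2" using elim(7) by linarith
        have "K / fact n \<le> K * real n ^ M / fact n"
          using K n2 by (intro divide_right_mono) (auto simp: mult_le_cancel_left1 intro!: one_le_power)
        hence Kn: "K / fact n < 1" using elim(4) by linarith
        have zw1: "norm (z + of_nat n) \<le> 1" "norm (w + of_nat n - of_int k) \<le> 1" using zw(2,3) Kn elim(4) by linarith+
        define p q where "p = (\<lambda>t::complex. - of_nat n + t * (z + of_nat n))"
          and "q = (\<lambda>t::complex. - of_nat n + of_int k + t * (w + of_nat n - of_int k))"
        have pq: "p 0 = - of_nat n" "q 0 = - of_nat n + of_int k" "p 1 = z" "q 1 = w" by (simp_all add: p_def q_def)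
        let ?d = "\<lambda>t. poly2 (pderiv_x P) (p t) (q t) * (z + of_nat n) + poly2 (pderiv P) (p t) (q t) * (w + of_nat n - of_int k)"
        have "norm (poly2 P (p 0) (q 0) - poly2 P (p 1) (q 1)) \<le>
           (K * real n ^ N1 / fact n + K * real n ^ (N2 + M) / fact n) * norm (0 - (1::complex))"
        proof (rule field_differentiable_bound[OF convex_cball[of 0 1]])
          fix t :: complex assume t: "t \<in> cball 0 1"
          show "((\<lambda>t. poly2 P (p t) (q t)) has_field_derivative ?d t) (at t within cball 0 1)"
            by (rule poly2_has_field_derivative) (auto simp: p_def q_def intro!: derivative_eq_intros)
          have t1: "norm t \<le> 1" using t by simp
          have "norm (t * (z + of_nat n)) \<le> 1 * 1" unfolding norm_mult using t1 zw1 by (intro mult_mono) auto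
          hence p: "p t \<in> cball (- of_nat n) 1" by (simp add: p_def dist_norm)
          have a: "norm (t * (w + of_nat n - of_int k)) \<le> 1 * 1" unfolding norm_mult using t1 zw1 by (intro mult_mono) auto
          have "norm (q t) \<le> norm (- of_nat n + of_int k :: complex) + 1"
            unfolding q_def using a norm_triangle_ineq[of "- of_nat n + of_int k" "t * (w + of_nat n - of_int k)"] by linarith
          also have "norm (- of_nat n + of_int k :: complex) \<le> real n + real_of_int \<bar>k\<bar>"
            using norm_triangle_ineq[of "- of_nat n :: complex" "of_int k"] by simp
          also have "real n + real_of_int \<bar>k\<bar> + 1 \<le> 2 * real n" using elim(7) by linarith
          also have "2 * real n \<le> real n * real n" using n2 by (intro mult_right_mono) auto
          finally have q: "norm (q t) \<le> real n ^ 2" by (simp add: power2_eq_square)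
          have "norm (?d t) \<le> norm (poly2 (pderiv_x P) (p t) (q t)) * norm (z + of_nat n) + norm (poly2 (pderiv P) (p t) (q t)) * norm (w + of_nat n - of_int k)"
            by (metis norm_mult norm_triangle_ineq)
          also have "\<dots> \<le> real n ^ N1 * (K / fact n) + real n ^ N2 * (K * real n ^ M / fact n)"
            using elim(2,3) p q zw(2,3) by (intro add_mono mult_mono) auto
          also have "\<dots> = K * real n ^ N1 / fact n + K * real n ^ (N2 + M) / fact n" by (simp add: power_add mult_ac)
          finally show "norm (?d t) \<le> K * real n ^ N1 / fact n + K * real n ^ (N2 + M) / fact n" .
        qed auto
        hence "norm (poly2 P (- of_nat n) (- of_nat n + of_int k)) \<le> K * real n ^ N1 / fact n + K * real n ^ (N2 + M) / fact n"
          unfolding pq using zw(1) by simp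
        hence "norm (poly2 P (- of_nat n) (- of_nat n + of_int k)) < \<kappa>" using elim(5,6) by linarith
        moreover have "poly g (- of_nat n) = poly2 P (- of_nat n) (- of_nat n + of_int k)"
          by (simp add: g_def poly_poly_eq_poly2 add.commute)
        moreover have "norm (poly g (- of_nat n)) \<ge> \<kappa>" using elim(1) by simp
        ultimately show False by simp
      qed
    qed
    thus False using k by (simp add: frequently_def)
  qed
  thus ?thesis unfolding g_def by blast
qed

end

section \<open>Plane curves off the real axis\<close>

text \<open>Each isolated point is the only point of \<open>A\<close> in some member of a countable
  basis. Hence an uncountable set contains limit points of itself outside any countable exceptional
  set.\<close>

lemma countable_isolated_points:
  fixes A :: "'a::second_countable_topology set"
  shows "countable {x\<in>A. \<not> x islimpt A}"
proof -
  obtain \<B> :: "'a set set" where \<B>: "countable \<B>" "topological_basis \<B>" using ex_countable_basis by blast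
  have "\<exists>U\<in>\<B>. x \<in> U \<and> U \<inter> A \<subseteq> {x}" if x: "\<not> x islimpt A" for x
  proof -
    obtain T where T: "x \<in> T" "open T" "\<And>y. y \<in> A \<Longrightarrow> y \<in> T \<Longrightarrow> y = x"
      using x unfolding islimpt_def by blast
    obtain U where U: "U \<in> \<B>" "x \<in> U" "U \<subseteq> T" using topological_basisE[OF \<B>(2) T(2,1)] by blast
    have "U \<inter> A \<subseteq> {x}" using U(3) T(3) by blast
    thus ?thesis using U(1,2) by blast
  qed
  then obtain f where f: "\<And>x. \<not> x islimpt A \<Longrightarrow> f x \<in> \<B> \<and> x \<in> f x \<and> f x \<inter> A \<subseteq> {x}" by metis
  have "inj_on f {x\<in>A. \<not> x islimpt A}"
  proof (rule inj_onI)
    fix x y assume xy: "x \<in> {x\<in>A. \<not> x islimpt A}" "y \<in> {x\<in>A. \<not> x islimpt A}" "f x = f y"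
    have "y \<in> f x \<inter> A" using xy f[of y] by simp
    thus "x = y" using f[of x] xy by blast
  qed
  moreover have "f ` {x\<in>A. \<not> x islimpt A} \<subseteq> \<B>" using f by blast
  ultimately show ?thesis by (intro countable_image_inj_on[OF countable_subset[OF _ \<B>(1)]])
qed

section \<open>Polynomials with vanishing Wronskian\<close>

lemma lead_coeff_pderiv:
  fixes p :: "'a::{idom,ring_char_0} poly"
  shows "lead_coeff (pderiv p) = of_nat (degree p) * lead_coeff p"
proof (cases "degree p = 0")
  case True
  hence "pderiv p = 0" by (simp add: pderiv_eq_0_iff)
  thus ?thesis using True by simp
next
  case False
  thus ?thesis by (simp add: degree_pderiv coeff_pderiv)
qed

text \<open>In the leading coefficients of the two products the degrees appear as numerical factors;
  characteristic 0 lets them be compared.\<close>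

lemma wronskian_eq_0_imp_degree_eq:
  fixes p q :: "'a::field_char_0 poly"
  assumes "q * pderiv p = pderiv q * p" "p \<noteq> 0" "q \<noteq> 0"
  shows "degree p = degree q"
proof -
  have "lead_coeff q * (of_nat (degree p) * lead_coeff p) = (of_nat (degree q) * lead_coeff q) * lead_coeff p"
    using arg_cong[OF assms(1), of lead_coeff] unfolding lead_coeff_mult lead_coeff_pderiv .
  hence "lead_coeff q * lead_coeff p * of_nat (degree p) = lead_coeff q * lead_coeff p * of_nat (degree q)"
    by (simp add: mult_ac)
  hence "(of_nat (degree p) :: 'a) = of_nat (degree q)" using assms by simp
  thus ?thesis by simp
qed

text \<open>After subtraction of the multiple of \<open>q\<close> that cancels the leading term, the
  Wronskian still vanishes. A nonzero difference would have the degree of \<open>q\<close>, where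
  its coefficient is 0.\<close>

lemma wronskian_eq_0_imp_proportional:
  fixes p q :: "'a::field_char_0 poly"
  assumes w: "q * pderiv p = pderiv q * p" and q: "q \<noteq> 0"
  shows "\<exists>c. p = smult c q"
proof (cases "p = 0")
  case False
  have d: "degree p = degree q" by (rule wronskian_eq_0_imp_degree_eq[OF w False q])
  define c where "c = lead_coeff p / lead_coeff q"
  define s where "s = p - smult c q"
  have "q * pderiv s = pderiv q * s" using w by (simp add: s_def pderiv_diff pderiv_smult algebra_simps)
  moreover have "coeff s (degree q) = 0" using q d by (simp add: s_def c_def)
  ultimately have "s = 0" using wronskian_eq_0_imp_degree_eq[of q s] q leading_coeff_0_iff[of s] by metis
  thus ?thesis by (auto simp: s_def)
qed (auto intro: exI[of _ 0])

lemma holomorphic_on_poly2 [holomorphic_intros]: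
  assumes "f holomorphic_on A" "g holomorphic_on A"
  shows "(\<lambda>z. poly2 P (f z) (g z)) holomorphic_on A"
proof (induction P)
  case (pCons a P)
  have "(\<lambda>z. poly a (f z)) holomorphic_on A"
    by (induction a) (auto intro!: holomorphic_intros assms)
  thus ?case using pCons assms by (auto intro!: holomorphic_intros)
qed auto

lemma rGamma_countable_fibres: "countable {z::complex. rGamma z = b}"
proof -
  have "countable {z \<in> UNIV. rGamma z - b = 0}"
  proof (rule holomorphic_countable_zeros)
    show "\<not> (\<lambda>z. rGamma z - b) constant_on UNIV"
    proof
      assume "(\<lambda>z. rGamma z - b) constant_on UNIV"
      then obtain c where c: "\<And>z. rGamma z - b = c" by (auto simp: constant_on_def)
      have "rGamma 0 - b = rGamma 1 - b" unfolding c ..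
      thus False by simp
    qed
  qed (auto intro!: holomorphic_intros)
  thus ?thesis by simp
qed

text \<open>Least degree does the work of irreducibility. If the ideal generator \<open>h\<close>
  had positive degree, a multiple of \<open>P\<close> by a polynomial in x would be a product of two
  factors of lower degree, and \<open>T\<close> would be covered by two countable zero sets.\<close>

lemma minimal_bezout:
  fixes P :: "complex poly poly" and T :: "complex set"
  assumes P: "P \<noteq> 0" and unc: "uncountable T" and T: "\<And>z. z \<in> T \<Longrightarrow> poly2 P z (cnj z) = 0"
    and min: "\<And>R. R \<noteq> 0 \<Longrightarrow> degree R < degree P \<Longrightarrow> countable {z\<in>T. poly2 R z (cnj z) = 0}"
    and F: "F \<noteq> 0" "degree F < degree P"
  shows "\<exists>A B D. D \<noteq> 0 \<and> A * P + B * F = [:D:]"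
proof -
  from ideal_generator[OF F(1), of P]
  obtain a b h c q where h: "h = a * P + b * F" "h \<noteq> 0" "degree h \<le> degree F" "c \<noteq> 0" "smult c P = h * q"
    by (elim exE conjE) (rule that)
  have "degree h = 0"
  proof (rule ccontr)
    assume dh: "degree h \<noteq> 0"
    have q: "q \<noteq> 0" using h(4,5) P by auto
    have "degree P = degree h + degree q"
      using arg_cong[OF h(5), of degree] h(2,4) q by (simp add: degree_mult_eq)
    hence "degree h < degree P" "degree q < degree P" using dh h(3) F(2) by auto
    hence "countable ({z\<in>T. poly2 h z (cnj z) = 0} \<union> {z\<in>T. poly2 q z (cnj z) = 0})"
      using min h(2) q by auto
    moreover have "T \<subseteq> {z\<in>T. poly2 h z (cnj z) = 0} \<union> {z\<in>T. poly2 q z (cnj z) = 0}"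
    proof
      fix z assume z: "z \<in> T"
      have "poly2 h z (cnj z) * poly2 q z (cnj z) = 0"
        using arg_cong[OF h(5), of "\<lambda>t. poly2 t z (cnj z)"] T[OF z] by simp
      thus "z \<in> {z\<in>T. poly2 h z (cnj z) = 0} \<union> {z\<in>T. poly2 q z (cnj z) = 0}" using z by auto
    qed
    ultimately have "countable T" by (rule countable_subset[rotated])
    thus False using unc by simp
  qed
  then obtain D where "h = [:D:]" by (rule degree_eq_zeroE)
  thus ?thesis using h(1,2) by (intro exI[of _ a] exI[of _ b] exI[of _ D]) auto
qed

text \<open>\<open>pderiv_x P\<close> may have the same degree as \<open>P\<close>, so
  \<open>minimal_bezout\<close> is applied to a combination \<open>F\<close> whose leading term
  cancels. If \<open>F\<close> were 0, all coefficients would be proportional to \<open>l\<close>,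
  and P = l(z) g(w) would have only finitely many zeros with w = cnj z.\<close>

lemma minimal_bezout_x:
  fixes P :: "complex poly poly" and T :: "complex set"
  assumes P: "P \<noteq> 0" and unc: "uncountable T" and T: "\<And>z. z \<in> T \<Longrightarrow> poly2 P z (cnj z) = 0"
    and min: "\<And>R. R \<noteq> 0 \<Longrightarrow> degree R < degree P \<Longrightarrow> countable {z\<in>T. poly2 R z (cnj z) = 0}"
  shows "\<exists>A B D. D \<noteq> 0 \<and> A * P + B * pderiv_x P = [:D:]"
proof -
  define l where "l = lead_coeff P"
  have l: "l \<noteq> 0" using P by (simp add: l_def)
  \<comment> \<open>This is \<open>l\<^sup>2\<close> times the \<open>x\<close>-derivative of the monic polynomial \<open>P / l\<close>.\<close>
  define F where "F = smult l (pderiv_x P) - smult (pderiv l) P"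
  have cF: "coeff F i = l * pderiv (coeff P i) - pderiv l * coeff P i" for i by (simp add: F_def)
  have "F \<noteq> 0"
  proof
    assume "F = 0"
    hence "l * pderiv (coeff P i) = pderiv l * coeff P i" for i using cF[of i] by simp
    hence "\<exists>c. coeff P i = smult c l" for i by (rule wronskian_eq_0_imp_proportional[OF _ l])
    then obtain c where c: "\<And>i. coeff P i = smult (c i) l" by metis
    define g where "g = (\<Sum>i\<le>degree P. monom (c i) i)"
    have "smult (c (degree P)) l = smult 1 l" using c[of "degree P"] by (simp add: l_def)
    hence "smult (c (degree P) - 1) l = 0" by (simp add: smult_diff_left)
    hence "c (degree P) = 1" using l by simp
    moreover have "coeff g (degree P) = c (degree P)"
      by (simp add: g_def coeff_sum)
    ultimately have g: "g \<noteq> 0" by auto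
    have ev: "poly2 P z w = poly l z * poly g w" for z w
    proof -
      have "poly2 P z w = (\<Sum>i\<le>degree P. poly (coeff P i) z * w ^ i)"
        by (simp add: poly2_def poly_altdef[of P] poly_sum)
      also have "\<dots> = poly l z * poly g w"
        by (simp add: c g_def poly_sum poly_monom sum_distrib_left mult_ac)
      finally show ?thesis .
    qed
    have "T \<subseteq> {z. poly l z = 0} \<union> cnj ` {w. poly g w = 0}"
    proof
      fix z assume z: "z \<in> T"
      have "poly l z = 0 \<or> poly g (cnj z) = 0" using T[OF z] unfolding ev by simp
      moreover have "z = cnj (cnj z)" by simp
      ultimately show "z \<in> {z. poly l z = 0} \<union> cnj ` {w. poly g w = 0}" by blast
    qed
    moreover have "finite ({z. poly l z = 0} \<union> cnj ` {w. poly g w = 0})"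
      using poly_roots_finite[OF l] poly_roots_finite[OF g] by simp
    ultimately have "finite T" by (rule finite_subset)
    thus False using unc countable_finite by blast
  qed
  moreover have "degree F < degree P"
  proof -
    have "coeff F i = 0" if "i \<ge> degree P" for i
      using that by (cases "i = degree P") (auto simp: cF l_def coeff_eq_0)
    thus ?thesis by (metis \<open>F \<noteq> 0\<close> leading_coeff_0_iff not_le)
  qed
  ultimately obtain A B D where bez: "D \<noteq> 0" "A * P + B * F = [:D:]"
    using minimal_bezout[OF P unc T min] by blast
  have "(A - smult (pderiv l) B) * P + smult l B * pderiv_x P = [:D:]"
    using bez(2) by (simp add: F_def algebra_simps smult_diff_right)
  thus ?thesis using bez(1) by blast
qed

text \<open>\<open>Q\<close> is minimised on \<open>V\<close> first, and \<open>P\<close> afterwards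
  on the zero set of \<open>Q\<close>, so that both relations hold on one uncountable set
  \<open>T\<close> on which \<open>P\<close> has least degree.\<close>

lemma countable_off_axis:
  fixes V :: "complex set"
  assumes im: "\<And>z. z \<in> V \<Longrightarrow> Im z \<noteq> 0"
    and P0: "P0 \<noteq> 0" "\<And>z. z \<in> V \<Longrightarrow> poly2 P0 z (cnj z) = 0"
    and Q0: "Q0 \<noteq> 0" "\<And>z. z \<in> V \<Longrightarrow> poly2 Q0 (rGamma z) (rGamma (cnj z)) = 0"
  shows "countable V"
proof (rule ccontr)
  assume unc: "uncountable V"
  define ZQ where "ZQ = (\<lambda>Q. {z\<in>V. poly2 Q (rGamma z) (rGamma (cnj z)) = 0})"
  have "ZQ Q0 = V" using Q0 by (auto simp: ZQ_def)
  hence "Q0 \<noteq> 0 \<and> uncountable (ZQ Q0)" using Q0 unc by simp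
  then obtain Q where Q: "Q \<noteq> 0" "uncountable (ZQ Q)"
    and Qmin: "\<And>R. degree R < degree Q \<Longrightarrow> \<not> (R \<noteq> 0 \<and> uncountable (ZQ R))"
    by (rule min_degree_ex[of "\<lambda>Q. Q \<noteq> 0 \<and> uncountable (ZQ Q)"]) blast
  \<comment> \<open>The zeros of a factor w - b lie over a countable fibre of \<open>rGamma\<close>,
    so the cofactor, of smaller degree, would still vanish on an uncountable set.\<close>
  have Qb: "poly Q [:b:] \<noteq> 0" for b
  proof
    assume "poly Q [:b:] = 0"
    then obtain H where H: "Q = [:- [:b:], 1:] * H" using poly_eq_0_iff_dvd dvdE by metis
    hence H0: "H \<noteq> 0" using Q by auto
    have "degree Q = Suc (degree H)" unfolding H using H0 by (subst degree_mult_eq) auto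
    hence "countable (ZQ H)" using Qmin[of H] H0 by auto
    moreover have "countable (cnj ` {w. rGamma w = b})" using rGamma_countable_fibres by blast
    moreover have "ZQ Q \<subseteq> ZQ H \<union> cnj ` {w. rGamma w = b}"
    proof
      fix z assume z: "z \<in> ZQ Q"
      hence "(rGamma (cnj z) - b) * poly2 H (rGamma z) (rGamma (cnj z)) = 0"
        by (simp add: ZQ_def H algebra_simps)
      hence "rGamma (cnj z) = b \<or> z \<in> ZQ H" using z by (simp add: ZQ_def)
      moreover have "z = cnj (cnj z)" by simp
      ultimately show "z \<in> ZQ H \<union> cnj ` {w. rGamma w = b}" by blast
    qed
    ultimately have "countable (ZQ Q)" by (meson countable_Un countable_subset)
    thus False using Q(2) by simp
  qed
  define ZP where "ZP = (\<lambda>P. {z\<in>ZQ Q. poly2 P z (cnj z) = 0})"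
  have "ZP P0 = ZQ Q" using P0 by (auto simp: ZP_def ZQ_def)
  hence "P0 \<noteq> 0 \<and> uncountable (ZP P0)" using P0 Q by simp
  then obtain P where P: "P \<noteq> 0" "uncountable (ZP P)"
    and Pmin: "\<And>R. degree R < degree P \<Longrightarrow> \<not> (R \<noteq> 0 \<and> uncountable (ZP R))"
    by (rule min_degree_ex[of "\<lambda>P. P \<noteq> 0 \<and> uncountable (ZP P)"]) blast
  define T where "T = ZP P"
  have T: "poly2 P z (cnj z) = 0" "Im z \<noteq> 0" "poly2 Q (rGamma z) (rGamma (cnj z)) = 0" if "z \<in> T" for z
    using that im by (auto simp: T_def ZP_def ZQ_def)
  have uncT: "uncountable T" using P by (simp add: T_def)
  have min: "countable {z\<in>T. poly2 R z (cnj z) = 0}" if "R \<noteq> 0" "degree R < degree P" for R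
  proof -
    have "countable (ZP R)" using Pmin[of R] that by blast
    moreover have "{z\<in>T. poly2 R z (cnj z) = 0} \<subseteq> ZP R" by (auto simp: T_def ZP_def)
    ultimately show ?thesis by (rule countable_subset[rotated])
  qed
  have deg: "degree P > 0"
  proof (rule ccontr)
    assume "\<not> degree P > 0"
    hence "degree P = 0" by simp
    then obtain a where a: "P = [:a:]" by (rule degree_eq_zeroE)
    hence "T \<subseteq> {z. poly a z = 0}" using T(1) by auto
    moreover have "finite {z. poly a z = 0}" using a P by (intro poly_roots_finite) auto
    ultimately have "finite T" by (rule finite_subset)
    thus False using uncT countable_finite by blast
  qed
  have "pderiv P \<noteq> 0" "degree (pderiv P) < degree P" using pderiv_neq_0[OF deg] deg by (auto simp: degree_pderiv)
  then obtain A1 B1 D1 where bez1: "D1 \<noteq> 0" "A1 * P + B1 * pderiv P = [:D1:]"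
    using minimal_bezout[OF P(1) uncT T(1) min] by blast
  obtain A2 B2 D2 where bez2: "D2 \<noteq> 0" "A2 * P + B2 * pderiv_x P = [:D2:]"
    using minimal_bezout_x[OF P(1) uncT T(1) min] by blast
  have "finite {z. poly (D1 * lead_coeff P) z = 0}" using bez1(1) P(1) by (intro poly_roots_finite) auto
  hence "countable ({z\<in>T. \<not> z islimpt T} \<union> {z. poly (D1 * lead_coeff P) z = 0})"
    by (intro countable_Un countable_isolated_points countable_finite)
  \<comment> \<open>The base point must be a limit point of \<open>T\<close> for the identity
    theorem and must avoid the exceptional points of the branch; this excludes only countably many
    points.\<close>
  then obtain a where a: "a \<in> T" "a islimpt T" "poly D1 a \<noteq> 0" "poly (lead_coeff P) a \<noteq> 0"
    using uncT countable_subset[of T "{z\<in>T. \<not> z islimpt T} \<union> {z. poly (D1 * lead_coeff P) z = 0}"] by fastforce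
  from algebraic_branch[OF deg bez1(2) a(3,4) T(1)[OF a(1)] T(2)[OF a(1)]]
  obtain \<Omega> \<phi> d e where \<Omega>: "open \<Omega>" "connected \<Omega>" "a \<in> \<Omega>" "\<phi> holomorphic_on \<Omega>"
    and zero: "\<forall>z\<in>\<Omega>. poly2 P z (\<phi> z) = 0"
    and der: "\<forall>z\<in>\<Omega>. (\<phi> has_field_derivative (- poly2 (pderiv_x P) z (\<phi> z) / poly2 (pderiv P) z (\<phi> z))) (at z)"
    and balls: "\<forall>\<^sub>F n in sequentially. ball (- of_nat n) \<bar>Im a\<bar> \<subseteq> \<Omega>"
    and de: "d > 0" "e > 0" "ball a d \<subseteq> \<Omega>"
    and uniq: "\<forall>z\<in>ball a d. \<forall>w\<in>ball (cnj a) e. poly2 P z w = 0 \<longrightarrow> w = \<phi> z"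
    by (elim exE conjE) (rule that)
  \<comment> \<open>Conjugation is an isometry, so the radius \<open>e\<close> for z keeps cnj z in
    the disc about cnj a where \<phi> z is the only root.\<close>
  define U where "U = T \<inter> ball a (min d e)"
  have rel: "poly2 Q (rGamma w) (rGamma (\<phi> w)) = 0" if w: "w \<in> \<Omega>" for w
  proof (rule analytic_continuation[of "\<lambda>z. poly2 Q (rGamma z) (rGamma (\<phi> z))" \<Omega> U a w])
    show "(\<lambda>z. poly2 Q (rGamma z) (rGamma (\<phi> z))) holomorphic_on \<Omega>"
      by (intro holomorphic_on_poly2 holomorphic_rGamma holomorphic_rGamma' \<Omega>(4))
    show "U \<subseteq> \<Omega>" using de by (auto simp: U_def)
    show "a islimpt U" unfolding islimpt_approachable
    proof (intro allI impI)
      fix r :: real assume "r > 0"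
      hence "min r (min d e) > 0" using de by simp
      then obtain x where "x \<in> T" "x \<noteq> a" "dist x a < min r (min d e)"
        using a(2) unfolding islimpt_approachable by blast
      thus "\<exists>x'\<in>U. x' \<noteq> a \<and> dist x' a < r" by (auto simp: U_def dist_commute)
    qed
    fix z assume z: "z \<in> U"
    have "dist (cnj a) (cnj z) = dist a z" by (metis complex_cnj_diff complex_mod_cnj dist_norm)
    hence "cnj z \<in> ball (cnj a) e" "z \<in> ball a d" using z by (auto simp: U_def)
    hence "cnj z = \<phi> z" using uniq T(1) z by (auto simp: U_def)
    thus "poly2 Q (rGamma z) (rGamma (\<phi> z)) = 0" using T(3)[of z] z by (simp add: U_def)
  qed (use \<Omega> w in auto)
  define r where "r = min 1 \<bar>Im a\<bar>"
  have sub: "ball (- of_nat n) r \<subseteq> ball (- of_nat n :: complex) \<bar>Im a\<bar>" for n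
    by (intro subset_ball) (simp add: r_def)
  have ev: "\<forall>\<^sub>F n in sequentially. \<forall>z\<in>ball (- of_nat n) r. z \<in> \<Omega>"
    using balls by eventually_elim (use sub in blast)
  interpret gamma_branch P Q A1 B1 A2 B2 D1 D2 \<phi> r
  proof
    show "0 < r" "r \<le> 1" using T(2)[OF a(1)] by (auto simp: r_def)
    show "\<forall>\<^sub>F n in sequentially. \<forall>z\<in>ball (- of_nat n) r.
       (\<phi> has_field_derivative (- poly2 (pderiv_x P) z (\<phi> z) / poly2 (pderiv P) z (\<phi> z))) (at z)"
      using ev by eventually_elim (use der in blast)
    show "\<forall>\<^sub>F n in sequentially. \<forall>z\<in>ball (- of_nat n) r. poly2 P z (\<phi> z) = 0"
      using ev by eventually_elim (use zero in blast)
    show "\<forall>\<^sub>F n in sequentially. \<forall>z\<in>ball (- of_nat n) r. poly2 Q (rGamma z) (rGamma (\<phi> z)) = 0"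
      using ev by eventually_elim (use rel in blast)
  qed (fact deg bez1 bez2 Q Qb)+
  obtain k :: int where k: "poly P [:of_int k, 1:] = 0" using shift_divides by blast
  then obtain H where H: "P = [:- [:of_int k, 1:], 1:] * H" using poly_eq_0_iff_dvd dvdE by metis
  hence H0: "H \<noteq> 0" using P by auto
  have "degree P = Suc (degree H)" unfolding H using H0 by (subst degree_mult_eq) auto
  hence "countable {z\<in>T. poly2 H z (cnj z) = 0}" using min[of H] H0 by auto
  moreover have "T \<subseteq> {z\<in>T. poly2 H z (cnj z) = 0}"
  proof
    fix z assume z: "z \<in> T"
    have "(cnj z - (z + of_int k)) * poly2 H z (cnj z) = 0"
      using T(1)[OF z] by (simp add: H algebra_simps)
    \<comment> \<open>The imaginary part is -2 Im z, because k is real.\<close>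
    moreover have "cnj z - (z + of_int k) \<noteq> 0" using T(2)[OF z] by (auto simp: complex_eq_iff)
    ultimately show "z \<in> {z\<in>T. poly2 H z (cnj z) = 0}" using z by simp
  qed
  ultimately have "countable T" by (rule countable_subset[rotated])
  thus False using uncT by simp
qed

theorem theorem1p4:
  fixes \<V> :: "(real \<times> real) set"
  assumes "weakly_bialgebraic_curve Gamma_poles Gamma_plane \<V>"
  shows "\<V> = {(x, 0) | x. x \<in> UNIV}"
proof -
  note wb = assms[unfolded weakly_bialgebraic_curve_def]
  have ne: "\<V> \<noteq> {}" and "\<V> \<subset> UNIV" and nsing: "\<not> is_singleton \<V>"
    and ex: "\<exists>V W. proper_subvariety W \<and> \<V> = real_points V \<and> Gamma_plane ` (\<V> \<inter> (UNIV - Gamma_poles)) \<subseteq> real_points W"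
    and nex: "\<not> (\<exists>V\<^sub>1 V\<^sub>2. \<V> = real_points V\<^sub>1 \<union> real_points V\<^sub>2 \<and> real_points V\<^sub>1 \<subset> \<V> \<and> real_points V\<^sub>2 \<subset> \<V>)"
    using wb by - (elim conjE, assumption)+
  have proper: "\<V> \<noteq> UNIV" using \<open>\<V> \<subset> UNIV\<close> by blast
  from ex obtain F W where W: "proper_subvariety W" and F: "\<V> = real_points F"
    and img: "Gamma_plane ` (\<V> \<inter> (UNIV - Gamma_poles)) \<subseteq> real_points W"
    by (elim exE conjE) (rule that)
  have irr: "real_points V1 = \<V> \<or> real_points V2 = \<V>" if "\<V> = real_points V1 \<union> real_points V2" for V1 V2
    using nex that by (metis Un_upper1 Un_upper2 psubsetI)
  \<comment> \<open>A finite set with more than one point splits into a point and the rest, both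
    algebraic and proper.\<close>
  have inf: "infinite \<V>"
  proof
    assume fin: "finite \<V>"
    obtain v where v: "v \<in> \<V>" using ne by blast
    obtain V1 where V1: "{v} = real_points V1" using finite_real_points[of "{v}"] by auto
    obtain V2 where V2: "\<V> - {v} = real_points V2" using finite_real_points[of "\<V> - {v}"] fin by auto
    have "\<V> = real_points V1 \<union> real_points V2" using V1 V2 v by auto
    from irr[OF this] show False using V1 V2 v nsing by (metis Diff_iff is_singletonI singletonI)
  qed
  define B where "B = {v \<in> real_points F. snd v \<noteq> 0}"
  obtain v where "v \<notin> \<V>" using proper by blast
  then obtain f0 where f0: "f0 \<in> F" "bpoly f0 v \<noteq> 0" unfolding F real_points_def by blast
  hence "f0 \<noteq> 0" by (auto simp: bpoly_def)
  note f0 = f0(1) this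
  obtain q where q: "q \<in> W" "q \<noteq> 0" using W by (auto simp: proper_subvariety_def)
  have "finite B"
  proof (rule ccontr)
    assume "infinite B"
    hence uncB: "uncountable B" unfolding B_def by (rule infinite_imp_uncountable_off_axis[OF _ f0])
    define V where "V = {z. (Re z, Im z) \<in> B}"
    have "B = (\<lambda>z. (Re z, Im z)) ` V"
      by (force simp: V_def image_iff intro: exI[of _ "Complex _ _"])
    hence uncV: "uncountable V" using uncB countable_image by metis
    obtain P0 :: "complex poly poly" where P0: "P0 \<noteq> 0" "\<And>z. poly2 P0 z (cnj z) = of_real (poly2 f0 (Re z) (Im z))"
      using complexification[OF f0(2)] by blast
    obtain R :: "complex poly poly" where R: "R \<noteq> 0" "\<And>z. poly2 R z (cnj z) = of_real (poly2 q (Re z) (Im z))"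
      using complexification[OF q(2)] by blast
    obtain Q0 where Q0: "Q0 \<noteq> 0" "\<And>a b. a \<noteq> 0 \<Longrightarrow> b \<noteq> 0 \<Longrightarrow> poly2 R (inverse a) (inverse b) = 0 \<Longrightarrow> poly2 Q0 a b = 0"
      using poly2_reverse[OF R(1)] by blast
    have "countable V"
    proof (rule countable_off_axis[OF _ P0(1) _ Q0(1)])
      fix z assume z: "z \<in> V"
      show im: "Im z \<noteq> 0" using z by (simp add: V_def B_def)
      show "poly2 P0 z (cnj z) = 0"
        using z f0(1) unfolding P0(2) by (simp add: V_def B_def real_points_def bpoly_eq_poly2)
      \<comment> \<open>Off the real axis neither z nor cnj z is a pole, so the values of
        \<open>Gamma\<close> are nonzero and the relation can be passed to
        \<open>rGamma\<close>.\<close>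
      have np: "z \<notin> \<int>\<^sub>\<le>\<^sub>0" "cnj z \<notin> \<int>\<^sub>\<le>\<^sub>0" using im by (auto elim!: nonpos_Ints_cases' simp: complex_eq_iff)
      have "(Re z, Im z) \<in> \<V> \<inter> (UNIV - Gamma_poles)" using z im by (simp add: V_def B_def F Gamma_poles_def)
      hence "Gamma_plane (Re z, Im z) \<in> real_points W" using img by blast
      hence "poly2 q (Re (Gamma z)) (Im (Gamma z)) = 0"
        using q(1) by (simp add: Gamma_plane_def real_points_def bpoly_eq_poly2)
      hence "poly2 R (Gamma z) (cnj (Gamma z)) = 0" by (simp add: R(2))
      moreover have "cnj (Gamma z) = Gamma (cnj z)" by (simp add: cnj_Gamma)
      ultimately show "poly2 Q0 (rGamma z) (rGamma (cnj z)) = 0"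
        using np by (intro Q0(2)) (simp_all add: rGamma_inverse_Gamma Gamma_eq_zero_iff)
    qed
    thus False using uncV by simp
  qed
  define axis where "axis = {[:0, 1:] :: real poly poly}"
  have axis: "real_points axis = {(x, 0) | x. x \<in> UNIV}"
    by (auto simp: axis_def real_points_def bpoly_eq_poly2)
  obtain V2 where V2: "B = real_points V2" using finite_real_points[OF \<open>finite B\<close>] by blast
  \<comment> \<open>The finite piece cannot be the whole infinite curve, so irreducibility leaves
    only the trace on the axis.\<close>
  have "\<V> = real_points (F \<union> axis) \<union> real_points V2"
    unfolding V2[symmetric] real_points_Int[symmetric] axis B_def F by force
  from irr[OF this] have "real_points (F \<union> axis) = \<V>" using V2 \<open>finite B\<close> inf by auto
  hence sub: "\<V> \<subseteq> {(x, 0) | x. x \<in> UNIV}" using real_points_Int[of F axis] axis by blast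
  \<comment> \<open>Each equation has infinitely many zeros on the axis, hence vanishes on all of
    it.\<close>
  have "(x, 0) \<in> \<V>" for x
  proof -
    have "bpoly f (x, 0) = 0" if f: "f \<in> F" for f
    proof -
      have inj: "inj_on fst \<V>" using sub by (auto simp: inj_on_def)
      have "fst ` \<V> \<subseteq> {x. poly (poly f [:0:]) x = 0}"
        using sub f unfolding F by (force simp: real_points_def bpoly_def)
      moreover have "infinite (fst ` \<V>)" using inf inj finite_imageD by blast
      ultimately have "poly f [:0:] = 0" using poly_roots_finite finite_subset by blast
      thus ?thesis by (simp add: bpoly_def)
    qed
    thus ?thesis by (auto simp: F real_points_def)
  qed
  thus ?thesis using sub by blast
qed

end
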